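(* Let $\alpha_1\in\,]0,1[$ and $a\in\mathbb R^2\setminus\alpha_1\mathbb Z^2$. Let $\mathcal F_a^{\alpha_1}\subset\mathcal T\!or_{1,2}$ be the corresponding leaf of Veech's foliation, $\mathscr F_a^{\alpha_1}\subset\mathscr M_{1,2}$ its image, and $\pi_a:\mathcal F_a^{\alpha_1}\to\mathscr F_a^{\alpha_1}$ the restriction of the quotient map. Then one of the following situations occurs: 1. the quotient mapping $\pi_a$ is trivial (an isomorphism), hence $\mathscr F_a^{\alpha_1}\simeq\mathbb H$; or 2. the quotient mapping $\pi_a$ is isomorphic to that of $\mathbb H$ by $\tau\mapsto\tau+1$, hence $\mathscr F_a^{\alpha_1}$ is conformally isomorphic to the infinite cylinder $\mathbb H/\langle\tau\mapsto\tau+1\rangle$; or 3. the leaf $\mathscr F_a^{\alpha_1}$ is algebraic. If $N$ stands for the smallest positive integer such that $Na\in\alpha_1\mathbb Z^2$, then $N\ge2$ and $\mathscr F_a^{\alpha_1}$ coincides with the image of the map $$\mathbb H/\Gamma_1(N)\to\mathscr M_{1,2},\qquad \Big(E_\tau,\Big[\tfrac1N\Big]\Big)\mapsto\Big(E_\tau,[0],\Big[\tfrac1N\Big]\Big),$$ hence is isomorphic to the modular curve $Y_1(N)=\mathbb H/\Gamma_1(N)$.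
   Context: For $\tau\in\mathbb H$: $\mathbb Z_\tau=\mathbb Z+\mathbb Z\tau$, $E_\tau=\mathbb C/\mathbb Z_\tau$. $\mathcal T\!or_{1,2}=\{(\tau,z_2)\in\mathbb H\times\mathbb C:z_2\notin\mathbb Z_\tau\}$. The group $\mathrm{SL}_2(\mathbb Z)\ltimes\mathbb Z^2$ acts on it by $\big(\begin{bmatrix} p & q \\ r & s \end{bmatrix},(k,l)\big)\cdot(\tau,z_2)=\big(\frac{p\tau+q}{r\tau+s},\frac{z_2+k+l\tau}{r\tau+s}\big)$ with quotient the moduli space $\mathscr M_{1,2}$ of elliptic curves with two marked points; $\mathscr M_{1,2}$ and its leaves are viewed as orbifolds. The leaves of Veech's foliation on $\mathcal T\!or_{1,2}$ are $\mathcal F_a^{\alpha_1}=\{(\tau,z_2):a_0\tau-\alpha_1z_2=a_\infty\}$, $a=(a_0,a_\infty)\in\mathbb R^2\setminus\alpha_1\mathbb Z^2$, each biholomorphic to $\mathbb H$ via $\tau$; the group permutes the leaves. $\Gamma_1(N)$ is the group of matrices $\begin{bmatrix} p & q \\ r & s \end{bmatrix}\in\mathrm{SL}_2(\mathbb Z)$ with $p\equiv s\equiv1$, $r\equiv0$ mod $N$. A leaf of $\mathscr M_{1,2}$ is algebraic if it is a closed algebraic subvariety. *)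

theory Defs
  imports
    "HOL-Complex_Analysis.Complex_Analysis"
    "HOL-Algebra.Elementary_Groups"
    "HOL-Number_Theory.Cong"
begin

section \<open>The space of marked tori and the modular group acting on it\<close>

definition upper_half :: "complex set" where
  "upper_half = {\<tau>. Im \<tau> > 0}"

definition period_lattice :: "complex \<Rightarrow> complex set" where
  "period_lattice \<tau> = {of_int m + of_int n * \<tau> | m n :: int. True}"

definition Tor12 :: "(complex \<times> complex) set" where
  "Tor12 = {(\<tau>, z). \<tau> \<in> upper_half \<and> z \<notin> period_lattice \<tau>}"

definition SL2Z :: "(int^2^2) monoid" where
  "SL2Z = \<lparr>carrier = {A. det A = 1}, mult = (**), one = mat 1\<rparr>"

definition moebius :: "int^2^2 \<Rightarrow> complex \<Rightarrow> complex" where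
  "moebius A \<tau> = (of_int (A$1$1) * \<tau> + of_int (A$1$2)) / (of_int (A$2$1) * \<tau> + of_int (A$2$2))"

(* The product of the semidirect product of SL2(Z) with Z^2 is the one for which tor_act below
   is a left action: the row vector attached to A ** B is (l, k) ** B + (l', k'). *)
definition affine_SL2Z :: "((int^2^2) \<times> (int \<times> int)) monoid" where
  "affine_SL2Z =
     \<lparr>carrier = carrier SL2Z \<times> UNIV,
      mult = (\<lambda>(A, (k, l)) (B, (k', l')).
        (A ** B, (k' + l * B$1$2 + k * B$2$2, l' + l * B$1$1 + k * B$2$1))),
      one = (mat 1, (0, 0))\<rparr>"

definition tor_act :: "(int^2^2) \<times> (int \<times> int) \<Rightarrow> complex \<times> complex \<Rightarrow> complex \<times> complex" where
  "tor_act = (\<lambda>(A, (k, l)) (\<tau>, z).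
     (moebius A \<tau>,
      (z + of_int k + of_int l * \<tau>) / (of_int (A$2$1) * \<tau> + of_int (A$2$2))))"

definition moduli_proj :: "complex \<times> complex \<Rightarrow> (complex \<times> complex) set" where
  "moduli_proj p = (\<lambda>g. tor_act g p) ` carrier affine_SL2Z"

definition M12 :: "(complex \<times> complex) set set" where
  "M12 = moduli_proj ` Tor12"

definition Gamma1 :: "nat \<Rightarrow> (int^2^2) monoid" where
  "Gamma1 N = SL2Z\<lparr>carrier := {A \<in> carrier SL2Z.
     [A$1$1 = 1] (mod int N) \<and> [A$2$2 = 1] (mod int N) \<and> [A$2$1 = 0] (mod int N)}\<rparr>"


section \<open>Veech's foliation\<close>

definition scaled_lattice :: "real \<Rightarrow> (real \<times> real) set" where
  "scaled_lattice \<alpha> = {(\<alpha> * of_int m, \<alpha> * of_int n) | m n :: int. True}"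

definition leaf :: "real \<Rightarrow> real \<times> real \<Rightarrow> (complex \<times> complex) set" where
  "leaf \<alpha> a = {(\<tau>, z) \<in> Tor12.
     complex_of_real (fst a) * \<tau> - complex_of_real \<alpha> * z = complex_of_real (snd a)}"

definition moduli_leaf :: "real \<Rightarrow> real \<times> real \<Rightarrow> (complex \<times> complex) set set" where
  "moduli_leaf \<alpha> a = moduli_proj ` leaf \<alpha> a"

definition leaf_stabilizer :: "real \<Rightarrow> real \<times> real \<Rightarrow> ((int^2^2) \<times> (int \<times> int)) monoid" where
  "leaf_stabilizer \<alpha> a =
     affine_SL2Z\<lparr>carrier := {g \<in> carrier affine_SL2Z. tor_act g ` leaf \<alpha> a = leaf \<alpha> a}\<rparr>"


section \<open>Quotient orbifolds\<close>

(* A one-dimensional complex orbifold presented as a quotient: a complex curve whose complex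
   structure is given by one injective global chart onto an open subset of the plane, a group
   acting on it (possibly not effectively, so that generic isotropy is recorded), and the
   quotient map to the underlying set. *)
record ('x, 'g, 'q) quotient_orbifold =
  cover :: "'x set"
  chart :: "'x \<Rightarrow> complex"
  deck :: "'g monoid"
  deck_act :: "'g \<Rightarrow> 'x \<Rightarrow> 'x"
  quot_map :: "'x \<Rightarrow> 'q"

definition points :: "('x, 'g, 'q) quotient_orbifold \<Rightarrow> 'q set" where
  "points X = quot_map X ` cover X"

definition biholomorphism ::
  "('x, 'g, 'q) quotient_orbifold \<Rightarrow> ('y, 'h, 'r) quotient_orbifold \<Rightarrow> ('x \<Rightarrow> 'y) \<Rightarrow> bool" where
  "biholomorphism X Y \<phi> \<longleftrightarrow>
     bij_betw \<phi> (cover X) (cover Y) \<and>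
     (\<lambda>w. chart Y (\<phi> (inv_into (cover X) (chart X) w)))
       holomorphic_on chart X ` cover X \<and>
     (\<lambda>w. chart X (inv_into (cover X) \<phi> (inv_into (cover Y) (chart Y) w)))
       holomorphic_on chart Y ` cover Y"

(* The map f between the underlying sets is an isomorphism of orbifolds, and it identifies
   the two quotient maps: f is covered by a biholomorphism phi which is equivariant along an
   isomorphism theta of the acting groups. All covers used here are copies of the upper half
   plane, hence simply connected, so every isomorphism of orbifolds arises in this way. When
   the groups act freely this says that f is a conformal isomorphism of Riemann surfaces. *)
definition orbifold_iso ::
  "('x, 'g, 'q) quotient_orbifold \<Rightarrow> ('y, 'h, 'r) quotient_orbifold \<Rightarrow> ('q \<Rightarrow> 'r) \<Rightarrow> bool" where
  "orbifold_iso X Y f \<longleftrightarrow>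
     bij_betw f (points X) (points Y) \<and>
     (\<exists>\<phi> \<theta>. biholomorphism X Y \<phi> \<and> \<theta> \<in> iso (deck X) (deck Y) \<and>
        (\<forall>g \<in> carrier (deck X). \<forall>x \<in> cover X.
           \<phi> (deck_act X g x) = deck_act Y (\<theta> g) (\<phi> x)) \<and>
        (\<forall>x \<in> cover X. f (quot_map X x) = quot_map Y (\<phi> x)))"

definition orbifold_isomorphic ::
  "('x, 'g, 'q) quotient_orbifold \<Rightarrow> ('y, 'h, 'r) quotient_orbifold \<Rightarrow> bool" where
  "orbifold_isomorphic X Y \<longleftrightarrow> (\<exists>f. orbifold_iso X Y f)"

definition trivial_quotient :: "'x set \<Rightarrow> ('x \<Rightarrow> complex) \<Rightarrow> ('x, unit, 'x) quotient_orbifold" where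
  "trivial_quotient S c =
     \<lparr>cover = S, chart = c, deck = singleton_group (),
      deck_act = (\<lambda>_ x. x), quot_map = (\<lambda>x. x)\<rparr>"

definition half_plane_quotient ::
  "'g monoid \<Rightarrow> ('g \<Rightarrow> complex \<Rightarrow> complex) \<Rightarrow> (complex, 'g, complex set) quotient_orbifold" where
  "half_plane_quotient G act =
     \<lparr>cover = upper_half, chart = (\<lambda>\<tau>. \<tau>), deck = G, deck_act = act,
      quot_map = (\<lambda>\<tau>. (\<lambda>g. act g \<tau>) ` carrier G)\<rparr>"

definition half_plane :: "(complex, unit, complex) quotient_orbifold" where
  "half_plane = trivial_quotient upper_half (\<lambda>\<tau>. \<tau>)"

definition infinite_cylinder :: "(complex, int, complex set) quotient_orbifold" where
  "infinite_cylinder = half_plane_quotient integer_group (\<lambda>n \<tau>. \<tau> + of_int n)"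

definition Y1 :: "nat \<Rightarrow> (complex, int^2^2, complex set) quotient_orbifold" where
  "Y1 N = half_plane_quotient (Gamma1 N) moebius"

definition leaf_curve ::
  "real \<Rightarrow> real \<times> real \<Rightarrow> (complex \<times> complex, unit, complex \<times> complex) quotient_orbifold" where
  "leaf_curve \<alpha> a = trivial_quotient (leaf \<alpha> a) fst"

(* The image of a leaf in M12 with the orbifold structure inherited from M12. Since the group
   permutes the leaves, the fibres of moduli_proj on a leaf are the orbits of its stabilizer,
   and the isotropy groups of points of the leaf are contained in that stabilizer. *)
definition leaf_orbifold ::
  "real \<Rightarrow> real \<times> real \<Rightarrow>
     (complex \<times> complex, (int^2^2) \<times> (int \<times> int), (complex \<times> complex) set) quotient_orbifold" where
  "leaf_orbifold \<alpha> a =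
     \<lparr>cover = leaf \<alpha> a, chart = fst, deck = leaf_stabilizer \<alpha> a,
      deck_act = tor_act, quot_map = moduli_proj\<rparr>"


section \<open>The algebraic structure of the moduli space\<close>

definition weierstrass_p :: "complex \<Rightarrow> complex \<Rightarrow> complex" where
  "weierstrass_p \<tau> z =
     1 / z\<^sup>2 + (\<Sum>\<^sub>\<infinity>\<omega>\<in>period_lattice \<tau> - {0}. 1 / (z - \<omega>)\<^sup>2 - 1 / \<omega>\<^sup>2)"

definition weierstrass_p' :: "complex \<Rightarrow> complex \<Rightarrow> complex" where
  "weierstrass_p' \<tau> z = - 2 * (\<Sum>\<^sub>\<infinity>\<omega>\<in>period_lattice \<tau>. 1 / (z - \<omega>) ^ 3)"

definition g2 :: "complex \<Rightarrow> complex" where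
  "g2 \<tau> = 60 * (\<Sum>\<^sub>\<infinity>\<omega>\<in>period_lattice \<tau> - {0}. 1 / \<omega> ^ 4)"

definition g3 :: "complex \<Rightarrow> complex" where
  "g3 \<tau> = 140 * (\<Sum>\<^sub>\<infinity>\<omega>\<in>period_lattice \<tau> - {0}. 1 / \<omega> ^ 6)"

(* M12 is a quasi-projective variety through its Weierstrass model: the class of (tau, z) goes
   to the point [p : p' : g2 : g3] of the weighted projective space P(2,3,4,6), which lies on
   y^2 = 4 x^3 - g2 x - g3 and off g2^3 = 27 g3^2. The polynomials to be used are thus
   the weighted homogeneous ones. Here d is the weighted degree, and the index set of
   the sum is finite. *)
definition weierstrass_poly ::
  "nat \<Rightarrow> (nat \<times> nat \<times> nat \<times> nat \<Rightarrow> complex) \<Rightarrow> complex \<times> complex \<Rightarrow> complex" where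
  "weierstrass_poly d c = (\<lambda>(\<tau>, z).
     \<Sum>(i, j, k, l) \<in> {(i, j, k, l). 2 * i + 3 * j + 4 * k + 6 * l = d}.
       c (i, j, k, l) * weierstrass_p \<tau> z ^ i * weierstrass_p' \<tau> z ^ j * g2 \<tau> ^ k * g3 \<tau> ^ l)"

definition zariski_closed :: "(complex \<times> complex) set set \<Rightarrow> bool" where
  "zariski_closed S \<longleftrightarrow> S \<subseteq> M12 \<and>
     (\<exists>P. \<forall>p \<in> Tor12.
        moduli_proj p \<in> S \<longleftrightarrow> (\<forall>(d, c) \<in> P. weierstrass_poly d c p = 0))"

definition zariski_irreducible :: "(complex \<times> complex) set set \<Rightarrow> bool" where
  "zariski_irreducible S \<longleftrightarrow> S \<noteq> {} \<and>
     (\<forall>A B. zariski_closed A \<and> zariski_closed B \<and> S \<subseteq> A \<union> B \<longrightarrow> S \<subseteq> A \<or> S \<subseteq> B)"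

definition closed_algebraic_subvariety :: "(complex \<times> complex) set set \<Rightarrow> bool" where
  "closed_algebraic_subvariety S \<longleftrightarrow> zariski_closed S \<and> zariski_irreducible S"

end

theory Submission
  imports Defs
begin

text \<open>Write a point of a leaf as \<open>(\<tau>, u \<tau> + v)\<close> with constant real \<open>(u, v)\<close>. The stabilizer of the leaf
  is isomorphic to the group of those \<open>A\<close> in \<open>SL\<^sub>2(\<int>)\<close> for which the row vector \<open>(u, v) A - (u, v)\<close>
  is integral. If some nontrivial \<open>A\<close> qualifies, a nontrivial integral combination of \<open>u\<close> and \<open>v\<close> is
  rational, and a change of basis makes \<open>u\<close> rational. If \<open>v\<close> is then irrational, the stabilizer is
  generated by a translation. If it is rational too, a further change of basis turns \<open>(u, v)\<close> into
  \<open>(0, 1/N)\<close> modulo \<open>\<int>\<^sup>2\<close>, whose stabilizer is \<open>\<Gamma>\<^sub>1(N)\<close>, and the leaf in the moduli space is the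
  locus of points of exact order \<open>N\<close>.

  This locus is irreducible because weighted homogeneous polynomials restrict to holomorphic functions
  of \<open>\<tau>\<close> on it. It is closed because of division functions: with an odd theta function \<open>\<theta>\<close> having
  simple zeros at the periods, and \<open>N = k M\<close>, the elliptic function
  \<open>\<theta>(N z) / (\<theta>(M z) \<theta>(z)\<^sup>d)\<close> with \<open>d = N\<^sup>2 - M\<^sup>2\<close> vanishes exactly where \<open>N z\<close> but not \<open>M z\<close> is a
  period. Its logarithmic derivative is expressed through the Weierstrass function, so that its
  normalized Laurent coefficients at the origin are weighted homogeneous polynomials in \<open>g\<^sub>2\<close> and \<open>g\<^sub>3\<close>,
  and hence its square is a weighted homogeneous polynomial in \<open>\<wp>\<close>, \<open>g\<^sub>2\<close> and \<open>g\<^sub>3\<close>.\<close>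

section \<open>Lattice sums\<close>

text \<open>Closedness asks for polynomials whose coefficients are the same for all \<tau>, whereas
  an argument with elliptic functions works for one \<tau> at a time and leaves the dependence of
  the coefficients on \<tau> open. The weights settle this: every coefficient that occurs is shown
  to be a fixed weighted form, and Liouville's theorem then compares functions on each torus
  separately. The theta function takes the place of the sigma function because its zeros and
  multipliers can be read off a power series. The price is a constant and a Gaussian factor
  exp(\<kappa> z^2), neither controlled in \<tau>; the Gaussian cancels because N^2 = M^2 + d, and
  the constant is divided out. The square is taken because d may be odd, and only an even function
  is a polynomial in \<wp> alone. A single M excludes only the M-torsion; the points of exact order
  N are the common zeros of the functions belonging to all proper divisors M of N.\<close>

definition lattice_point :: "complex \<Rightarrow> int \<times> int \<Rightarrow> complex" where
  "lattice_point \<tau> p = of_int (fst p) + of_int (snd p) * \<tau>"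

text \<open>The summand 1 keeps the size positive at the origin, so that one majorant by inverse
  cubes serves sums with and without the origin.\<close>

definition lattice_size :: "int \<times> int \<Rightarrow> real" where
  "lattice_size p = 1 + \<bar>of_int (fst p)\<bar> + \<bar>of_int (snd p)\<bar>"

lemma lattice_size_ge_1: "lattice_size p \<ge> 1"
  by (simp add: lattice_size_def)

lemma lattice_size_pos: "lattice_size p > 0"
  using lattice_size_ge_1[of p] by linarith

lemma period_lattice_eq_range: "period_lattice \<tau> = range (lattice_point \<tau>)"
  by (auto simp: period_lattice_def lattice_point_def image_def)

lemma summable_on_int_powr:
  assumes "s > 1"
  shows "(\<lambda>m::int. (1 + \<bar>of_int m\<bar>) powr -s :: real) summable_on UNIV"
proof -
  have "summable (\<lambda>n. of_nat (Suc n) powr -s :: real)"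
    using assms by (subst summable_Suc_iff, subst summable_real_powr_iff) auto
  hence *: "(\<lambda>n::nat. (1 + real n) powr -s) summable_on UNIV"
    by (intro summable_nonneg_imp_summable_on) auto
  have "(\<lambda>m::int. (1 + \<bar>of_int m\<bar>) powr -s :: real) summable_on range int"
    by (subst summable_on_reindex) (use * in \<open>auto simp: o_def\<close>)
  moreover have "(\<lambda>m::int. (1 + \<bar>of_int m\<bar>) powr -s :: real) summable_on range (\<lambda>n. - int n)"
    by (subst summable_on_reindex) (use * in \<open>auto simp: o_def inj_on_def\<close>)
  hence "(\<lambda>m::int. (1 + \<bar>of_int m\<bar>) powr -s :: real) summable_on (range (\<lambda>n. - int n) - range int)"
    by (rule summable_on_subset_banach) auto
  ultimately have "(\<lambda>m::int. (1 + \<bar>of_int m\<bar>) powr -s :: real) summable_on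
      (range int \<union> (range (\<lambda>n. - int n) - range int))"
    by (intro summable_on_Un_disjoint) auto
  also have "range int \<union> (range (\<lambda>n. - int n) - range int) = UNIV"
    using int_cases2 by blast
  finally show ?thesis .
qed

text \<open>Since (1+|m|)(1+|n|) \<le> size^2, the term is at most the product of (1+|m|)^(-3/2) and
  (1+|n|)^(-3/2), and both one-dimensional series converge because 3/2 > 1.\<close>

lemma summable_on_lattice_size: "(\<lambda>p. 1 / lattice_size p ^ 3) summable_on UNIV"
proof -
  let ?f = "\<lambda>m::int. (1 + \<bar>of_int m\<bar>) powr -(3/2) :: real"
  have f: "?f summable_on UNIV" by (rule summable_on_int_powr) simp
  have "(\<lambda>p. ?f (fst p) * ?f (snd p)) summable_on (UNIV \<times> UNIV)"
  proof (rule summable_on_SigmaI)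
    show "((\<lambda>y. ?f (fst (x, y)) * ?f (snd (x, y))) has_sum ?f x * infsum ?f UNIV) UNIV" for x
      using f by (auto intro!: has_sum_cmult_right)
    show "(\<lambda>x. ?f x * infsum ?f UNIV) summable_on UNIV"
      by (intro summable_on_cmult_left f)
  qed auto
  hence "(\<lambda>p. norm (?f (fst p) * ?f (snd p))) summable_on UNIV"
    by (simp add: abs_mult)
  moreover have "norm (1 / lattice_size p ^ 3) \<le> ?f (fst p) * ?f (snd p)" for p
  proof -
    let ?a = "1 + \<bar>of_int (fst p)\<bar> :: real" and ?b = "1 + \<bar>of_int (snd p)\<bar> :: real"
    have "?a * ?b \<le> lattice_size p * lattice_size p"
      unfolding lattice_size_def by (intro mult_mono) auto
    hence "(?a * ?b) powr (3/2) \<le> (lattice_size p * lattice_size p) powr (3/2)"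
      by (intro powr_mono2) auto
    also have "\<dots> = lattice_size p powr 3"
      using lattice_size_pos[of p] by (simp add: powr_mult flip: powr_add)
    also have "\<dots> = lattice_size p ^ 3"
      using lattice_size_pos[of p] by (simp add: powr_numeral)
    finally have "?a powr (3/2) * ?b powr (3/2) \<le> lattice_size p ^ 3"
      by (simp add: powr_mult)
    hence "1 / lattice_size p ^ 3 \<le> 1 / (?a powr (3/2) * ?b powr (3/2))"
      using lattice_size_pos[of p] by (intro divide_left_mono) auto
    thus ?thesis using lattice_size_pos[of p] by (simp add: powr_minus field_simps)
  qed
  hence "norm (1 / lattice_size p ^ 3) \<le> norm (?f (fst p) * ?f (snd p))" for p
    by simp
  ultimately have "(\<lambda>p. norm (1 / lattice_size p ^ 3)) summable_on UNIV"
    by (rule Infinite_Sum.abs_summable_on_comparison_test)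
  thus ?thesis by (rule Infinite_Sum.abs_summable_summable)
qed

lemma summable_on_lattice_sizeI:
  fixes f :: "int \<times> int \<Rightarrow> complex"
  assumes "\<And>p. p \<in> A \<Longrightarrow> norm (f p) \<le> C / lattice_size p ^ 3"
  shows "f summable_on A"
proof -
  have "(\<lambda>p. C * (1 / lattice_size p ^ 3)) summable_on A"
    by (intro summable_on_cmult_right summable_on_subset_banach[OF summable_on_lattice_size]) auto
  hence "(\<lambda>p. norm (C * (1 / lattice_size p ^ 3))) summable_on A"
    by (rule summable_on_iff_abs_summable_on_real[THEN iffD1])
  hence "(\<lambda>p. norm (f p)) summable_on A"
    by (rule Infinite_Sum.abs_summable_on_comparison_test)
       (use assms in \<open>auto intro!: order.trans[OF _ abs_ge_self] simp: real_norm_def simp del: abs_mult abs_divide\<close>)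
  thus ?thesis by (rule Infinite_Sum.abs_summable_summable)
qed

text \<open>Equivalence of norms on the plane: the imaginary part controls y, and then the triangle
  inequality controls x. The constant is uniform for \<tau> near \<tau>0, which later gives locally
  uniform convergence in \<tau>.\<close>

lemma upper_half_linear_form_bound:
  assumes "\<tau>0 \<in> upper_half"
  obtains c d where "c > 0" "d > 0" "cball \<tau>0 d \<subseteq> upper_half"
    "\<And>\<tau> x y. \<tau> \<in> cball \<tau>0 d \<Longrightarrow> c * (\<bar>x\<bar> + \<bar>y\<bar>) \<le> norm (complex_of_real x + complex_of_real y * \<tau>)"
proof -
  define h where "h = Im \<tau>0"
  have h: "h > 0" using assms by (simp add: h_def upper_half_def)
  \<comment> \<open>A radius of at most h/2 keeps Im \<tau> \<ge> h/2, and a radius of at most 1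
    bounds |\<tau>|. \<open>K\<close> collects the estimates |y| \<le> 2|w|/h and |x| \<le> |w| +
    |y| |\<tau>|.\<close>
  define d where "d = min (h / 2) 1"
  define K where "K = 1 + (2 + norm \<tau>0) * (2 / h)"
  have K: "K > 0" using h unfolding K_def by (auto intro!: add_pos_nonneg mult_nonneg_nonneg)
  have Im: "Im \<tau> \<ge> h / 2" "norm \<tau> \<le> norm \<tau>0 + 1" if "\<tau> \<in> cball \<tau>0 d" for \<tau>
  proof -
    have 1: "norm (\<tau>0 - \<tau>) \<le> d" using that by (simp add: dist_norm)
    have "\<bar>Im (\<tau>0 - \<tau>)\<bar> \<le> d" using abs_Im_le_cmod 1 order.trans by blast
    hence "\<bar>h - Im \<tau>\<bar> \<le> h / 2" by (simp add: d_def h_def)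
    thus "Im \<tau> \<ge> h / 2" by linarith
    have "norm \<tau> \<le> norm \<tau>0 + norm (\<tau>0 - \<tau>)" by norm
    thus "norm \<tau> \<le> norm \<tau>0 + 1" using 1 by (simp add: d_def)
  qed
  show ?thesis
  proof (rule that[of "1 / K" d])
    show "1 / K > 0" "d > 0" using K h by (auto simp: d_def)
    show "cball \<tau>0 d \<subseteq> upper_half"
    proof
      fix \<tau> assume "\<tau> \<in> cball \<tau>0 d"
      from Im(1)[OF this] show "\<tau> \<in> upper_half" using h by (simp add: upper_half_def)
    qed
  next
    fix \<tau> x y assume t: "\<tau> \<in> cball \<tau>0 d"
    define w where "w = complex_of_real x + complex_of_real y * \<tau>"
    have "\<bar>y\<bar> * Im \<tau> = \<bar>Im w\<bar>" using Im(1)[OF t] h by (simp add: w_def abs_mult)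
    also have "\<dots> \<le> norm w" by (rule abs_Im_le_cmod)
    finally have "\<bar>y\<bar> * (h / 2) \<le> norm w"
      using mult_left_mono[OF Im(1)[OF t], of "\<bar>y\<bar>"] by linarith
    hence y: "\<bar>y\<bar> \<le> norm w * (2 / h)" using h by (simp add: field_simps)
    have "\<bar>x\<bar> = norm (w - complex_of_real y * \<tau>)" by (simp add: w_def)
    also have "\<dots> \<le> norm w + norm (complex_of_real y * \<tau>)" by (rule norm_triangle_ineq4)
    also have "norm (complex_of_real y * \<tau>) \<le> \<bar>y\<bar> * (norm \<tau>0 + 1)"
      using Im(2)[OF t] by (simp add: norm_mult mult_left_mono)
    finally have "\<bar>x\<bar> + \<bar>y\<bar> \<le> norm w + \<bar>y\<bar> * (norm \<tau>0 + 2)" by (simp add: algebra_simps)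
    also have "\<dots> \<le> norm w + norm w * (2 / h) * (norm \<tau>0 + 2)"
      using y by (intro add_left_mono mult_right_mono) auto
    also have "\<dots> = norm w * K" by (simp add: K_def algebra_simps add_divide_distrib)
    finally show "1 / K * (\<bar>x\<bar> + \<bar>y\<bar>) \<le> norm (complex_of_real x + complex_of_real y * \<tau>)"
      using K by (simp add: w_def field_simps)
  qed
qed

lemma upper_half_coordinates:
  assumes "\<tau> \<in> upper_half"
  obtains x y where "z = complex_of_real x + complex_of_real y * \<tau>"
proof
  have "Im \<tau> \<noteq> 0" using assms by (simp add: upper_half_def)
  thus "z = complex_of_real (Re z - Im z / Im \<tau> * Re \<tau>) + complex_of_real (Im z / Im \<tau>) * \<tau>"
    by (simp add: complex_eq_iff)
qed

lemma upper_half_linear_form_eq_0: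
  assumes "\<tau> \<in> upper_half" "complex_of_real x + complex_of_real y * \<tau> = 0"
  shows "x = 0 \<and> y = 0"
proof -
  have "y * Im \<tau> = 0" using arg_cong[OF assms(2), of Im] by simp
  hence "y = 0" using assms(1) by (simp add: upper_half_def)
  thus ?thesis using assms(2) by simp
qed

lemma inj_lattice_point:
  assumes "\<tau> \<in> upper_half"
  shows "inj (lattice_point \<tau>)"
proof (rule injI)
  fix p q assume "lattice_point \<tau> p = lattice_point \<tau> q"
  hence "complex_of_real (of_int (fst p - fst q)) + complex_of_real (of_int (snd p - snd q)) * \<tau> = 0"
    by (simp add: lattice_point_def algebra_simps)
  from upper_half_linear_form_eq_0[OF assms this] show "p = q"
    by (simp add: prod_eq_iff)
qed

lemma lattice_point_0 [simp]: "lattice_point \<tau> (0, 0) = 0"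
  by (simp add: lattice_point_def)

lemma lattice_point_eq_0_iff:
  assumes "\<tau> \<in> upper_half"
  shows "lattice_point \<tau> p = 0 \<longleftrightarrow> p = (0, 0)"
  using inj_lattice_point[OF assms] lattice_point_0 by (metis injD)

lemma period_lattice_coordinates:
  assumes "\<tau> \<in> upper_half"
  shows "complex_of_real x + complex_of_real y * \<tau> \<in> period_lattice \<tau> \<longleftrightarrow> x \<in> \<int> \<and> y \<in> \<int>"
proof
  assume "complex_of_real x + complex_of_real y * \<tau> \<in> period_lattice \<tau>"
  then obtain m n where "complex_of_real x + complex_of_real y * \<tau> = of_int m + of_int n * \<tau>"
    by (auto simp: period_lattice_def)
  hence "complex_of_real (x - of_int m) + complex_of_real (y - of_int n) * \<tau> = 0"
    by (simp add: algebra_simps)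
  from upper_half_linear_form_eq_0[OF assms this] show "x \<in> \<int> \<and> y \<in> \<int>" by simp
next
  assume "x \<in> \<int> \<and> y \<in> \<int>"
  then obtain m n where "x = of_int m" "y = of_int n" by (auto elim!: Ints_cases)
  hence "complex_of_real x + complex_of_real y * \<tau> = of_int m + of_int n * \<tau>" by simp
  thus "complex_of_real x + complex_of_real y * \<tau> \<in> period_lattice \<tau>"
    unfolding period_lattice_def by blast
qed

lemma period_lattice_0 [simp]: "0 \<in> period_lattice \<tau>"
  unfolding period_lattice_def by (auto intro!: exI[of _ 0])

lemma period_lattice_add:
  assumes "z \<in> period_lattice \<tau>" "w \<in> period_lattice \<tau>"
  shows "z + w \<in> period_lattice \<tau>"
proof -
  obtain m n m' n' where "z = of_int m + of_int n * \<tau>" "w = of_int m' + of_int n' * \<tau>"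
    using assms by (auto simp: period_lattice_def)
  hence "z + w = of_int (m + m') + of_int (n + n') * \<tau>" by (simp add: algebra_simps)
  thus ?thesis unfolding period_lattice_def by blast
qed

lemma period_lattice_of_int_mult:
  assumes "z \<in> period_lattice \<tau>"
  shows "of_int k * z \<in> period_lattice \<tau>"
proof -
  obtain m n where "z = of_int m + of_int n * \<tau>"
    using assms by (auto simp: period_lattice_def)
  hence "of_int k * z = of_int (k * m) + of_int (k * n) * \<tau>" by (simp add: algebra_simps)
  thus ?thesis unfolding period_lattice_def by blast
qed

lemma period_lattice_uminus: "z \<in> period_lattice \<tau> \<Longrightarrow> -z \<in> period_lattice \<tau>"
  using period_lattice_of_int_mult[of z \<tau> "-1"] by simp

lemma period_lattice_diff: "z \<in> period_lattice \<tau> \<Longrightarrow> w \<in> period_lattice \<tau> \<Longrightarrow> z - w \<in> period_lattice \<tau>"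
  using period_lattice_add[of z \<tau> "-w"] period_lattice_uminus[of w \<tau>] by simp

lemma lattice_point_lower_bound:
  assumes "\<tau>0 \<in> upper_half"
  obtains c d where "c > 0" "d > 0" "cball \<tau>0 d \<subseteq> upper_half"
    "\<And>\<tau> p. \<tau> \<in> cball \<tau>0 d \<Longrightarrow> p \<noteq> (0, 0) \<Longrightarrow> c * lattice_size p \<le> norm (lattice_point \<tau> p)"
proof -
  obtain c d where cd: "c > 0" "d > 0" "cball \<tau>0 d \<subseteq> upper_half"
    "\<And>\<tau> x y. \<tau> \<in> cball \<tau>0 d \<Longrightarrow> c * (\<bar>x\<bar> + \<bar>y\<bar>) \<le> norm (complex_of_real x + complex_of_real y * \<tau>)"
    by (rule upper_half_linear_form_bound[OF assms]) blast
  show ?thesis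
  proof (rule that[of "c / 2" d])
    fix \<tau> and p :: "int \<times> int" assume t: "\<tau> \<in> cball \<tau>0 d" and p: "p \<noteq> (0, 0)"
    have "1 \<le> \<bar>fst p\<bar> + \<bar>snd p\<bar>" using p by (cases p) auto
    hence "1 \<le> \<bar>real_of_int (fst p)\<bar> + \<bar>real_of_int (snd p)\<bar>" by linarith
    \<comment> \<open>Off the origin |m| + |n| \<ge> 1 absorbs the summand 1 of the size, at the
      price of a factor 2.\<close>
    hence "lattice_size p \<le> 2 * (\<bar>of_int (fst p)\<bar> + \<bar>of_int (snd p)\<bar>)"
      by (simp add: lattice_size_def)
    hence "c / 2 * lattice_size p \<le> c / 2 * (2 * (\<bar>of_int (fst p)\<bar> + \<bar>of_int (snd p)\<bar>))"
      using cd(1) by (intro mult_left_mono) auto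
    also have "\<dots> \<le> norm (lattice_point \<tau> p)"
      using cd(4)[OF t, of "of_int (fst p)" "of_int (snd p)"] by (simp add: lattice_point_def algebra_simps)
    finally show "c / 2 * lattice_size p \<le> norm (lattice_point \<tau> p)" .
  qed (use cd in auto)
qed

text \<open>In real coordinates a point off the lattice has a positive distance e to the integer
  pairs; this takes care of the near lattice points, and the growth of the size takes care of the
  far ones.\<close>

lemma lattice_distance_bound:
  assumes "\<tau> \<in> upper_half" "z \<notin> period_lattice \<tau>"
  obtains c where "c > 0" "\<And>p. c * lattice_size p \<le> norm (z - lattice_point \<tau> p)"
proof -
  obtain c0 d where cd: "c0 > 0" "d > 0"
    "\<And>\<tau>' x y. \<tau>' \<in> cball \<tau> d \<Longrightarrow>
       c0 * (\<bar>x\<bar> + \<bar>y\<bar>) \<le> norm (complex_of_real x + complex_of_real y * \<tau>')"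
    by (rule upper_half_linear_form_bound[OF assms(1)]) blast
  obtain x y where z: "z = complex_of_real x + complex_of_real y * \<tau>"
    using upper_half_coordinates[OF assms(1)] .
  define e where "e = \<bar>x - of_int (round x)\<bar> + \<bar>y - of_int (round y)\<bar>"
  define B where "B = \<bar>x\<bar> + \<bar>y\<bar>"
  have B: "B \<ge> 0" by (simp add: B_def)
  have e: "e > 0"
  proof (rule ccontr)
    assume "\<not> e > 0"
    hence "x = of_int (round x)" "y = of_int (round y)" by (auto simp: e_def)
    hence "x \<in> \<int>" "y \<in> \<int>" by (metis Ints_of_int)+
    thus False using assms z period_lattice_coordinates by blast
  qed
  \<comment> \<open>With t \<ge> e and \<open>lattice_size p\<close> \<le> t + 1 + B, the best
    factor is the minimum of t/(t+1+B) over t \<ge> e, attained at t = e.\<close>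
  define l where "l = e / (e + B + 1)"
  have l: "l > 0" using e B by (simp add: l_def)
  have leB: "l * (e + B + 1) = e" using e B by (simp add: l_def)
  show ?thesis
  proof (rule that[of "c0 * l"])
    fix p
    define t where "t = \<bar>x - of_int (fst p)\<bar> + \<bar>y - of_int (snd p)\<bar>"
    have t1: "t \<ge> e" unfolding t_def e_def by (intro add_mono round_diff_minimal)
    have t2: "t \<ge> lattice_size p - 1 - B" unfolding t_def lattice_size_def B_def by linarith
    have "l * lattice_size p \<le> l * (t + 1 + B)" using t2 l by (intro mult_left_mono) auto
    also have "\<dots> = l * t + e - l * e" using leB by (simp add: algebra_simps)
    also have "\<dots> = t - (1 - l) * (t - e)" by (simp add: algebra_simps)
    also have "\<dots> \<le> t"
    proof -
      have "l \<le> 1" using e B by (simp add: l_def)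
      thus ?thesis using t1 by simp
    qed
    finally have "c0 * l * lattice_size p \<le> c0 * t" using cd(1) by (simp add: mult.assoc)
    also have "\<dots> \<le> norm (complex_of_real (x - of_int (fst p)) + complex_of_real (y - of_int (snd p)) * \<tau>)"
      using cd(3)[of \<tau> "x - of_int (fst p)" "y - of_int (snd p)"] cd(2) by (simp add: t_def)
    also have "\<dots> = norm (z - lattice_point \<tau> p)"
      by (simp add: z lattice_point_def algebra_simps)
    finally show "c0 * l * lattice_size p \<le> norm (z - lattice_point \<tau> p)" .
  qed (use cd l in auto)
qed

text \<open>Moving the point by c/2 costs at most half of the bound, because every size is at least
  1.\<close>

lemma lattice_distance_bound_cball:
  assumes "\<tau> \<in> upper_half" "z0 \<notin> period_lattice \<tau>"
  obtains c d where "c > 0" "d > 0"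
    "\<And>z p. z \<in> cball z0 d \<Longrightarrow> c * lattice_size p \<le> norm (z - lattice_point \<tau> p)"
proof -
  obtain c where c: "c > 0" "\<And>p. c * lattice_size p \<le> norm (z0 - lattice_point \<tau> p)"
    by (rule lattice_distance_bound[OF assms]) blast
  show ?thesis
  proof (rule that[of "c / 2" "c / 2"])
    fix z p assume z: "z \<in> cball z0 (c / 2)"
    have "norm (z0 - lattice_point \<tau> p) \<le> norm (z0 - z) + norm (z - lattice_point \<tau> p)" by norm
    moreover have "c / 2 * 1 \<le> c / 2 * lattice_size p"
      using c(1) lattice_size_ge_1[of p] by (intro mult_left_mono) auto
    hence "norm (z0 - z) \<le> c / 2 * lattice_size p"
      using z by (simp add: dist_norm)
    ultimately show "c / 2 * lattice_size p \<le> norm (z - lattice_point \<tau> p)"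
      using c(2)[of p] by simp
  qed (use c in auto)
qed

lemma lattice_point_lower_bound':
  assumes "\<tau> \<in> upper_half"
  obtains c where "c > 0" "\<And>p. p \<noteq> (0,0) \<Longrightarrow> c * lattice_size p \<le> norm (lattice_point \<tau> p)"
proof -
  obtain c d where "c > 0" "d > 0"
    "\<And>\<tau>' p. \<tau>' \<in> cball \<tau> d \<Longrightarrow> p \<noteq> (0, 0) \<Longrightarrow>
       c * lattice_size p \<le> norm (lattice_point \<tau>' p)"
    by (rule lattice_point_lower_bound[OF assms]) blast
  thus ?thesis using that[of c] by simp
qed

text \<open>Subtracting 1/w^2 gains one power of decay over 1/r^2, and inverse cubes are summable
  over the lattice.\<close>

lemma norm_inverse_square_diff_le:
  fixes z w :: complex
  assumes "norm z \<le> B" "r \<le> norm (z - w)" "r \<le> norm w" "r > 0"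
  shows "norm (1 / (z - w)\<^sup>2 - 1 / w\<^sup>2) \<le> 2 * B / r ^ 3"
proof -
  have nz: "z - w \<noteq> 0" "w \<noteq> 0" "w - z \<noteq> 0" using assms by auto
  \<comment> \<open>The difference a^2 - b^2 = (a - b)(a + b) with a = 1/(w - z) and b =
    1/w.\<close>
  have "1 / (z - w)\<^sup>2 - 1 / w\<^sup>2 = (z / ((w - z) * w)) * (1 / (w - z) + 1 / w)"
    using nz by (simp add: divide_simps) (simp add: algebra_simps power2_eq_square)
  also have "norm \<dots> \<le> (B / (r * r)) * (1 / r + 1 / r)"
    unfolding norm_mult norm_divide
  proof (intro mult_mono frac_le order.trans[OF norm_triangle_ineq] add_mono)
    show "norm (1 / (w - z)) \<le> 1 / r" "norm (1 / w) \<le> 1 / r"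
      unfolding norm_divide using assms by (auto intro!: frac_le simp: norm_minus_commute)
  qed (use assms order.trans[OF norm_ge_zero assms(1)] in \<open>auto simp: norm_minus_commute\<close>)
  also have "\<dots> = 2 * B / r ^ 3" using assms by (simp add: field_simps power3_eq_cube)
  finally show ?thesis .
qed

text \<open>Weierstrass's theorem on uniform limits. The majorant may depend on the point, since
  holomorphy is a local property.\<close>

lemma holomorphic_infsum:
  fixes f :: "'i \<Rightarrow> complex \<Rightarrow> complex"
  assumes S: "open S" and hol: "\<And>i. i \<in> I \<Longrightarrow> f i holomorphic_on S"
    and M: "\<And>x. x \<in> S \<Longrightarrow> \<exists>d>0. \<exists>M. M summable_on I \<and>
        (\<forall>i\<in>I. \<forall>y\<in>cball x d \<inter> S. norm (f i y) \<le> M i)"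
  shows "(\<lambda>y. \<Sum>\<^sub>\<infinity>i\<in>I. f i y) holomorphic_on S"
proof -
  have "\<exists>r>0. (\<lambda>y. \<Sum>\<^sub>\<infinity>i\<in>I. f i y) holomorphic_on ball x r" if x: "x \<in> S" for x
  proof -
    obtain d M where d: "d > 0" "M summable_on I" "\<forall>i\<in>I. \<forall>y\<in>cball x d \<inter> S. norm (f i y) \<le> M i"
      using M[OF x] by blast
    obtain e where e: "e > 0" "cball x e \<subseteq> S" using S x open_contains_cball by blast
    define r where "r = min d e"
    have r: "r > 0" "cball x r \<subseteq> S" using d e by (auto simp: r_def)
    have "uniform_limit (cball x r) (\<lambda>X y. \<Sum>i\<in>X. f i y) (\<lambda>y. \<Sum>\<^sub>\<infinity>i\<in>I. f i y) (finite_subsets_at_top I)"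
      by (rule Weierstrass_m_test_general[where M = M]) (use d r in \<open>auto simp: r_def\<close>)
    moreover have "\<forall>\<^sub>F X in finite_subsets_at_top I. continuous_on (cball x r) (\<lambda>y. \<Sum>i\<in>X. f i y)
        \<and> (\<lambda>y. \<Sum>i\<in>X. f i y) holomorphic_on ball x r"
    proof (rule eventually_finite_subsets_at_top_weakI)
      fix X assume X: "finite X" "X \<subseteq> I"
      have "(\<lambda>y. \<Sum>i\<in>X. f i y) holomorphic_on S"
        using hol X by (intro holomorphic_on_sum) auto
      thus "continuous_on (cball x r) (\<lambda>y. \<Sum>i\<in>X. f i y)
        \<and> (\<lambda>y. \<Sum>i\<in>X. f i y) holomorphic_on ball x r"
        by (meson r(2) ball_subset_cball continuous_on_subset holomorphic_on_imp_continuous_on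
            holomorphic_on_subset subset_trans)
    qed
    ultimately have "(\<lambda>y. \<Sum>\<^sub>\<infinity>i\<in>I. f i y) holomorphic_on ball x r"
      by (elim holomorphic_uniform_limit[rotated]) auto
    thus ?thesis using r by blast
  qed
  thus ?thesis
    by (meson S analytic_imp_holomorphic analytic_on_def)
qed

section \<open>Elliptic functions\<close>

text \<open>Behaviour at the lattice points is left open: they may be singularities of any kind, and
  periodicity is asked only off the lattice and for the two generators.\<close>

definition elliptic :: "complex \<Rightarrow> (complex \<Rightarrow> complex) \<Rightarrow> bool" where
  "elliptic \<tau> f \<longleftrightarrow> f holomorphic_on (- period_lattice \<tau>) \<and>
     (\<forall>z. z \<notin> period_lattice \<tau> \<longrightarrow> f (z + 1) = f z \<and> f (z + \<tau>) = f z)"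

lemma period_lattice_1 [simp]: "1 \<in> period_lattice \<tau>"
proof -
  have "1 = of_int 1 + of_int 0 * \<tau>" by simp
  thus ?thesis unfolding period_lattice_def by blast
qed

lemma period_lattice_period [simp]: "\<tau> \<in> period_lattice \<tau>"
proof -
  have "\<tau> = of_int 0 + of_int 1 * \<tau>" by simp
  thus ?thesis unfolding period_lattice_def by blast
qed

lemma period_lattice_add_iff [simp]:
  "w \<in> period_lattice \<tau> \<Longrightarrow> z + w \<in> period_lattice \<tau> \<longleftrightarrow> z \<in> period_lattice \<tau>"
  using period_lattice_add[of z \<tau> w] period_lattice_diff[of "z + w" \<tau> w] by auto

lemma period_lattice_uminus_iff [simp]: "- z \<in> period_lattice \<tau> \<longleftrightarrow> z \<in> period_lattice \<tau>"
  using period_lattice_uminus[of z \<tau>] period_lattice_uminus[of "-z" \<tau>] by auto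

lemma closed_period_lattice:
  assumes "\<tau> \<in> upper_half"
  shows "closed (period_lattice \<tau>)"
proof -
  have "\<exists>d>0. ball z d \<subseteq> - period_lattice \<tau>" if z: "z \<in> - period_lattice \<tau>" for z
  proof -
    obtain c where c: "c > 0" "\<And>p. c * lattice_size p \<le> norm (z - lattice_point \<tau> p)"
      by (rule lattice_distance_bound[OF assms, of z]) (use z in auto)
    have "c \<le> norm (z - lattice_point \<tau> p)" for p
    proof -
      have "c * 1 \<le> c * lattice_size p" using c(1) lattice_size_ge_1 by (intro mult_left_mono) auto
      thus ?thesis using c(2)[of p] by simp
    qed
    hence "ball z c \<subseteq> - period_lattice \<tau>"
      by (auto simp: period_lattice_eq_range dist_norm not_less[symmetric])
    thus ?thesis using c by blast
  qed
  hence "open (- period_lattice \<tau>)"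
    unfolding open_contains_ball by blast
  thus ?thesis by (simp add: closed_def)
qed

lemma period_lattice_inter_ball_0:
  assumes "\<tau> \<in> upper_half"
  obtains d where "d > 0" "ball 0 d \<inter> period_lattice \<tau> = {0}"
proof -
  obtain c where c: "c > 0"
    "\<And>p. p \<noteq> (0,0) \<Longrightarrow> c * lattice_size p \<le> norm (lattice_point \<tau> p)"
    by (rule lattice_point_lower_bound'[OF assms]) blast
  have "norm (lattice_point \<tau> p) \<ge> c" if "p \<noteq> (0,0)" for p
  proof -
    have "c * 1 \<le> c * lattice_size p"
      using c(1) lattice_size_ge_1[of p] by (intro mult_left_mono) auto
    thus ?thesis using c(2)[OF that] by simp
  qed
  hence "w = 0" if w: "w \<in> ball 0 c" "w \<in> period_lattice \<tau>" for w
  proof -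
    obtain p where p: "w = lattice_point \<tau> p"
      using w(2) unfolding period_lattice_eq_range by blast
    have "p = (0, 0)"
    proof (rule ccontr)
      assume "p \<noteq> (0, 0)"
      from \<open>\<And>p. p \<noteq> (0, 0) \<Longrightarrow> c \<le> norm (lattice_point \<tau> p)\<close>[OF this] w p show False by simp
    qed
    thus ?thesis using p by simp
  qed
  hence "ball 0 c \<inter> period_lattice \<tau> = {0}" using c(1) by auto
  thus ?thesis using that c(1) by blast
qed

lemma eventually_not_in_period_lattice:
  assumes "\<tau> \<in> upper_half"
  shows "\<forall>\<^sub>F z in at 0. z \<notin> period_lattice \<tau>"
proof -
  obtain d where d: "d > 0" "ball 0 d \<inter> period_lattice \<tau> = {0}"
    using period_lattice_inter_ball_0[OF assms] by blast
  have "z \<notin> period_lattice \<tau>" if "z \<noteq> 0" "dist z 0 < d" for z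
    using d(2) that by (auto simp: set_eq_iff)
  thus ?thesis using d(1) unfolding eventually_at by blast
qed

text \<open>The codomain is arbitrary, so that predicates of z can be transported along periods as
  well.\<close>

lemma periodic_of_int:
  fixes f :: "complex \<Rightarrow> 'b" and w :: complex
  assumes "\<And>z. f (z + w) = f z"
  shows "f (z + of_int m * w) = f z"
proof (induction m arbitrary: z rule: int_induct[where k = 0])
  case base
  thus ?case by simp
next
  case (step1 i)
  have "f (z + of_int (i + 1) * w) = f ((z + of_int i * w) + w)" by (simp add: algebra_simps)
  thus ?case using assms step1 by simp
next
  case (step2 i)
  have "f (z + of_int (i - 1) * w) = f ((z + of_int (i - 1) * w) + w)" using assms by simp
  also have "(z + of_int (i - 1) * w) + w = z + of_int i * w" by (simp add: algebra_simps)
  finally show ?case using step2 by simp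
qed

text \<open>A limit at 0 makes that singularity removable, and periodicity carries this to all
  lattice points. The resulting entire function takes all its values on a compact parallelogram, so
  Liouville's theorem applies.\<close>

lemma elliptic_constant:
  assumes \<tau>: "\<tau> \<in> upper_half" and f: "elliptic \<tau> f" and lim: "(f \<longlongrightarrow> l) (at 0)"
    and z: "z \<notin> period_lattice \<tau>"
  shows "f z = l"
proof -
  \<comment> \<open>The limit is prescribed on the whole lattice, which makes \<open>g\<close>
    periodic without exception.\<close>
  define g where "g w = (if w \<in> period_lattice \<tau> then l else f w)" for w
  have per: "g (w + 1) = g w" "g (w + \<tau>) = g w" for w
    using f by (auto simp: g_def elliptic_def)
  have g_per: "g (w + v) = g w" if v: "v \<in> period_lattice \<tau>" for w v
  proof -
    obtain m n where "v = of_int m + of_int n * \<tau>" using v by (auto simp: period_lattice_def)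
    hence "g (w + v) = g ((w + of_int m * 1) + of_int n * \<tau>)" by (simp add: algebra_simps)
    also have "\<dots> = g w"
      using periodic_of_int[of g \<tau>, OF per(2)] periodic_of_int[of g 1, OF per(1)] by simp
    finally show ?thesis .
  qed
  have op: "open (- period_lattice \<tau>)" using closed_period_lattice[OF \<tau>] by auto
  have "g holomorphic_on - period_lattice \<tau>"
    by (rule holomorphic_transform[of f]) (use f in \<open>auto simp: elliptic_def g_def\<close>)
  hence an: "g analytic_on {w}" if "w \<notin> period_lattice \<tau>" for w
    using that op analytic_at by blast
  obtain d where d: "d > 0" "ball 0 d \<inter> period_lattice \<tau> = {0}"
    using period_lattice_inter_ball_0[OF \<tau>] by blast
  have "(g \<longlongrightarrow> l) (at 0)"
    using lim by (rule Lim_transform_eventually)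
       (use eventually_not_in_period_lattice[OF \<tau>] in \<open>auto simp: g_def elim: eventually_mono\<close>)
  hence "isCont g 0" by (simp add: isCont_def g_def)
  hence "isCont g w" if w: "w \<in> ball 0 d" for w
  proof (cases "w = 0")
    case False
    hence "w \<notin> period_lattice \<tau>" using w d(2) by blast
    thus ?thesis by (intro analytic_at_imp_isCont an)
  qed simp
  hence "continuous_on (ball 0 d) g" by (simp add: continuous_at_imp_continuous_on)
  moreover have "g holomorphic_on (ball 0 d - {0})"
    by (rule holomorphic_on_subset[OF \<open>g holomorphic_on - period_lattice \<tau>\<close>]) (use d in auto)
  ultimately have "g holomorphic_on ball 0 d"
    by (intro no_isolated_singularity[of "ball 0 d" g "{0}"]) auto
  hence an0: "g analytic_on {0}" using d(1) unfolding analytic_at by (intro exI[of _ "ball 0 d"]) auto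
  have "g analytic_on {w}" if w: "w \<in> period_lattice \<tau>" for w
  proof -
    have "g = (\<lambda>v. g (v - w))" using g_per[of "-w"] w by auto
    moreover have "(\<lambda>v. g (v - w)) analytic_on {w}"
    proof -
      have "(\<lambda>v. v - w) analytic_on {w}" by (intro analytic_intros)
      from analytic_on_compose[OF this, of g] show ?thesis using an0 by (simp add: o_def)
    qed
    ultimately show ?thesis by simp
  qed
  with an have "g analytic_on UNIV" by (subst analytic_on_analytic_at) blast
  hence hol: "g holomorphic_on UNIV" by (rule analytic_imp_holomorphic)
  \<comment> \<open>The closed fundamental parallelogram; fractional parts of the real coordinates
    move any point into it.\<close>
  define K where "K = (\<lambda>(x::real,y::real). complex_of_real x + complex_of_real y * \<tau>) ` ({0..1} \<times> {0..1})"
  have "compact K" unfolding K_def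
    by (intro compact_continuous_image compact_Times)
       (auto simp: case_prod_unfold intro!: continuous_intros)
  hence "compact (g ` K)"
    using hol by (intro compact_continuous_image)
      (auto intro: continuous_on_subset holomorphic_on_imp_continuous_on)
  moreover have "range g \<subseteq> g ` K"
  proof safe
    fix w
    obtain x y where w: "w = complex_of_real x + complex_of_real y * \<tau>"
      using upper_half_coordinates[OF \<tau>] .
    define w' where "w' = complex_of_real (frac x) + complex_of_real (frac y) * \<tau>"
    have "w' + (of_int \<lfloor>x\<rfloor> + of_int \<lfloor>y\<rfloor> * \<tau>) = w"
      by (simp add: w w'_def frac_def algebra_simps)
    moreover have "of_int \<lfloor>x\<rfloor> + of_int \<lfloor>y\<rfloor> * \<tau> \<in> period_lattice \<tau>"
      by (auto simp: period_lattice_def)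
    ultimately have "g w = g w'" using g_per[of "of_int \<lfloor>x\<rfloor> + of_int \<lfloor>y\<rfloor> * \<tau>" w'] by simp
    moreover have "w' \<in> K"
      unfolding K_def w'_def by (rule image_eqI[of _ _ "(frac x, frac y)"])
         (auto intro: less_imp_le frac_lt_1)
    ultimately show "g w \<in> g ` K" by blast
  qed
  ultimately have "bounded (range g)"
    using bounded_subset compact_imp_bounded by blast
  from Liouville_theorem[OF hol this] obtain k where "\<And>w. g w = k"
    by (auto simp: constant_on_def)
  hence "g z = g 0" by simp
  thus ?thesis using z by (simp add: g_def)
qed

lemma elliptic_deriv:
  assumes \<tau>: "\<tau> \<in> upper_half" and f: "elliptic \<tau> f"
  shows "elliptic \<tau> (deriv f)"
  unfolding elliptic_def
proof (intro conjI allI impI)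
  have op: "open (- period_lattice \<tau>)" using closed_period_lattice[OF \<tau>] by auto
  show "deriv f holomorphic_on - period_lattice \<tau>"
    using f op by (auto simp: elliptic_def intro: holomorphic_deriv)
  fix z assume z: "z \<notin> period_lattice \<tau>"
  have *: "deriv f (z + w) = deriv f z"
    if w: "\<And>z. z \<notin> period_lattice \<tau> \<Longrightarrow> f (z + w) = f z" for w
  proof -
    have "deriv f (z + w) = deriv (\<lambda>v. f (v + w)) z"
      by (simp add: deriv_def DERIV_shift)
    also have "\<dots> = deriv f z"
      by (rule deriv_cong_ev)
         (use eventually_nhds_in_open[OF op, of z] z w in \<open>auto elim!: eventually_mono\<close>)
    finally show ?thesis .
  qed
  show "deriv f (z + 1) = deriv f z" "deriv f (z + \<tau>) = deriv f z"
    using f by (auto simp: elliptic_def intro!: *)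
qed

lemma elliptic_const: "elliptic \<tau> (\<lambda>_. c)"
  by (simp add: elliptic_def)

lemma elliptic_add: "elliptic \<tau> f \<Longrightarrow> elliptic \<tau> g \<Longrightarrow> elliptic \<tau> (\<lambda>z. f z + g z)"
  by (auto simp: elliptic_def intro!: holomorphic_intros)

lemma elliptic_diff: "elliptic \<tau> f \<Longrightarrow> elliptic \<tau> g \<Longrightarrow> elliptic \<tau> (\<lambda>z. f z - g z)"
  by (auto simp: elliptic_def intro!: holomorphic_intros)

lemma elliptic_mult: "elliptic \<tau> f \<Longrightarrow> elliptic \<tau> g \<Longrightarrow> elliptic \<tau> (\<lambda>z. f z * g z)"
  by (auto simp: elliptic_def intro!: holomorphic_intros)

lemma elliptic_power: "elliptic \<tau> f \<Longrightarrow> elliptic \<tau> (\<lambda>z. f z ^ n)"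
  by (auto simp: elliptic_def intro!: holomorphic_intros)

section \<open>The Weierstrass function\<close>

text \<open>At the origin the convention 1/0 = 0 turns the term into 1/z^2, so that \<wp> becomes a
  sum over all pairs with no exceptional term.\<close>

definition wp_term :: "complex \<Rightarrow> complex \<Rightarrow> int \<times> int \<Rightarrow> complex" where
  "wp_term \<tau> z p = 1 / (z - lattice_point \<tau> p)\<^sup>2 - 1 / (lattice_point \<tau> p)\<^sup>2"

lemma period_lattice_minus_0:
  assumes "\<tau> \<in> upper_half"
  shows "period_lattice \<tau> - {0} = lattice_point \<tau> ` (- {(0,0)})"
  using lattice_point_eq_0_iff[OF assms] by (auto simp: period_lattice_eq_range)

text \<open>Summation over pairs of integers has an index set that does not vary with \<tau>, as
  termwise holomorphy in \<tau> requires.\<close>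

lemma infsum_period_lattice_minus_0:
  assumes "\<tau> \<in> upper_half"
  shows "(\<Sum>\<^sub>\<infinity>\<omega>\<in>period_lattice \<tau> - {0}. f \<omega>) = (\<Sum>\<^sub>\<infinity>p\<in>-{(0,0)}. f (lattice_point \<tau> p))"
  unfolding period_lattice_minus_0[OF assms]
  by (subst infsum_reindex) (auto simp: o_def intro: inj_on_subset[OF inj_lattice_point[OF assms]])

lemma infsum_period_lattice:
  assumes "\<tau> \<in> upper_half"
  shows "(\<Sum>\<^sub>\<infinity>\<omega>\<in>period_lattice \<tau>. f \<omega>) = (\<Sum>\<^sub>\<infinity>p. f (lattice_point \<tau> p))"
  unfolding period_lattice_eq_range
  by (subst infsum_reindex) (auto simp: o_def inj_lattice_point[OF assms])

lemma wp_term_bound: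
  assumes "norm z \<le> B" "c > 0" "c * lattice_size p \<le> norm (z - lattice_point \<tau> p)"
    "c * lattice_size p \<le> norm (lattice_point \<tau> p)"
  shows "norm (wp_term \<tau> z p) \<le> (2 * B / c ^ 3) / lattice_size p ^ 3"
proof -
  have "norm (wp_term \<tau> z p) \<le> 2 * B / (c * lattice_size p) ^ 3"
    unfolding wp_term_def
    by (rule norm_inverse_square_diff_le) (use assms lattice_size_pos[of p] in auto)
  thus ?thesis by (simp add: power_mult_distrib field_simps)
qed

lemma wp_term_locally_bounded:
  assumes \<tau>: "\<tau> \<in> upper_half" and z0: "z0 \<notin> period_lattice \<tau>"
  obtains C d where "d > 0"
    "\<And>z p. z \<in> cball z0 d \<Longrightarrow> norm (wp_term \<tau> z p) \<le> C / lattice_size p ^ 3"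
proof -
  obtain c1 d where c1: "c1 > 0" "d > 0"
    "\<And>z p. z \<in> cball z0 d \<Longrightarrow> c1 * lattice_size p \<le> norm (z - lattice_point \<tau> p)"
    by (rule lattice_distance_bound_cball[OF \<tau> z0]) blast
  obtain c2 where c2: "c2 > 0" "\<And>p. p \<noteq> (0,0) \<Longrightarrow> c2 * lattice_size p \<le> norm (lattice_point \<tau> p)"
    by (rule lattice_point_lower_bound'[OF \<tau>]) blast
  define c where "c = min c1 c2"
  define B where "B = norm z0 + d"
  have c: "c > 0" "c \<le> c1" "c \<le> c2" using c1 c2 by (auto simp: c_def)
  show ?thesis
  \<comment> \<open>The second entry of the maximum serves the origin, where the term is 1/z^2 and
    the size is 1.\<close>
  proof (rule that[of d "max (2 * B / c ^ 3) (1 / c1\<^sup>2)"])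
    fix z p assume z: "z \<in> cball z0 d"
    have "norm z \<le> norm z0 + norm (z0 - z)" by norm
    hence B: "norm z \<le> B" using z by (simp add: B_def dist_norm)
    show "norm (wp_term \<tau> z p) \<le> max (2 * B / c ^ 3) (1 / c1\<^sup>2) / lattice_size p ^ 3"
    proof (cases "p = (0,0)")
      case True
      have "c1 \<le> norm z" using c1(3)[OF z, of p] True by (simp add: lattice_size_def)
      hence "1 / (norm z)\<^sup>2 \<le> 1 / c1\<^sup>2" using c1(1) by (intro frac_le power_mono) auto
      thus ?thesis using True by (simp add: wp_term_def norm_divide norm_power lattice_size_def)
    next
      case False
      have "norm (wp_term \<tau> z p) \<le> (2 * B / c ^ 3) / lattice_size p ^ 3"
      proof (rule wp_term_bound[OF B c(1)])
        show "c * lattice_size p \<le> norm (z - lattice_point \<tau> p)"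
          using c1(3)[OF z, of p] c(2) lattice_size_pos[of p] mult_right_mono[of c c1 "lattice_size p"]
          by linarith
        show "c * lattice_size p \<le> norm (lattice_point \<tau> p)"
          using c2(2)[OF False] c(3) lattice_size_pos[of p] mult_right_mono[of c c2 "lattice_size p"]
          by linarith
      qed
      also have "\<dots> \<le> max (2 * B / c ^ 3) (1 / c1\<^sup>2) / lattice_size p ^ 3"
        using lattice_size_pos[of p] by (intro divide_right_mono) auto
      finally show ?thesis .
    qed
  qed (use c1 in auto)
qed

lemma wp_term_summable:
  assumes "\<tau> \<in> upper_half" "z \<notin> period_lattice \<tau>"
  shows "wp_term \<tau> z summable_on A"
proof -
  obtain C d where Cd: "d > 0"
    "\<And>w p. w \<in> cball z d \<Longrightarrow> norm (wp_term \<tau> w p) \<le> C / lattice_size p ^ 3"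
    by (rule wp_term_locally_bounded[OF assms]) blast
  show ?thesis
    by (rule summable_on_lattice_sizeI[of _ _ C]) (use Cd in auto)
qed

lemma weierstrass_p_eq:
  assumes "\<tau> \<in> upper_half"
  shows "weierstrass_p \<tau> z = 1 / z\<^sup>2 + (\<Sum>\<^sub>\<infinity>p\<in>-{(0,0)}. wp_term \<tau> z p)"
  by (simp add: weierstrass_p_def infsum_period_lattice_minus_0[OF assms] wp_term_def)

lemma weierstrass_p_eq_infsum:
  assumes "\<tau> \<in> upper_half" "z \<notin> period_lattice \<tau>"
  shows "weierstrass_p \<tau> z = (\<Sum>\<^sub>\<infinity>p. wp_term \<tau> z p)"
proof -
  have "(\<Sum>\<^sub>\<infinity>p\<in>{(0,0)} \<union> -{(0,0)}. wp_term \<tau> z p) =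
      (\<Sum>\<^sub>\<infinity>p\<in>{(0,0)}. wp_term \<tau> z p) + (\<Sum>\<^sub>\<infinity>p\<in>-{(0,0)}. wp_term \<tau> z p)"
    by (intro infsum_Un_disjoint wp_term_summable[OF assms]) auto
  thus ?thesis by (simp add: weierstrass_p_eq[OF assms(1)] wp_term_def)
qed

text \<open>\<open>f\<close> itself may fail to be summable over all pairs, as inverse squares do,
  but each row converges. Summed row by row, the differences telescope to 0 in every row.\<close>

lemma infsum_telescope_snd:
  fixes f :: "int \<times> int \<Rightarrow> complex"
  assumes "\<And>m. (\<lambda>n. f (m, n)) summable_on UNIV"
    "(\<lambda>p. f (fst p, snd p - 1) - f p) summable_on UNIV"
  shows "(\<Sum>\<^sub>\<infinity>p. f (fst p, snd p - 1) - f p) = 0"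
proof -
  define S where "S = (\<Sum>\<^sub>\<infinity>p. f (fst p, snd p - 1) - f p)"
  have "((\<lambda>p. f (fst p, snd p - 1) - f p) has_sum S) (UNIV \<times> UNIV)"
    using assms(2) by (simp add: S_def)
  hence "((\<lambda>_. 0) has_sum S) (UNIV :: int set)"
  proof (rule has_sum_SigmaD)
    fix m :: int
    have s: "((\<lambda>n. f (m, n)) has_sum infsum (\<lambda>n. f (m, n)) UNIV) UNIV"
      using assms(1) by simp
    have "bij_betw (\<lambda>n::int. n - 1) UNIV UNIV"
      by (rule bij_betwI[of _ _ _ "\<lambda>n. n + 1"]) auto
    from has_sum_reindex_bij_betw[OF this, of "\<lambda>n. f (m, n)"] s
    have "((\<lambda>n. f (m, n - 1)) has_sum infsum (\<lambda>n. f (m, n)) UNIV) UNIV" by simp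
    moreover have "((\<lambda>n. - f (m, n)) has_sum - infsum (\<lambda>n. f (m, n)) UNIV) UNIV"
      using s by (simp add: has_sum_uminus)
    ultimately have "((\<lambda>n. f (m, n - 1) + - f (m, n)) has_sum
        infsum (\<lambda>n. f (m, n)) UNIV + - infsum (\<lambda>n. f (m, n)) UNIV) UNIV"
      by (rule has_sum_add)
    thus "((\<lambda>y. f (fst (m, y), snd (m, y) - 1) - f (m, y)) has_sum 0) UNIV" by simp
  qed
  hence "S = 0" using has_sum_0_simp has_sum_unique by blast
  thus ?thesis by (simp add: S_def)
qed

lemma infsum_telescope_fst:
  fixes f :: "int \<times> int \<Rightarrow> complex"
  assumes "\<And>n. (\<lambda>m. f (m, n)) summable_on UNIV"
    "(\<lambda>p. f (fst p - 1, snd p) - f p) summable_on UNIV"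
  shows "(\<Sum>\<^sub>\<infinity>p. f (fst p - 1, snd p) - f p) = 0"
proof -
  let ?g = "\<lambda>p. f (fst p - 1, snd p) - f p"
  have bij: "bij_betw prod.swap (UNIV :: (int \<times> int) set) UNIV" by (rule bij_swap)
  have "(\<Sum>\<^sub>\<infinity>p. ?g p) = (\<Sum>\<^sub>\<infinity>p. ?g (prod.swap p))"
    by (rule infsum_reindex_bij_betw[OF bij, symmetric])
  also have "\<dots> = 0"
    using infsum_telescope_snd[of "f \<circ> prod.swap"] assms
      summable_on_reindex_bij_betw[OF bij, of ?g]
    by (simp add: o_def)
  finally show ?thesis .
qed

lemma summable_on_int_inverse_square:
  fixes f :: "int \<Rightarrow> complex"
  assumes "c > 0" "\<And>m. c * (1 + \<bar>of_int m\<bar>) \<le> norm (f m)"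
  shows "(\<lambda>m. 1 / (f m)\<^sup>2) summable_on UNIV"
proof (rule Infinite_Sum.abs_summable_summable)
  have "(\<lambda>m::int. 1 / c\<^sup>2 * (1 + \<bar>of_int m\<bar>) powr -2 :: real) summable_on UNIV"
    by (intro summable_on_cmult_right summable_on_int_powr) auto
  hence "(\<lambda>m::int. norm (1 / c\<^sup>2 * (1 + \<bar>of_int m\<bar>) powr -2 :: real)) summable_on UNIV"
    by (rule summable_on_iff_abs_summable_on_real[THEN iffD1])
  thus "(\<lambda>m. norm (1 / (f m)\<^sup>2)) summable_on UNIV"
  proof (rule Infinite_Sum.abs_summable_on_comparison_test)
    fix m :: int
    have "1 / (norm (f m))\<^sup>2 \<le> 1 / (c * (1 + \<bar>of_int m\<bar>))\<^sup>2"
      using assms by (intro frac_le power_mono) (auto intro!: add_pos_nonneg)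
    also have "\<dots> = 1 / c\<^sup>2 * (1 + \<bar>of_int m\<bar>) powr -2"
      by (simp add: powr_minus powr_numeral power_mult_distrib divide_simps)
    finally show "norm (1 / (f m)\<^sup>2) \<le> norm (1 / c\<^sup>2 * (1 + \<bar>of_int m\<bar>) powr -2 :: real)"
      by (simp add: norm_divide norm_power)
  qed
qed

text \<open>In the difference of two values the terms 1/\<omega>^2 cancel, and translating z by a
  period shifts the index of the inverse squares by one: the sum telescopes.\<close>

lemma weierstrass_p_periodic:
  assumes \<tau>: "\<tau> \<in> upper_half" and z: "z \<notin> period_lattice \<tau>"
  shows "weierstrass_p \<tau> (z + 1) = weierstrass_p \<tau> z"
    and "weierstrass_p \<tau> (z + \<tau>) = weierstrass_p \<tau> z"
proof -
  define f where "f p = 1 / (z - lattice_point \<tau> p)\<^sup>2" for p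
  obtain c where c: "c > 0" "\<And>p. c * lattice_size p \<le> norm (z - lattice_point \<tau> p)"
    by (rule lattice_distance_bound[OF \<tau> z]) blast
  have sum1: "(\<lambda>m. f (m, n)) summable_on UNIV" for n
    unfolding f_def
  proof (rule summable_on_int_inverse_square[OF c(1)])
    fix m :: int
    have "c * (1 + \<bar>of_int m\<bar>) \<le> c * lattice_size (m, n)"
      using c(1) by (intro mult_left_mono) (auto simp: lattice_size_def)
    thus "c * (1 + \<bar>of_int m\<bar>) \<le> norm (z - lattice_point \<tau> (m, n))"
      using c(2)[of "(m, n)"] by simp
  qed
  have sum2: "(\<lambda>n. f (m, n)) summable_on UNIV" for m
    unfolding f_def
  proof (rule summable_on_int_inverse_square[OF c(1)])
    fix n :: int
    have "c * (1 + \<bar>of_int n\<bar>) \<le> c * lattice_size (m, n)"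
      using c(1) by (intro mult_left_mono) (auto simp: lattice_size_def)
    thus "c * (1 + \<bar>of_int n\<bar>) \<le> norm (z - lattice_point \<tau> (m, n))"
      using c(2)[of "(m, n)"] by simp
  qed
  have z1: "z + 1 \<notin> period_lattice \<tau>" "z + \<tau> \<notin> period_lattice \<tau>" using z by auto
  have d1: "wp_term \<tau> (z + 1) p - wp_term \<tau> z p = f (fst p - 1, snd p) - f p" for p
    by (simp add: wp_term_def f_def lattice_point_def algebra_simps)
  have d2: "wp_term \<tau> (z + \<tau>) p - wp_term \<tau> z p = f (fst p, snd p - 1) - f p" for p
    by (simp add: wp_term_def f_def lattice_point_def algebra_simps)
  have diff: "weierstrass_p \<tau> w - weierstrass_p \<tau> z = (\<Sum>\<^sub>\<infinity>p. wp_term \<tau> w p - wp_term \<tau> z p)"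
    "(\<lambda>p. wp_term \<tau> w p - wp_term \<tau> z p) summable_on UNIV"
    if w: "w \<notin> period_lattice \<tau>" for w
  proof -
    have "((\<lambda>p. wp_term \<tau> w p + - wp_term \<tau> z p) has_sum
        (\<Sum>\<^sub>\<infinity>p. wp_term \<tau> w p) + - (\<Sum>\<^sub>\<infinity>p. wp_term \<tau> z p)) UNIV"
      by (intro has_sum_add) (simp_all add: has_sum_uminus wp_term_summable \<tau> w z)
    thus "weierstrass_p \<tau> w - weierstrass_p \<tau> z = (\<Sum>\<^sub>\<infinity>p. wp_term \<tau> w p - wp_term \<tau> z p)"
      "(\<lambda>p. wp_term \<tau> w p - wp_term \<tau> z p) summable_on UNIV"
      by (auto simp: weierstrass_p_eq_infsum \<tau> w z has_sum_iff)
  qed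
  have "weierstrass_p \<tau> (z + 1) - weierstrass_p \<tau> z = 0"
    using diff[OF z1(1)] infsum_telescope_fst[OF sum1] by (simp add: d1)
  thus "weierstrass_p \<tau> (z + 1) = weierstrass_p \<tau> z" by simp
  have "weierstrass_p \<tau> (z + \<tau>) - weierstrass_p \<tau> z = 0"
    using diff[OF z1(2)] infsum_telescope_snd[OF sum2] by (simp add: d2)
  thus "weierstrass_p \<tau> (z + \<tau>) = weierstrass_p \<tau> z" by simp
qed

lemma elliptic_weierstrass_p:
  assumes \<tau>: "\<tau> \<in> upper_half"
  shows "elliptic \<tau> (weierstrass_p \<tau>)"
proof -
  have "(\<lambda>z. \<Sum>\<^sub>\<infinity>p. wp_term \<tau> z p) holomorphic_on (- period_lattice \<tau>)"
  proof (rule holomorphic_infsum)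
    show "open (- period_lattice \<tau>)" using closed_period_lattice[OF \<tau>] by auto
    show "(\<lambda>z. wp_term \<tau> z p) holomorphic_on - period_lattice \<tau>" for p
      unfolding wp_term_def by (intro holomorphic_intros) (auto simp: period_lattice_eq_range)
    fix z assume "z \<in> - period_lattice \<tau>"
    hence z: "z \<notin> period_lattice \<tau>" by simp
    obtain C d where Cd: "d > 0"
      "\<And>w p. w \<in> cball z d \<Longrightarrow> norm (wp_term \<tau> w p) \<le> C / lattice_size p ^ 3"
      by (rule wp_term_locally_bounded[OF \<tau> z]) blast
    have "(\<lambda>p. C * (1 / lattice_size p ^ 3)) summable_on UNIV"
      by (intro summable_on_cmult_right summable_on_lattice_size)
    thus "\<exists>d>0. \<exists>M. M summable_on UNIV \<and>
      (\<forall>p\<in>UNIV. \<forall>w\<in>cball z d \<inter> - period_lattice \<tau>. norm (wp_term \<tau> w p) \<le> M p)"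
      using Cd by (auto intro!: exI[of _ d] exI[of _ "\<lambda>p. C * (1 / lattice_size p ^ 3)"])
  qed
  hence "weierstrass_p \<tau> holomorphic_on (- period_lattice \<tau>)"
    by (rule holomorphic_transform) (simp add: weierstrass_p_eq_infsum \<tau>)
  thus ?thesis using weierstrass_p_periodic[OF \<tau>] by (simp add: elliptic_def)
qed

section \<open>The differential equation and the graded ring\<close>

text \<open>The Eisenstein series of weight n, absolutely convergent for n \<ge> 3.\<close>

definition lattice_sum :: "complex \<Rightarrow> nat \<Rightarrow> complex" where
  "lattice_sum \<tau> n = (\<Sum>\<^sub>\<infinity>p\<in>-{(0,0)}. 1 / lattice_point \<tau> p ^ n)"

definition wp_regular :: "complex \<Rightarrow> complex \<Rightarrow> complex" where
  "wp_regular \<tau> z = (\<Sum>\<^sub>\<infinity>p\<in>-{(0,0)}. wp_term \<tau> z p)"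

text \<open>The Laurent series of \<wp> at 0 without the term 1/z^2. Its constant coefficient is 0
  since the terms 1/\<omega>^2 are subtracted; the general formula at n = 0 would involve the series
  of weight 2, which does not converge absolutely.\<close>

definition wp_fps :: "complex \<Rightarrow> complex fps" where
  "wp_fps \<tau> = Abs_fps (\<lambda>n. if n = 0 then 0 else of_nat (Suc n) * lattice_sum \<tau> (n + 2))"

lemma g2_eq: "\<tau> \<in> upper_half \<Longrightarrow> g2 \<tau> = 60 * lattice_sum \<tau> 4"
  by (simp add: g2_def lattice_sum_def infsum_period_lattice_minus_0)

lemma g3_eq: "\<tau> \<in> upper_half \<Longrightarrow> g3 \<tau> = 140 * lattice_sum \<tau> 6"
  by (simp add: g3_def lattice_sum_def infsum_period_lattice_minus_0)

lemma lattice_sum_odd: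
  assumes "odd n"
  shows "lattice_sum \<tau> n = 0"
proof -
  let ?h = "\<lambda>p. (- fst p, - snd p) :: int \<times> int"
  have bij: "bij_betw ?h (-{(0,0)}) (-{(0,0)})"
    by (rule bij_betwI[of _ _ _ ?h]) auto
  have "lattice_sum \<tau> n = (\<Sum>\<^sub>\<infinity>p\<in>-{(0,0)}. 1 / lattice_point \<tau> (?h p) ^ n)"
    unfolding lattice_sum_def by (rule infsum_reindex_bij_betw[OF bij, symmetric])
  also have "(\<lambda>p. 1 / lattice_point \<tau> (?h p) ^ n) = (\<lambda>p. - (1 / lattice_point \<tau> p ^ n))"
  proof
    fix p
    have "lattice_point \<tau> (?h p) = - lattice_point \<tau> p" by (simp add: lattice_point_def)
    thus "1 / lattice_point \<tau> (?h p) ^ n = - (1 / lattice_point \<tau> p ^ n)"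
      using assms by (simp add: power_minus_odd)
  qed
  finally show ?thesis by (simp add: infsum_uminus lattice_sum_def)
qed

lemma wp_fps_odd: "odd n \<Longrightarrow> fps_nth (wp_fps \<tau>) n = 0"
  by (auto simp: wp_fps_def lattice_sum_odd)

lemma wp_fps_0_1 [simp]: "fps_nth (wp_fps \<tau>) 0 = 0" "fps_nth (wp_fps \<tau>) (Suc 0) = 0"
  by (simp_all add: wp_fps_def lattice_sum_odd)

lemma weierstrass_p_eq_regular:
  "\<tau> \<in> upper_half \<Longrightarrow> weierstrass_p \<tau> z = 1 / z\<^sup>2 + wp_regular \<tau> z"
  by (simp add: weierstrass_p_eq wp_regular_def)

text \<open>The derivative of the geometric series in z/w; subtracting 1/w^2 removes its constant
  term.\<close>

lemma wp_term_sums: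
  assumes "norm z < norm w" "w = lattice_point \<tau> p"
  shows "(\<lambda>n. if n = 0 then 0 else of_nat (Suc n) * z ^ n / w ^ (n + 2)) sums wp_term \<tau> z p"
proof -
  have w: "w \<noteq> 0" "w - z \<noteq> 0" using assms(1) by auto
  have "norm (z / w) < 1" using assms(1) w by (simp add: norm_divide)
  from sums_mult[OF geometric_deriv_sums[OF this], of "1 / w\<^sup>2"]
  have "(\<lambda>n. of_nat (Suc n) * z ^ n / w ^ (n + 2)) sums (1 / w\<^sup>2 * (1 / (1 - z / w)\<^sup>2))"
    by (simp add: power_divide power_add mult_ac power2_eq_square)
  also have "1 / w\<^sup>2 * (1 / (1 - z / w)\<^sup>2) = 1 / (z - w)\<^sup>2"
  proof -
    have "w\<^sup>2 * (1 - z / w)\<^sup>2 = (z - w)\<^sup>2"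
      using w by (simp add: field_simps power2_eq_square)
    thus ?thesis by (simp flip: power_mult_distrib)
  qed
  finally have "(\<lambda>n. of_nat (Suc n) * z ^ n / w ^ (n + 2)) sums (1 / (z - w)\<^sup>2)" .
  moreover have "(\<lambda>n. if n = 0 then 1 / w\<^sup>2 else 0) sums (1 / w\<^sup>2)"
    using sums_single[of 0 "\<lambda>_. 1 / w\<^sup>2"] by simp
  ultimately have "(\<lambda>n. of_nat (Suc n) * z ^ n / w ^ (n + 2) - (if n = 0 then 1 / w\<^sup>2 else 0)) sums
      (1 / (z - w)\<^sup>2 - 1 / w\<^sup>2)"
    by (rule sums_diff)
  also have "(\<lambda>n. of_nat (Suc n) * z ^ n / w ^ (n + 2) - (if n = 0 then 1 / w\<^sup>2 else 0)) =
      (\<lambda>n. if n = 0 then 0 else of_nat (Suc n) * z ^ n / w ^ (n + 2))"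
    by (auto simp: fun_eq_iff power2_eq_square)
  finally show ?thesis using assms(2) by (simp add: wp_term_def)
qed

text \<open>Each lattice term is expanded in powers of z, and the two summations are exchanged. This
  rests on the majorant \<open>a n * b p\<close> of the double family, with \<open>a\<close> from
  the derivative of the geometric series and \<open>b\<close> from inverse cubes.\<close>

lemma wp_regular_sums:
  assumes \<tau>: "\<tau> \<in> upper_half"
  obtains c where "c > 0" "\<And>z. norm z \<le> c \<Longrightarrow> (\<lambda>n. fps_nth (wp_fps \<tau>) n * z ^ n) sums wp_regular \<tau> z"
proof -
  obtain c0 where c0: "c0 > 0" "\<And>p. p \<noteq> (0,0) \<Longrightarrow> c0 * lattice_size p \<le> norm (lattice_point \<tau> p)"
    by (rule lattice_point_lower_bound'[OF \<tau>]) blast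
  \<comment> \<open>Halving leaves |z| \<le> |\<omega>|/2 on the disc, so that the geometric ratio
    is at most 1/2.\<close>
  define c where "c = c0 / 2"
  have c: "c > 0" "\<And>p. p \<noteq> (0,0) \<Longrightarrow> 2 * c * lattice_size p \<le> norm (lattice_point \<tau> p)"
    using c0 by (simp_all add: c_def)
  have sums: "(\<lambda>n. fps_nth (wp_fps \<tau>) n * z ^ n) sums wp_regular \<tau> z" if z: "norm z \<le> c" for z
  proof -
    define t where "t n p = (if n = 0 then 0 else of_nat (Suc n) * z ^ n / lattice_point \<tau> p ^ (n + 2))"
      for n p
    define a :: "nat \<Rightarrow> real" where "a n = of_nat (Suc n) * (1 / 2) ^ n" for n
    define K where "K = 1 / (2 * c)\<^sup>2"
    define b where "b p = K * (1 / lattice_size p ^ 3)" for p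
    have "2 * c * lattice_size p \<ge> 2 * c" for p
      using mult_left_mono[OF lattice_size_ge_1[of p], of "2 * c"] c(1) by simp
    hence L2c: "2 * c \<le> norm (lattice_point \<tau> p)" if "p \<noteq> (0,0)" for p
      using c(2)[OF that] order.trans by blast
    have bound: "norm (t n p) \<le> a n * b p" if p: "p \<noteq> (0,0)" for n p
    proof (cases n)
      case 0
      thus ?thesis using lattice_size_pos[of p] by (simp add: t_def a_def b_def K_def)
    next
      case (Suc m)
      define L where "L = norm (lattice_point \<tau> p)"
      have L: "2 * c \<le> L" "2 * c * lattice_size p \<le> L" "L > 0"
        using L2c[OF p] c(2)[OF p] c(1) by (auto simp: L_def)
      have "norm (t n p) = of_nat (Suc n) * ((norm z / L) ^ n * (1 / L\<^sup>2))"
        using Suc by (simp add: t_def L_def norm_mult norm_divide norm_power power_divide power_add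
            power2_eq_square del: of_nat_Suc)
      \<comment> \<open>One factor |z| is set apart: the other n - 1 give the geometric decay, and
        |z|/L^3 gives the inverse cube that the sum over \<open>p\<close> requires.\<close>
      also have "\<dots> = of_nat (Suc n) * ((norm z / L) ^ m * (norm z * (1 / L ^ 3)))"
        using Suc by (simp add: field_simps power2_eq_square power3_eq_cube)
      also have "\<dots> \<le> of_nat (Suc n) * ((1 / 2) ^ m * (c * (1 / (2 * c * lattice_size p) ^ 3)))"
      proof -
        have "norm z / L \<le> 1 / 2" using z L by (simp add: divide_simps)
        hence "(norm z / L) ^ m \<le> (1 / 2) ^ m"
          using L by (intro power_mono) auto
        moreover have "norm z * (1 / L ^ 3) \<le> c * (1 / (2 * c * lattice_size p) ^ 3)"
          using z L c(1) lattice_size_pos[of p]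
          by (intro mult_mono[OF z] frac_le power_mono[OF L(2)] zero_less_power) (auto simp: mult_pos_pos)
        ultimately have "(norm z / L) ^ m * (norm z * (1 / L ^ 3)) \<le>
            (1 / 2) ^ m * (c * (1 / (2 * c * lattice_size p) ^ 3))"
          using c(1) lattice_size_pos[of p] L by (rule_tac mult_mono) auto
        thus ?thesis by (intro mult_left_mono) auto
      qed
      also have "\<dots> = a n * b p"
        using Suc c(1) lattice_size_pos[of p]
        by (simp add: a_def b_def K_def field_simps power2_eq_square power3_eq_cube)
      finally show ?thesis .
    qed
    have "a sums (1 / (1 - 1 / 2)\<^sup>2)"
      unfolding a_def by (rule geometric_deriv_sums) simp
    hence "summable a" by (rule sums_summable)
    hence a: "a summable_on UNIV"
      by (rule summable_nonneg_imp_summable_on) (simp add: a_def)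
    have b: "b summable_on (-{(0,0)})"
      unfolding b_def
      by (intro summable_on_cmult_right summable_on_subset_banach[OF summable_on_lattice_size]) auto
    have "(\<lambda>x. a (fst x) * b (snd x)) summable_on (UNIV \<times> (-{(0,0)}))"
    proof (rule summable_on_SigmaI)
      show "((\<lambda>p. a (fst (n, p)) * b (snd (n, p))) has_sum a n * infsum b (-{(0,0)})) (-{(0,0)})" for n
        using b by (auto intro!: has_sum_cmult_right)
      show "(\<lambda>n. a n * infsum b (-{(0,0)})) summable_on UNIV"
        by (intro summable_on_cmult_left a)
    qed (use lattice_size_pos in \<open>auto simp: a_def b_def K_def less_imp_le\<close>)
    hence "(\<lambda>x. norm (a (fst x) * b (snd x))) summable_on (UNIV \<times> (-{(0,0)}))"
      by (rule summable_on_iff_abs_summable_on_real[THEN iffD1])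
    hence "(\<lambda>x. norm (t (fst x) (snd x))) summable_on (UNIV \<times> (-{(0,0)}))"
    proof (rule Infinite_Sum.abs_summable_on_comparison_test)
      fix x :: "nat \<times> int \<times> int" assume "x \<in> UNIV \<times> - {(0,0)}"
      hence "norm (t (fst x) (snd x)) \<le> a (fst x) * b (snd x)" by (intro bound) auto
      also have "\<dots> \<le> norm (a (fst x) * b (snd x))" by simp
      finally show "norm (t (fst x) (snd x)) \<le> norm (a (fst x) * b (snd x))" .
    qed
    hence summ: "(\<lambda>(n, p). t n p) summable_on (UNIV \<times> (-{(0,0)}))"
      unfolding case_prod_unfold by (rule Infinite_Sum.abs_summable_summable)
    define S where "S = infsum (\<lambda>(n, p). t n p) (UNIV \<times> (-{(0,0)}))"
    have S: "((\<lambda>(n, p). t n p) has_sum S) (UNIV \<times> (-{(0,0)}))"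
      using summ by (simp add: S_def)
    have inner: "((\<lambda>p. t n p) has_sum fps_nth (wp_fps \<tau>) n * z ^ n) (-{(0,0)})" for n
    proof -
      have "t n summable_on (-{(0,0)})" using summable_on_SigmaD1[OF summ] by blast
      moreover have "infsum (t n) (-{(0,0)}) = fps_nth (wp_fps \<tau>) n * z ^ n"
      proof (cases "n = 0")
        case False
        have "infsum (t n) (-{(0,0)}) = (\<Sum>\<^sub>\<infinity>p\<in>-{(0,0)}. (of_nat (Suc n) * z ^ n) * (1 / lattice_point \<tau> p ^ (n + 2)))"
          using False by (intro infsum_cong) (simp add: t_def)
        also have "\<dots> = (of_nat (Suc n) * z ^ n) * lattice_sum \<tau> (n + 2)"
          unfolding lattice_sum_def by (rule infsum_cmult_right')
        finally show ?thesis using False by (simp add: wp_fps_def)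
      qed (simp add: t_def[abs_def])
      ultimately show ?thesis by (simp add: has_sum_iff)
    qed
    have "((\<lambda>n. fps_nth (wp_fps \<tau>) n * z ^ n) has_sum S) UNIV"
      using S by (rule has_sum_SigmaD) (use inner in simp)
    hence 1: "(\<lambda>n. fps_nth (wp_fps \<tau>) n * z ^ n) sums S" by (rule has_sum_imp_sums)
    \<comment> \<open>The same double family with the order of summation reversed; its inner sums
      are now the terms of \<wp>.\<close>
    have bij: "bij_betw prod.swap ((-{(0,0)}) \<times> (UNIV::nat set)) (UNIV \<times> (-{(0::int,0::int)}))"
      by (rule bij_betwI[of _ _ _ prod.swap]) auto
    have S': "((\<lambda>(p, n). t n p) has_sum S) ((-{(0,0)}) \<times> UNIV)"
      using has_sum_reindex_bij_betw[OF bij, of "\<lambda>(n, p). t n p"] S by (simp add: case_prod_unfold)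
    hence summ': "(\<lambda>(p, n). t n p) summable_on ((-{(0,0)}) \<times> UNIV)"
      by (rule has_sum_imp_summable)
    have "(wp_term \<tau> z has_sum S) (-{(0,0)})"
      using S'
    proof (rule has_sum_SigmaD)
      fix p assume p: "p \<in> -{(0::int,0::int)}"
      hence "(\<lambda>n. t n p) summable_on UNIV" using summable_on_SigmaD1[OF summ'] by blast
      hence *: "((\<lambda>n. t n p) has_sum infsum (\<lambda>n. t n p) UNIV) UNIV" by simp
      hence "(\<lambda>n. t n p) sums infsum (\<lambda>n. t n p) UNIV" by (rule has_sum_imp_sums)
      moreover have "(\<lambda>n. t n p) sums wp_term \<tau> z p"
        unfolding t_def using z L2c[of p] p c(1) by (intro wp_term_sums) auto
      ultimately have "infsum (\<lambda>n. t n p) UNIV = wp_term \<tau> z p" by (rule sums_unique2)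
      thus "((\<lambda>n. case (p, n) of (p, n) \<Rightarrow> t n p) has_sum wp_term \<tau> z p) UNIV" using * by simp
    qed
    hence "S = wp_regular \<tau> z" by (simp add: wp_regular_def has_sum_iff)
    thus ?thesis using 1 by simp
  qed
  show ?thesis by (rule that[OF c(1) sums])
qed

section \<open>Power series expansions at the origin\<close>

lemma has_fps_expansionI_sums:
  fixes f :: "complex \<Rightarrow> complex"
  assumes "c > 0" "\<And>z. norm z \<le> c \<Longrightarrow> (\<lambda>n. fps_nth F n * z ^ n) sums f z"
  shows "f has_fps_expansion F"
  unfolding has_fps_expansion_def
proof
  have "summable (\<lambda>n. fps_nth F n * of_real c ^ n)"
    using assms(2)[of "of_real c"] assms(1) by (auto simp: sums_iff)
  hence "conv_radius (fps_nth F) \<ge> norm (of_real c :: complex)" by (rule conv_radius_geI)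
  thus "fps_conv_radius F > 0" using assms(1)
    by (auto simp: fps_conv_radius_def intro: less_le_trans[of 0 "ereal c"])
  have "eventually (\<lambda>z. z \<in> ball 0 c) (nhds (0::complex))"
    using assms(1) by (intro eventually_nhds_in_open) auto
  thus "eventually (\<lambda>z. eval_fps F z = f z) (nhds 0)"
    by eventually_elim (use assms(2) in \<open>auto simp: eval_fps_def sums_iff\<close>)
qed

lemma wp_regular_has_fps_expansion:
  assumes "\<tau> \<in> upper_half"
  shows "wp_regular \<tau> has_fps_expansion wp_fps \<tau>"
  by (rule wp_regular_sums[OF assms]) (rule has_fps_expansionI_sums)

lemma has_fps_expansion_shift:
  fixes g :: "complex \<Rightarrow> complex"
  assumes g: "g has_fps_expansion C" and "\<And>i. i < n \<Longrightarrow> fps_nth C i = 0"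
  obtains k where "k has_fps_expansion fps_shift n C" "\<forall>\<^sub>F z in nhds 0. g z = z ^ n * k z"
proof -
  have C: "fps_X ^ n * fps_shift n C = C"
    using assms(2) by (auto simp: fps_eq_iff fps_X_power_mult_nth)
  have k: "eval_fps (fps_shift n C) has_fps_expansion fps_shift n C"
    using g by (intro eval_fps_has_fps_expansion) (auto simp: has_fps_expansion_def)
  have "(\<lambda>z. z ^ n * eval_fps (fps_shift n C) z) has_fps_expansion C"
    using has_fps_expansion_mult[OF has_fps_expansion_fps_X_power[of n] k] by (simp add: C)
  hence "\<forall>\<^sub>F z in nhds 0. eval_fps C z = z ^ n * eval_fps (fps_shift n C) z"
    by (simp add: has_fps_expansion_def)
  moreover have "\<forall>\<^sub>F z in nhds 0. eval_fps C z = g z"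
    using g by (simp add: has_fps_expansion_def)
  ultimately have "\<forall>\<^sub>F z in nhds 0. g z = z ^ n * eval_fps (fps_shift n C) z"
    by eventually_elim simp
  with k show ?thesis using that by blast
qed

lemma has_fps_expansion_tendsto_at:
  fixes g :: "complex \<Rightarrow> complex"
  assumes "g has_fps_expansion C"
  shows "(g \<longlongrightarrow> fps_nth C 0) (at 0)"
  using has_fps_expansion_imp_tendsto_0[OF assms] tendsto_mono[OF at_le[of "UNIV - {0}" UNIV]]
  by (metis at_within_def inf_le1 tendsto_mono)

lemma has_fps_expansion_eventually_0:
  fixes d :: "complex \<Rightarrow> complex"
  assumes d: "d has_fps_expansion D" and ev: "\<forall>\<^sub>F z in at 0. d z = 0"
  shows "D = 0"
proof -
  have "(d \<longlongrightarrow> 0) (at 0)"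
    by (rule Lim_transform_eventually[of "\<lambda>_. 0"]) (use ev in \<open>auto elim: eventually_mono\<close>)
  with has_fps_expansion_tendsto_at[OF d] have "fps_nth D 0 = 0"
    using tendsto_unique[of "at (0::complex)"] by auto
  hence "d 0 = 0" using has_fps_expansion_imp_0_eq_fps_nth_0[OF d] by simp
  hence "\<forall>\<^sub>F z in nhds 0. d z = 0" using ev by (simp add: eventually_nhds_conv_at)
  hence "d has_fps_expansion 0" by (simp add: has_fps_expansion_0_iff)
  thus ?thesis using d fps_expansion_unique_complex by blast
qed

text \<open>The equation \<wp>'' = 6 \<wp>^2 - g2/2, written for h in \<wp> = 1/z^2 + h, where 6
  \<wp>^2 contributes 12 h/z^2, hence the shift by 2. The difference of the two sides is elliptic
  and tends to 0 at the origin, so it vanishes. Being quadratic in h, this form of the equation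
  turns directly into a recursion.\<close>

lemma wp_fps_differential_equation:
  assumes \<tau>: "\<tau> \<in> upper_half"
  shows "fps_deriv (fps_deriv (wp_fps \<tau>)) - 12 * fps_shift 2 (wp_fps \<tau>) - 6 * wp_fps \<tau> ^ 2
    + fps_const (g2 \<tau> / 2) = 0"
proof -
  let ?H = "wp_fps \<tau>" and ?h = "wp_regular \<tau>"
  let ?D = "fps_deriv (fps_deriv ?H) - 12 * fps_shift 2 ?H - 6 * ?H ^ 2 + fps_const (g2 \<tau> / 2)"
  have H: "?h has_fps_expansion ?H" by (rule wp_regular_has_fps_expansion[OF \<tau>])
  have "fps_nth ?H i = 0" if "i < 2" for i using that by (auto simp: less_2_cases_iff)
  then obtain k where k: "k has_fps_expansion fps_shift 2 ?H"
    "\<forall>\<^sub>F z in nhds 0. ?h z = z ^ 2 * k z"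
    using has_fps_expansion_shift[OF H, of 2] by blast
  define d where "d z = deriv (deriv ?h) z - 12 * k z - 6 * ?h z ^ 2 + g2 \<tau> / 2" for z
  have d: "d has_fps_expansion ?D"
    unfolding d_def by (intro fps_expansion_intros H k)
  \<comment> \<open>The constant coefficient is 6 G4 - 36 G4 + 30 G4 = 0, where G4 stands for
    \<open>lattice_sum \<tau> 4\<close>.\<close>
  have D0: "fps_nth ?D 0 = 0"
    by (simp add: wp_fps_def g2_eq[OF \<tau>] fps_nth_power_0 numeral_fps_const eval_nat_numeral)
  define f where "f z = deriv (deriv (weierstrass_p \<tau>)) z - 6 * weierstrass_p \<tau> z ^ 2 + g2 \<tau> / 2" for z
  have ell: "elliptic \<tau> f"
    unfolding f_def
    by (intro elliptic_add elliptic_diff elliptic_mult elliptic_power elliptic_const elliptic_deriv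
        elliptic_weierstrass_p \<tau>)
  obtain S where S: "open S" "0 \<in> S" "?h holomorphic_on S"
    using has_fps_expansion_imp_analytic_0[OF H] by (auto simp: analytic_at)
  have wp: "weierstrass_p \<tau> = (\<lambda>z. 1 / z\<^sup>2 + ?h z)"
    using weierstrass_p_eq_regular[OF \<tau>] by blast
  have d1: "deriv (weierstrass_p \<tau>) z = -2 / z ^ 3 + deriv ?h z" if z: "z \<in> S - {0}" for z
  proof -
    have "(?h has_field_derivative deriv ?h z) (at z)"
      using z S holomorphic_derivI by blast
    moreover have "((\<lambda>z. 1 / z\<^sup>2) has_field_derivative -2 / z ^ 3) (at z)"
      using z by (auto intro!: derivative_eq_intros simp: field_simps power2_eq_square power3_eq_cube)
    ultimately show ?thesis unfolding wp by (intro DERIV_imp_deriv DERIV_add)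
  qed
  have d2: "deriv (deriv (weierstrass_p \<tau>)) z = 6 / z ^ 4 + deriv (deriv ?h) z" if z: "z \<in> S - {0}" for z
  proof -
    have "open (S - {0})" using S by auto
    hence "eventually (\<lambda>w. w \<in> S - {0}) (nhds z)" using z by (intro eventually_nhds_in_open)
    hence 1: "deriv (deriv (weierstrass_p \<tau>)) z = deriv (\<lambda>z. -2 / z ^ 3 + deriv ?h z) z"
      by (intro deriv_cong_ev) (auto elim!: eventually_mono simp: d1)
    have 2: "(deriv ?h has_field_derivative deriv (deriv ?h) z) (at z)"
      using z S holomorphic_derivI[OF holomorphic_deriv] by blast
    have "((\<lambda>z. -2 / z ^ 3) has_field_derivative 6 / z ^ 4) (at z)"
      using z by (auto intro!: derivative_eq_intros simp: field_simps eval_nat_numeral)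
    from DERIV_imp_deriv[OF DERIV_add[OF this 2]] show ?thesis using 1 by simp
  qed
  have "eventually (\<lambda>z. z \<in> S) (nhds 0)" using S by (intro eventually_nhds_in_open)
  with k(2) have "eventually (\<lambda>z. z \<in> S \<and> ?h z = z ^ 2 * k z) (nhds 0)"
    by eventually_elim auto
  hence ev: "eventually (\<lambda>z. f z = d z) (at 0)"
    unfolding eventually_at_filter
  proof eventually_elim
    case (elim z)
    have "f z = d z" if z: "z \<noteq> 0"
    proof -
      have h: "?h z = z ^ 2 * k z" using elim by blast
      have "f z = 6 / z ^ 4 + deriv (deriv ?h) z - 6 * (1 / z\<^sup>2 + ?h z)\<^sup>2 + g2 \<tau> / 2"
        using elim z d2[of z] by (simp add: f_def weierstrass_p_eq_regular[OF \<tau>])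
      also have "6 * (1 / z\<^sup>2 + ?h z)\<^sup>2 = 6 / z ^ 4 + 12 * k z + 6 * ?h z ^ 2"
        using z by (simp add: h field_simps eval_nat_numeral)
      finally show "f z = d z" by (simp add: d_def)
    qed
    thus ?case by blast
  qed
  have "(d \<longlongrightarrow> 0) (at 0)" using has_fps_expansion_tendsto_at[OF d] D0 by simp
  hence "(f \<longlongrightarrow> 0) (at 0)"
    by (rule Lim_transform_eventually) (use ev in \<open>auto elim: eventually_mono\<close>)
  hence fz: "f z = 0" if "z \<notin> period_lattice \<tau>" for z
    using elliptic_constant[OF \<tau> ell] that by blast
  have "eventually (\<lambda>z. d z = 0) (at 0)"
    using ev eventually_not_in_period_lattice[OF \<tau>] by eventually_elim (simp add: fz)
  with d show ?thesis by (rule has_fps_expansion_eventually_0)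
qed

text \<open>The factor on the left vanishes for n = 2, so the coefficient of index 4 remains free,
  as does the one of index 2, which n > 0 leaves out. These are the places of g3 and g2.\<close>

lemma wp_fps_recursion:
  assumes \<tau>: "\<tau> \<in> upper_half" and n: "n > 0"
  shows "(of_nat ((n + 2) * (n + 1)) - 12) * fps_nth (wp_fps \<tau>) (n + 2) =
    6 * (\<Sum>i\<le>n. fps_nth (wp_fps \<tau>) i * fps_nth (wp_fps \<tau>) (n - i))"
proof -
  let ?H = "wp_fps \<tau>"
  have sq: "fps_nth (?H ^ 2) n = (\<Sum>i\<le>n. fps_nth ?H i * fps_nth ?H (n - i))"
    by (simp add: power2_eq_square fps_mult_nth atMost_atLeast0)
  have "0 = fps_nth (fps_deriv (fps_deriv ?H) - 12 * fps_shift 2 ?H - 6 * ?H ^ 2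
      + fps_const (g2 \<tau> / 2)) n"
    by (simp add: wp_fps_differential_equation[OF \<tau>])
  also have "\<dots> = fps_nth (fps_deriv (fps_deriv ?H)) n - 12 * fps_nth ?H (n + 2) - 6 * fps_nth (?H ^ 2) n"
    using n by (simp add: numeral_fps_const)
  also have "fps_nth (fps_deriv (fps_deriv ?H)) n = of_nat ((n + 2) * (n + 1)) * fps_nth ?H (n + 2)"
    by (simp add: algebra_simps)
  finally have "of_nat ((n + 2) * (n + 1)) * fps_nth ?H (n + 2) - 12 * fps_nth ?H (n + 2)
      - 6 * fps_nth (?H ^ 2) n = 0" by (rule sym)
  thus ?thesis unfolding sq by (simp only: left_diff_distrib right_minus_eq)
qed

subsection \<open>Weighted homogeneous forms\<close>

text \<open>One coefficient family \<open>c\<close> has to work for all points, in particular for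
  all \<tau>; agreement is asked on \<open>Tor12\<close> only.\<close>

definition weighted_form :: "nat \<Rightarrow> (complex \<times> complex \<Rightarrow> complex) \<Rightarrow> bool" where
  "weighted_form d f \<longleftrightarrow> (\<exists>c. \<forall>p\<in>Tor12. f p = weierstrass_poly d c p)"

definition weight_exponents :: "nat \<Rightarrow> (nat \<times> nat \<times> nat \<times> nat) set" where
  "weight_exponents d = {(i, j, k, l). 2 * i + 3 * j + 4 * k + 6 * l = d}"

definition weierstrass_monom :: "nat \<times> nat \<times> nat \<times> nat \<Rightarrow> complex \<times> complex \<Rightarrow> complex" where
  "weierstrass_monom = (\<lambda>(i, j, k, l) (\<tau>, z).
     weierstrass_p \<tau> z ^ i * weierstrass_p' \<tau> z ^ j * g2 \<tau> ^ k * g3 \<tau> ^ l)"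

lemma finite_weight_exponents [simp]: "finite (weight_exponents d)"
  by (rule finite_subset[of _ "{..d} \<times> {..d} \<times> {..d} \<times> {..d}"]) (auto simp: weight_exponents_def)

lemma weierstrass_poly_eq:
  "weierstrass_poly d c p = (\<Sum>e\<in>weight_exponents d. c e * weierstrass_monom e p)"
  by (cases p) (simp add: weierstrass_poly_def weight_exponents_def weierstrass_monom_def
      case_prod_unfold mult.assoc)

lemma weighted_form_cong:
  assumes "weighted_form d f" "\<And>p. p \<in> Tor12 \<Longrightarrow> g p = f p"
  shows "weighted_form d g"
  using assms unfolding weighted_form_def by metis

lemma weighted_form_0: "weighted_form d (\<lambda>_. 0)"
  unfolding weighted_form_def weierstrass_poly_eq by (rule exI[of _ "\<lambda>_. 0"]) simp

lemma weighted_form_add: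
  assumes "weighted_form d f" "weighted_form d g"
  shows "weighted_form d (\<lambda>p. f p + g p)"
proof -
  obtain c c' where "\<forall>p\<in>Tor12. f p = weierstrass_poly d c p" "\<forall>p\<in>Tor12. g p = weierstrass_poly d c' p"
    using assms unfolding weighted_form_def by blast
  thus ?thesis unfolding weighted_form_def weierstrass_poly_eq
    by (intro exI[of _ "\<lambda>e. c e + c' e"]) (simp add: algebra_simps sum.distrib)
qed

lemma weighted_form_cmult:
  assumes "weighted_form d f"
  shows "weighted_form d (\<lambda>p. a * f p)"
proof -
  obtain c where "\<forall>p\<in>Tor12. f p = weierstrass_poly d c p"
    using assms unfolding weighted_form_def by blast
  thus ?thesis unfolding weighted_form_def weierstrass_poly_eq
    by (intro exI[of _ "\<lambda>e. a * c e"]) (simp add: algebra_simps sum_distrib_left)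
qed

lemma weighted_form_diff:
  assumes "weighted_form d f" "weighted_form d g"
  shows "weighted_form d (\<lambda>p. f p - g p)"
  using weighted_form_add[OF assms(1) weighted_form_cmult[OF assms(2), of "-1"]] by simp

lemma weighted_form_sum:
  assumes "finite A" "\<And>x. x \<in> A \<Longrightarrow> weighted_form d (f x)"
  shows "weighted_form d (\<lambda>p. \<Sum>x\<in>A. f x p)"
  using assms by (induction rule: finite_induct) (auto intro: weighted_form_0 weighted_form_add)

lemma weighted_form_monom:
  assumes "e \<in> weight_exponents d"
  shows "weighted_form d (weierstrass_monom e)"
  unfolding weighted_form_def weierstrass_poly_eq
  by (intro exI[of _ "\<lambda>e'. if e' = e then 1 else 0"])
     (use assms in \<open>simp add: if_distrib[of "\<lambda>x. x * _"] cong: if_cong\<close>)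

lemma weighted_form_mult:
  assumes "weighted_form d f" "weighted_form d' g"
  shows "weighted_form (d + d') (\<lambda>p. f p * g p)"
proof -
  obtain c c' where c: "\<forall>p\<in>Tor12. f p = weierstrass_poly d c p" "\<forall>p\<in>Tor12. g p = weierstrass_poly d' c' p"
    using assms unfolding weighted_form_def by blast
  have "weighted_form (d + d') (\<lambda>p. weierstrass_monom e p * weierstrass_monom e' p)"
    if ee: "e \<in> weight_exponents d" "e' \<in> weight_exponents d'" for e e'
  proof -
    obtain i j k l i' j' k' l' where e: "e = (i, j, k, l)" "e' = (i', j', k', l')"
      by (metis prod_cases4)
    have "(i + i', j + j', k + k', l + l') \<in> weight_exponents (d + d')"
      using ee by (simp add: e weight_exponents_def)
    from weighted_form_monom[OF this] show ?thesis
      by (rule weighted_form_cong) (auto simp: e weierstrass_monom_def power_add)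
  qed
  hence "weighted_form (d + d') (\<lambda>p. \<Sum>e\<in>weight_exponents d. \<Sum>e'\<in>weight_exponents d'.
      (c e * c' e') * (weierstrass_monom e p * weierstrass_monom e' p))"
    by (intro weighted_form_sum weighted_form_cmult) auto
  moreover have "f p * g p = (\<Sum>e\<in>weight_exponents d. \<Sum>e'\<in>weight_exponents d'.
      (c e * c' e') * (weierstrass_monom e p * weierstrass_monom e' p))" if "p \<in> Tor12" for p
    using c that unfolding weierstrass_poly_eq
    by (simp add: sum_product) (intro sum.cong refl, simp add: mult_ac)
  ultimately show ?thesis by (rule weighted_form_cong)
qed

lemma weighted_form_const: "weighted_form 0 (\<lambda>_. a)"
proof -
  have "(0, 0, 0, 0) \<in> weight_exponents 0" by (simp add: weight_exponents_def)
  from weighted_form_cmult[OF weighted_form_monom[OF this], of a] show ?thesis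
    by (rule weighted_form_cong) (auto simp: weierstrass_monom_def)
qed

lemma weighted_form_power:
  assumes "weighted_form d f"
  shows "weighted_form (n * d) (\<lambda>p. f p ^ n)"
  by (induction n) (use weighted_form_const[of 1] weighted_form_mult[OF assms] in auto)

lemma weighted_form_weierstrass_p: "weighted_form 2 (\<lambda>p. weierstrass_p (fst p) (snd p))"
proof -
  have "(1, 0, 0, 0) \<in> weight_exponents 2" by (simp add: weight_exponents_def)
  from weighted_form_monom[OF this] show ?thesis
    by (rule weighted_form_cong) (auto simp: weierstrass_monom_def)
qed

lemma weighted_form_g2: "weighted_form 4 (\<lambda>p. g2 (fst p))"
proof -
  have "(0, 0, 1, 0) \<in> weight_exponents 4" by (simp add: weight_exponents_def)
  from weighted_form_monom[OF this] show ?thesis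
    by (rule weighted_form_cong) (auto simp: weierstrass_monom_def)
qed

lemma weighted_form_g3: "weighted_form 6 (\<lambda>p. g3 (fst p))"
proof -
  have "(0, 0, 0, 1) \<in> weight_exponents 6" by (simp add: weight_exponents_def)
  from weighted_form_monom[OF this] show ?thesis
    by (rule weighted_form_cong) (auto simp: weierstrass_monom_def)
qed

subsection \<open>Power series with weighted homogeneous coefficients\<close>

text \<open>Homogeneity of weight d when the variable of the series is given weight -1.\<close>

definition graded_fps :: "nat \<Rightarrow> (complex \<Rightarrow> complex fps) \<Rightarrow> bool" where
  "graded_fps d A \<longleftrightarrow> (\<forall>n. weighted_form (n + d) (\<lambda>p. fps_nth (A (fst p)) n))"

lemma graded_fpsD: "graded_fps d A \<Longrightarrow> weighted_form (n + d) (\<lambda>p. fps_nth (A (fst p)) n)"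
  by (simp add: graded_fps_def)

lemma fst_Tor12: "p \<in> Tor12 \<Longrightarrow> fst p \<in> upper_half"
  by (auto simp: Tor12_def)

text \<open>Strong induction along the recursion, whose right side has total weight n + 2 for the
  coefficient of index n. The two free coefficients are g2/20 at index 2 and g3/28 at index
  4.\<close>

lemma graded_fps_wp_fps: "graded_fps 2 wp_fps"
  unfolding graded_fps_def
proof
  fix n show "weighted_form (n + 2) (\<lambda>p. fps_nth (wp_fps (fst p)) n)"
  proof (induction n rule: less_induct)
    case (less n)
    consider "n = 0" | "n = 1" | "n = 2" | "n = 4" | "n > 2" "n \<noteq> 4" by linarith
    thus ?case
    proof cases
      case 3
      have "weighted_form 4 (\<lambda>p. 1 / 20 * g2 (fst p))"
        by (intro weighted_form_cmult weighted_form_g2)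
      hence "weighted_form 4 (\<lambda>p. fps_nth (wp_fps (fst p)) 2)"
        by (rule weighted_form_cong) (use fst_Tor12 in \<open>simp add: wp_fps_def g2_eq\<close>)
      thus ?thesis using 3 by simp
    next
      case 4
      have "weighted_form 6 (\<lambda>p. 1 / 28 * g3 (fst p))"
        by (intro weighted_form_cmult weighted_form_g3)
      hence "weighted_form 6 (\<lambda>p. fps_nth (wp_fps (fst p)) 4)"
        by (rule weighted_form_cong) (use fst_Tor12 in \<open>simp add: wp_fps_def g3_eq\<close>)
      thus ?thesis using 4 by simp
    next
      case 5
      define m where "m = n - 2"
      have m: "n = m + 2" "m > 0" using 5 by (auto simp: m_def)
      define a :: complex where "a = of_nat ((m + 2) * (m + 1)) - 12"
      \<comment> \<open>Equality would mean m = 2, hence n = 4, which has its own case.\<close>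
      have "(m + 2) * (m + 1) \<noteq> 12"
      proof
        assume *: "(m + 2) * (m + 1) = 12"
        have "m = 1 \<or> m \<ge> 3" using m 5 by auto
        thus False
        proof
          assume "m \<ge> 3"
          hence "(m + 2) * (m + 1) \<ge> (3 + 2) * (3 + 1)" by (intro mult_mono) auto
          thus False using * by simp
        qed (use * in auto)
      qed
      hence "of_nat ((m + 2) * (m + 1)) \<noteq> (of_nat 12 :: complex)" unfolding of_nat_eq_iff .
      hence a: "a \<noteq> 0" by (simp add: a_def)
      have "weighted_form (n + 2) (\<lambda>p. \<Sum>i\<le>m. fps_nth (wp_fps (fst p)) i * fps_nth (wp_fps (fst p)) (m - i))"
      proof (intro weighted_form_sum finite_atMost)
        fix i assume "i \<in> {..m}"
        hence i: "i < n" "m - i < n" "(i + 2) + (m - i + 2) = n + 2" using m by auto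
        show "weighted_form (n + 2) (\<lambda>p. fps_nth (wp_fps (fst p)) i * fps_nth (wp_fps (fst p)) (m - i))"
          using weighted_form_mult[OF less[OF i(1)] less[OF i(2)]] unfolding i(3) .
      qed
      hence "weighted_form (n + 2) (\<lambda>p. 6 / a *
          (\<Sum>i\<le>m. fps_nth (wp_fps (fst p)) i * fps_nth (wp_fps (fst p)) (m - i)))"
        by (rule weighted_form_cmult)
      thus ?thesis
      proof (rule weighted_form_cong)
        fix p assume "p \<in> Tor12"
        from wp_fps_recursion[OF fst_Tor12[OF this] m(2)] show "fps_nth (wp_fps (fst p)) n =
            6 / a * (\<Sum>i\<le>m. fps_nth (wp_fps (fst p)) i * fps_nth (wp_fps (fst p)) (m - i))"
          using a unfolding a_def[symmetric] m(1) by (simp add: field_simps)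
      qed
    qed (simp_all add: weighted_form_0)
  qed
qed

lemma graded_fps_mult:
  assumes "graded_fps d A" "graded_fps e B"
  shows "graded_fps (d + e) (\<lambda>\<tau>. A \<tau> * B \<tau>)"
  unfolding graded_fps_def fps_mult_nth
proof (intro allI weighted_form_sum)
  fix n i :: nat assume "i \<in> {0..n}"
  hence i: "(i + d) + (n - i + e) = n + (d + e)" by simp
  show "weighted_form (n + (d + e)) (\<lambda>p. fps_nth (A (fst p)) i * fps_nth (B (fst p)) (n - i))"
    using weighted_form_mult[OF graded_fpsD[OF assms(1), of i] graded_fpsD[OF assms(2), of "n - i"]]
    unfolding i .
qed auto

lemma graded_fps_const: "graded_fps 0 (\<lambda>_. fps_const a)"
  unfolding graded_fps_def
proof
  fix n show "weighted_form (n + 0) (\<lambda>p. fps_nth (fps_const a) n)"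
    by (cases "n = 0") (auto intro: weighted_form_const weighted_form_0)
qed

lemma graded_fps_add:
  "graded_fps d A \<Longrightarrow> graded_fps d B \<Longrightarrow> graded_fps d (\<lambda>\<tau>. A \<tau> + B \<tau>)"
  by (auto simp: graded_fps_def intro: weighted_form_add)

lemma graded_fps_diff:
  "graded_fps d A \<Longrightarrow> graded_fps d B \<Longrightarrow> graded_fps d (\<lambda>\<tau>. A \<tau> - B \<tau>)"
  by (auto simp: graded_fps_def intro: weighted_form_diff)

lemma graded_fps_power:
  assumes "graded_fps 0 A"
  shows "graded_fps 0 (\<lambda>\<tau>. A \<tau> ^ n)"
  by (induction n) (use graded_fps_const[of 1] graded_fps_mult[OF assms] in auto)

lemma graded_fps_X_power_mult:
  assumes "graded_fps (k + d) A"
  shows "graded_fps d (\<lambda>\<tau>. fps_X ^ k * A \<tau>)"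
  unfolding graded_fps_def fps_X_power_mult_nth
proof
  fix n
  show "weighted_form (n + d) (\<lambda>p. if n < k then 0 else fps_nth (A (fst p)) (n - k))"
  proof (cases "n < k")
    case False
    hence "(n - k) + (k + d) = n + d" by simp
    with graded_fpsD[OF assms, of "n - k"] show ?thesis using False by simp
  qed (simp add: weighted_form_0)
qed

lemma graded_fps_compose_linear:
  assumes "graded_fps d A"
  shows "graded_fps d (\<lambda>\<tau>. A \<tau> oo (fps_const a * fps_X))"
  unfolding fps_compose_linear graded_fps_def
  using graded_fpsD[OF assms] by (auto intro: weighted_form_cmult)

text \<open>The constant term has to be one number for all \<tau>, since dividing by a form of
  varying value would leave the weighted polynomials.\<close>

lemma graded_fps_inverse:
  assumes A: "graded_fps 0 A" and a: "\<And>\<tau>. \<tau> \<in> upper_half \<Longrightarrow> fps_nth (A \<tau>) 0 = a" "a \<noteq> 0"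
  shows "graded_fps 0 (\<lambda>\<tau>. inverse (A \<tau>))"
  unfolding graded_fps_def
proof
  fix n show "weighted_form (n + 0) (\<lambda>p. fps_nth (inverse (A (fst p))) n)"
  proof (induction n rule: less_induct)
    case (less n)
    show ?case
    proof (cases "n = 0")
      case True
      have "weighted_form 0 (\<lambda>_. inverse a)" by (rule weighted_form_const)
      hence "weighted_form 0 (\<lambda>p. fps_nth (inverse (A (fst p))) 0)"
        by (rule weighted_form_cong) (use fst_Tor12 a in simp)
      thus ?thesis using True by simp
    next
      case False
      have "weighted_form n (\<lambda>p. (- 1 / a) * (\<Sum>i=1..n. fps_nth (A (fst p)) i *
          fps_nth (inverse (A (fst p))) (n - i)))"
      proof (intro weighted_form_cmult weighted_form_sum)
        fix i assume "i \<in> {1..n}"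
        hence i: "n - i < n" "(i + 0) + (n - i + 0) = n" by auto
        show "weighted_form n (\<lambda>p. fps_nth (A (fst p)) i * fps_nth (inverse (A (fst p))) (n - i))"
          using weighted_form_mult[OF graded_fpsD[OF A, of i] less[OF i(1)]] unfolding i(2) .
      qed auto
      hence "weighted_form n (\<lambda>p. fps_nth (inverse (A (fst p))) n)"
      proof (rule weighted_form_cong)
        fix p assume p: "p \<in> Tor12"
        have "A (fst p) * inverse (A (fst p)) = 1"
          using a(1)[OF fst_Tor12[OF p]] a(2) by (intro inverse_mult_eq_1') auto
        hence "0 = fps_nth (A (fst p) * inverse (A (fst p))) n" using False by simp
        also have "\<dots> = (\<Sum>i=0..n. fps_nth (A (fst p)) i * fps_nth (inverse (A (fst p))) (n - i))"
          by (rule fps_mult_nth)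
        also have "\<dots> = a * fps_nth (inverse (A (fst p))) n +
            (\<Sum>i=1..n. fps_nth (A (fst p)) i * fps_nth (inverse (A (fst p))) (n - i))"
          using a(1)[OF fst_Tor12[OF p]] by (subst sum.atLeast_Suc_atMost) auto
        finally show "fps_nth (inverse (A (fst p))) n = (- 1 / a) *
            (\<Sum>i=1..n. fps_nth (A (fst p)) i * fps_nth (inverse (A (fst p))) (n - i))"
          using a(2) by (simp add: field_simps eq_neg_iff_add_eq_0)
      qed
      thus ?thesis by simp
    qed
  qed
qed

section \<open>Even power series and even elliptic functions\<close>

definition even_fps :: "complex fps \<Rightarrow> bool" where
  "even_fps A \<longleftrightarrow> (\<forall>n. odd n \<longrightarrow> fps_nth A n = 0)"

lemma even_fps_mult:
  assumes "even_fps A" "even_fps B"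
  shows "even_fps (A * B)"
  unfolding even_fps_def fps_mult_nth
proof (intro allI impI sum.neutral ballI)
  fix n i assume n: "odd (n::nat)" and "i \<in> {0..n}"
  hence "odd i \<or> odd (n - i)" by auto
  hence "fps_nth A i = 0 \<or> fps_nth B (n - i) = 0"
    using assms unfolding even_fps_def by blast
  thus "fps_nth A i * fps_nth B (n - i) = 0" by auto
qed

lemma even_fps_const: "even_fps (fps_const a)"
  by (auto simp: even_fps_def elim: oddE)

lemma even_fps_power: "even_fps A \<Longrightarrow> even_fps (A ^ n)"
  by (induction n) (use even_fps_const[of 1] even_fps_mult in auto)

lemma even_fps_diff: "even_fps A \<Longrightarrow> even_fps B \<Longrightarrow> even_fps (A - B)"
  by (simp add: even_fps_def)

text \<open>The leading term at the origin is removed by subtracting a multiple of a power of \<open>\<wp>\<close>; since the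
  function is even, this lowers the order of the pole by two, until Liouville's theorem applies.\<close>

lemma weighted_form_elliptic:
  assumes ell: "\<And>\<tau>. \<tau> \<in> upper_half \<Longrightarrow> elliptic \<tau> (f \<tau>)"
    and lau: "\<And>\<tau>. \<tau> \<in> upper_half \<Longrightarrow> \<exists>g. g has_fps_expansion A \<tau> \<and> (\<forall>\<^sub>F z in at 0. z ^ (2 * d) * f \<tau> z = g z)"
    and ev: "\<And>\<tau>. \<tau> \<in> upper_half \<Longrightarrow> even_fps (A \<tau>)"
    and gr: "graded_fps e A"
  shows "weighted_form (2 * d + e) (\<lambda>p. f (fst p) (snd p))"
  using assms
proof (induction d arbitrary: f A e)
  case 0
  have "f (fst p) (snd p) = fps_nth (A (fst p)) 0" if p: "p \<in> Tor12" for p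
  proof -
    have \<tau>: "fst p \<in> upper_half" using fst_Tor12[OF p] .
    obtain g where g: "g has_fps_expansion A (fst p)" "\<forall>\<^sub>F z in at 0. f (fst p) z = g z"
      using 0(2)[OF \<tau>] by auto
    have "(f (fst p) \<longlongrightarrow> fps_nth (A (fst p)) 0) (at 0)"
      by (rule Lim_transform_eventually[OF has_fps_expansion_tendsto_at[OF g(1)]])
         (use g(2) in \<open>auto elim: eventually_mono\<close>)
    thus ?thesis using elliptic_constant[OF \<tau> 0(1)[OF \<tau>]] p by (auto simp: Tor12_def)
  qed
  thus ?case using graded_fpsD[OF 0(4), of 0] by (auto elim!: weighted_form_cong)
next
  case (Suc d)
  define b where "b \<tau> = fps_nth (A \<tau>) 0" for \<tau>
  \<comment> \<open>The expansion of z^2 \<wp>. Its constant term 1 makes \<open>b \<tau>\<close>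
    times its power match the leading coefficient of \<open>A \<tau>\<close>.\<close>
  define Q where "Q \<tau> = 1 + fps_X ^ 2 * wp_fps \<tau>" for \<tau>
  define C where "C \<tau> = A \<tau> - fps_const (b \<tau>) * Q \<tau> ^ Suc d" for \<tau>
  define f' where "f' \<tau> z = f \<tau> z - b \<tau> * weierstrass_p \<tau> z ^ Suc d" for \<tau> z
  have Qev: "even_fps (Q \<tau>)" for \<tau>
    unfolding Q_def even_fps_def by (auto simp: fps_X_power_mult_nth wp_fps_odd)
  have Q0: "fps_nth (Q \<tau>) 0 = 1" for \<tau>
    by (simp add: Q_def fps_X_power_mult_nth)
  have Cev: "even_fps (C \<tau>)" if "\<tau> \<in> upper_half" for \<tau>
    unfolding C_def using that
    by (intro even_fps_diff Suc.prems even_fps_mult even_fps_const even_fps_power Qev)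
  have C0: "fps_nth (C \<tau>) i = 0" if "\<tau> \<in> upper_half" "i < 2" for \<tau> i
  proof (cases "i = 0")
    case True
    thus ?thesis by (simp add: C_def b_def fps_nth_power_0 Q0)
  next
    case False
    hence "odd i" using that by (auto simp: less_2_cases_iff)
    thus ?thesis using Cev[OF that(1)] by (simp add: even_fps_def)
  qed
  have Qgr: "graded_fps 0 (\<lambda>\<tau>. Q \<tau> ^ Suc d)"
    unfolding Q_def
    using graded_fps_add[OF graded_fps_const[of 1] graded_fps_X_power_mult[of 2 0 wp_fps]] graded_fps_wp_fps
    by (intro graded_fps_power) simp
  have bgr: "weighted_form e (\<lambda>p. b (fst p))"
    using graded_fpsD[OF Suc.prems(4), of 0] by (simp add: b_def)
  have "graded_fps e (\<lambda>\<tau>. fps_const (b \<tau>) * Q \<tau> ^ Suc d)"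
    unfolding graded_fps_def fps_mult_left_const_nth
    using weighted_form_mult[OF bgr graded_fpsD[OF Qgr]] by (simp add: add_ac)
  hence "graded_fps e C" unfolding C_def by (intro graded_fps_diff Suc.prems)
  \<comment> \<open>Dividing by z^2 raises the weight by 2, which offsets the drop of the pole order
    by 2: 2 d + (e + 2) = 2 (d + 1) + e.\<close>
  hence Cgr: "graded_fps (e + 2) (\<lambda>\<tau>. fps_shift 2 (C \<tau>))"
    unfolding graded_fps_def fps_shift_nth by (metis add.assoc add.commute)
  have "weighted_form (2 * d + (e + 2)) (\<lambda>p. f' (fst p) (snd p))"
  proof (rule Suc.IH[OF _ _ _ Cgr])
    fix \<tau> assume \<tau>: "\<tau> \<in> upper_half"
    show "elliptic \<tau> (f' \<tau>)" unfolding f'_def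
      by (intro elliptic_diff elliptic_mult elliptic_const elliptic_power elliptic_weierstrass_p Suc.prems \<tau>)
    show "even_fps (fps_shift 2 (C \<tau>))"
      using Cev[OF \<tau>] by (auto simp: even_fps_def)
    obtain g where g: "g has_fps_expansion A \<tau>" "\<forall>\<^sub>F z in at 0. z ^ (2 * Suc d) * f \<tau> z = g z"
      using Suc.prems(2)[OF \<tau>] by auto
    define q where "q z = 1 + z ^ 2 * wp_regular \<tau> z" for z
    have q: "q has_fps_expansion Q \<tau>" unfolding q_def Q_def
      by (intro fps_expansion_intros wp_regular_has_fps_expansion \<tau>)
    have "(\<lambda>z. g z - b \<tau> * q z ^ Suc d) has_fps_expansion C \<tau>"
      unfolding C_def by (intro fps_expansion_intros g q)
    then obtain k where k: "k has_fps_expansion fps_shift 2 (C \<tau>)"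
      "\<forall>\<^sub>F z in nhds 0. g z - b \<tau> * q z ^ Suc d = z ^ 2 * k z"
      using has_fps_expansion_shift[of "\<lambda>z. g z - b \<tau> * q z ^ Suc d" "C \<tau>" 2] C0[OF \<tau>] by blast
    have "\<forall>\<^sub>F z in at 0. g z - b \<tau> * q z ^ Suc d = z ^ 2 * k z"
      using k(2) by (simp add: eventually_at_filter eventually_mono)
    hence "\<forall>\<^sub>F z in at 0. z ^ (2 * d) * f' \<tau> z = k z"
      using g(2) eventually_neq_at_within[of 0]
    proof eventually_elim
      case (elim z)
      have "q z = z ^ 2 * weierstrass_p \<tau> z"
        using elim(3) by (simp add: q_def weierstrass_p_eq_regular[OF \<tau>] algebra_simps)
      hence "b \<tau> * q z ^ Suc d = z ^ (2 * Suc d) * (b \<tau> * weierstrass_p \<tau> z ^ Suc d)"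
        by (simp only: power_mult_distrib mult_ac flip: power_mult)
      hence "z ^ 2 * k z = z ^ (2 * Suc d) * f' \<tau> z"
        using elim(1,2) by (simp only: f'_def right_diff_distrib)
      also have "\<dots> = z ^ 2 * (z ^ (2 * d) * f' \<tau> z)"
        by (simp add: power2_eq_square)
      finally show ?case using elim(3) by simp
    qed
    with k(1) show "\<exists>g. g has_fps_expansion fps_shift 2 (C \<tau>) \<and> (\<forall>\<^sub>F z in at 0. z ^ (2 * d) * f' \<tau> z = g z)"
      by blast
  qed
  moreover have "weighted_form (Suc d * 2 + e) (\<lambda>p. weierstrass_p (fst p) (snd p) ^ Suc d * b (fst p))"
    by (intro weighted_form_mult weighted_form_power weighted_form_weierstrass_p bgr)
  ultimately have "weighted_form (2 * Suc d + e)
      (\<lambda>p. f' (fst p) (snd p) + weierstrass_p (fst p) (snd p) ^ Suc d * b (fst p))"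
    by (intro weighted_form_add) (simp_all add: algebra_simps)
  thus ?case by (rule weighted_form_cong) (simp add: f'_def mult.commute)
qed

section \<open>A theta function\<close>

text \<open>Euler's expansion of the infinite product of \<open>1 - q ^ n * x\<close> over \<open>n \<ge> 0\<close>.\<close>

primrec euler_coeff :: "complex \<Rightarrow> nat \<Rightarrow> complex" where
  "euler_coeff q 0 = 1"
| "euler_coeff q (Suc n) = - (q ^ n / (1 - q ^ Suc n)) * euler_coeff q n"

definition euler_product :: "complex \<Rightarrow> complex \<Rightarrow> complex" where
  "euler_product q x = (\<Sum>n. euler_coeff q n * x ^ n)"

lemma one_minus_power_neq_0:
  fixes q :: complex
  assumes "norm q < 1"
  shows "1 - q ^ Suc n \<noteq> 0"
proof
  assume "1 - q ^ Suc n = 0"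
  hence "norm q ^ Suc n = 1" by (metis eq_iff_diff_eq_0 norm_one norm_power)
  moreover have "norm q ^ Suc n \<le> norm q"
    using assms power_decreasing[of 1 "Suc n" "norm q"] by simp
  ultimately show False using assms by simp
qed

lemma euler_coeff_summable:
  assumes q: "norm q < 1"
  shows "summable (\<lambda>n. euler_coeff q n * x ^ n)"
proof -
  have "(\<lambda>n. norm q ^ n * (norm x / (1 - norm q))) \<longlonglongrightarrow> 0 * (norm x / (1 - norm q))"
    using q by (intro tendsto_mult LIMSEQ_realpow_zero tendsto_const) auto
  hence "eventually (\<lambda>n. norm q ^ n * (norm x / (1 - norm q)) < 1 / 2) sequentially"
    by (intro order_tendstoD(2)) auto
  then obtain N where N: "norm q ^ n * (norm x / (1 - norm q)) < 1 / 2" if "n \<ge> N" for n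
    by (auto simp: eventually_at_top_linorder)
  show ?thesis
  proof (rule summable_ratio_test[of "1 / 2" N])
    fix n assume n: "n \<ge> N"
    have "norm (q ^ Suc n) \<le> norm q"
      using q power_decreasing[of 1 "Suc n" "norm q"] by (simp add: norm_power norm_mult)
    moreover have "1 - norm (q ^ Suc n) \<le> norm (1 - q ^ Suc n)"
      using norm_triangle_ineq2[of 1 "q ^ Suc n"] by simp
    ultimately have le: "1 - norm q \<le> norm (1 - q ^ Suc n)" by linarith
    have "norm (q ^ n / (1 - q ^ Suc n) * x) \<le> norm q ^ n * (norm x / (1 - norm q))"
      using le q by (simp add: norm_mult norm_divide norm_power del: power_Suc) 
        (intro frac_le, auto)
    also have "\<dots> \<le> 1 / 2" using N[OF n] by simp
    finally have *: "norm (q ^ n / (1 - q ^ Suc n) * x) \<le> 1 / 2" .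
    have "norm (euler_coeff q (Suc n) * x ^ Suc n) =
        norm (q ^ n / (1 - q ^ Suc n) * x) * norm (euler_coeff q n * x ^ n)"
      by (simp add: norm_mult norm_divide mult_ac)
    also have "\<dots> \<le> 1 / 2 * norm (euler_coeff q n * x ^ n)"
      using * by (rule mult_right_mono) simp
    finally show "norm (euler_coeff q (Suc n) * x ^ Suc n) \<le> 1 / 2 * norm (euler_coeff q n * x ^ n)" .
  qed simp
qed

lemma holomorphic_euler_product:
  assumes q: "norm q < 1"
  shows "euler_product q holomorphic_on UNIV"
proof -
  have "euler_product q holomorphic_on ball 0 r" for r
    by (rule power_series_holomorphic[of 0 r "euler_coeff q"])
       (use summable_sums[OF euler_coeff_summable[OF q]] in \<open>simp add: euler_product_def\<close>)
  hence "euler_product q analytic_on {x}" for x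
    unfolding analytic_at by (intro exI[of _ "ball 0 (norm x + 1)"]) auto
  hence "euler_product q analytic_on UNIV" by (subst analytic_on_analytic_at) blast
  thus ?thesis by (rule analytic_imp_holomorphic)
qed

lemma euler_product_0: "euler_product q 0 = 1"
  by (simp add: euler_product_def)

text \<open>The recursion of \<open>euler_coeff\<close> is this equation read off coefficientwise.
  Iterating it splits off any finite number of factors of the product, so the infinite product is
  handled through its series.\<close>

lemma euler_product_functional_equation:
  assumes q: "norm q < 1"
  shows "euler_product q x = (1 - x) * euler_product q (q * x)"
proof -
  let ?e = "euler_coeff q"
  have s: "(\<lambda>n. ?e n * x ^ n) sums euler_product q x" for x
    unfolding euler_product_def by (rule summable_sums[OF euler_coeff_summable[OF q]])
  have "(\<lambda>n. ?e n * (q * x) ^ n) sums euler_product q (q * x)" by (rule s)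
  hence "(\<lambda>n. ?e (Suc n) * (q * x) ^ Suc n) sums (euler_product q (q * x) - 1)"
    by (subst sums_Suc_iff) simp
  moreover have "(\<lambda>n. x * (?e n * (q * x) ^ n)) sums (x * euler_product q (q * x))"
    by (intro sums_mult s)
  ultimately have "(\<lambda>n. ?e (Suc n) * (q * x) ^ Suc n - x * (?e n * (q * x) ^ n)) sums
      (euler_product q (q * x) - 1 - x * euler_product q (q * x))"
    by (rule sums_diff)
  moreover have "?e (Suc n) * (q * x) ^ Suc n - x * (?e n * (q * x) ^ n) = ?e (Suc n) * x ^ Suc n" for n
  proof -
    have *: "(1 - q ^ Suc n) * ?e (Suc n) = - (q ^ n * ?e n)"
      using one_minus_power_neq_0[OF q, of n] by (simp del: power_Suc)
    have "?e (Suc n) * (q * x) ^ Suc n - x * (?e n * (q * x) ^ n) - ?e (Suc n) * x ^ Suc n =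
       - ((1 - q ^ Suc n) * ?e (Suc n) + q ^ n * ?e n) * x ^ Suc n"
      by (simp add: algebra_simps power_mult_distrib del: euler_coeff.simps)
    also have "\<dots> = 0" unfolding * by simp
    finally show ?thesis by (simp only: right_minus_eq)
  qed
  ultimately have "(\<lambda>n. ?e (Suc n) * x ^ Suc n) sums
      (euler_product q (q * x) - 1 - x * euler_product q (q * x))" by simp
  moreover have "(\<lambda>n. ?e (Suc n) * x ^ Suc n) sums (euler_product q x - 1)"
    using s[of x] by (subst sums_Suc_iff) simp
  ultimately have "euler_product q (q * x) - 1 - x * euler_product q (q * x) = euler_product q x - 1"
    by (rule sums_unique2)
  thus ?thesis by (simp add: algebra_simps)
qed

text \<open>After n applications of the functional equation the remaining factor tends to
  \<open>euler_product q 0\<close>, which is 1, so a zero must come from one of finitely many linear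
  factors.\<close>

lemma euler_product_eq_0_iff:
  assumes q: "norm q < 1"
  shows "euler_product q x = 0 \<longleftrightarrow> (\<exists>n. q ^ n * x = 1)"
proof
  have split: "euler_product q x = (\<Prod>k<n. 1 - q ^ k * x) * euler_product q (q ^ n * x)" for n
  proof (induction n)
    case (Suc n)
    thus ?case using euler_product_functional_equation[OF q, of "q ^ n * x"] by (simp add: mult_ac)
  qed simp
  {
    assume "euler_product q x = 0"
    have "isCont (euler_product q) 0"
      using holomorphic_euler_product[OF q]
      by (meson UNIV_I analytic_at analytic_at_imp_isCont open_UNIV)
    moreover have "(\<lambda>n. q ^ n * x) \<longlonglongrightarrow> 0"
      using tendsto_mult[OF LIMSEQ_power_zero[OF q] tendsto_const[of x]] by simp
    ultimately have "(\<lambda>n. euler_product q (q ^ n * x)) \<longlonglongrightarrow> euler_product q 0"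
      by (rule isCont_tendsto_compose)
    hence "eventually (\<lambda>n. euler_product q (q ^ n * x) \<noteq> 0) sequentially"
      by (rule tendsto_imp_eventually_ne) (simp add: euler_product_0)
    then obtain n where "euler_product q (q ^ n * x) \<noteq> 0"
      by (auto simp: eventually_at_top_linorder)
    with split[of n] \<open>euler_product q x = 0\<close> have "(\<Prod>k<n. 1 - q ^ k * x) = 0" by simp
    thus "\<exists>n. q ^ n * x = 1" by (auto simp: prod_zero_iff)
  next
    assume "\<exists>n. q ^ n * x = 1"
    then obtain n where "q ^ n * x = 1" by blast
    with split[of "Suc n"] show "euler_product q x = 0" by simp
  }
qed

section \<open>The theta function, its multipliers and its zeros\<close>

definition nome :: "complex \<Rightarrow> complex" where
  "nome \<tau> = exp (2 * of_real pi * \<i> * \<tau>)"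

text \<open>Jacobi's odd theta function in product form, up to a factor depending on \<tau> only.
  The exponential in front makes it odd.\<close>

definition theta :: "complex \<Rightarrow> complex \<Rightarrow> complex" where
  "theta \<tau> z = exp (- (of_real pi * \<i> * z)) * euler_product (nome \<tau>) (nome z) *
     euler_product (nome \<tau>) (nome (\<tau> - z))"

lemma norm_nome_less_1: "\<tau> \<in> upper_half \<Longrightarrow> norm (nome \<tau>) < 1"
  by (simp add: nome_def upper_half_def)

lemma nome_add: "nome (z + w) = nome z * nome w"
  by (simp add: nome_def ring_distribs exp_add)

lemma nome_diff: "nome (z - w) = nome z / nome w"
  by (simp add: nome_def ring_distribs exp_diff)

lemma nome_nonzero [simp]: "nome z \<noteq> 0"
  by (simp add: nome_def)

lemma nome_1 [simp]: "nome 1 = 1"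
  using exp_two_pi_i by (simp add: nome_def)

lemma nome_0 [simp]: "nome 0 = 1"
  by (simp add: nome_def)

lemma nome_power: "nome z ^ n = nome (of_nat n * z)"
  by (simp add: nome_def mult_ac flip: exp_of_nat_mult)

lemma nome_eq_1_iff: "nome z = 1 \<longleftrightarrow> (\<exists>m::int. z = of_int m)"
proof
  assume "nome z = 1"
  then obtain n :: int where n: "Im (2 * of_real pi * \<i> * z) = of_int (2 * n) * pi"
    "Re (2 * of_real pi * \<i> * z) = 0"
    unfolding nome_def exp_eq_1 by auto
  hence "z = of_int n" by (simp add: complex_eq_iff)
  thus "\<exists>m::int. z = of_int m" by blast
next
  assume "\<exists>m::int. z = of_int m"
  then obtain m :: int where "z = of_int m" by blast
  thus "nome z = 1" unfolding nome_def exp_eq_1 by (auto intro!: exI[of _ m])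
qed

lemma holomorphic_nome [holomorphic_intros]: "f holomorphic_on A \<Longrightarrow> (\<lambda>z. nome (f z)) holomorphic_on A"
  unfolding nome_def by (intro holomorphic_intros)

lemma holomorphic_theta:
  assumes "\<tau> \<in> upper_half"
  shows "theta \<tau> holomorphic_on A"
proof -
  have *: "(\<lambda>z. euler_product (nome \<tau>) (f z)) holomorphic_on UNIV" if "f holomorphic_on UNIV" for f
    using holomorphic_on_compose_gen[OF that holomorphic_euler_product[OF norm_nome_less_1[OF assms]]]
    by (simp add: o_def)
  have "theta \<tau> holomorphic_on UNIV"
    unfolding theta_def by (intro holomorphic_intros *)
  thus ?thesis by (rule holomorphic_on_subset) auto
qed

lemma exp_two_pi: "exp (- (of_real pi * \<i> * z)) = exp (of_real pi * \<i> * z) / nome z"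
  unfolding nome_def by (subst exp_diff[symmetric]) (simp add: algebra_simps)

text \<open>The functional equation of \<open>euler_product\<close> moves the linear factor 1 -
  \<open>nome z\<close> from one of the two products to the other. The same exchange yields the
  multiplier of the period \<tau>.\<close>

lemma theta_uminus:
  assumes "\<tau> \<in> upper_half"
  shows "theta \<tau> (-z) = - theta \<tau> z"
proof -
  note fe = euler_product_functional_equation[OF norm_nome_less_1[OF assms]]
  let ?E = "euler_product (nome \<tau>)"
  have 1: "?E (nome (-z)) = (1 - 1 / nome z) * ?E (nome (\<tau> - z))"
    using fe[of "nome (-z)"] nome_diff[of 0 z] by (simp add: nome_diff)
  have 2: "?E (nome z) = (1 - nome z) * ?E (nome (\<tau> + z))"
    using fe[of "nome z"] by (simp add: nome_add)
  have "theta \<tau> (-z) = exp (of_real pi * \<i> * z) * (1 - 1 / nome z) * ?E (nome (\<tau> - z)) * ?E (nome (\<tau> + z))"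
    by (simp add: theta_def 1)
  also have "\<dots> = - (exp (of_real pi * \<i> * z) / nome z * ((1 - nome z) * ?E (nome (\<tau> + z))) * ?E (nome (\<tau> - z)))"
    by (simp add: field_simps)
  also have "\<dots> = - theta \<tau> z"
    by (simp only: theta_def 2 exp_two_pi)
  finally show ?thesis .
qed

lemma theta_plus_1: "theta \<tau> (z + 1) = - theta \<tau> z"
proof -
  have "exp (- (of_real pi * \<i> * (z + 1))) = - exp (- (of_real pi * \<i> * z))"
    by (simp add: algebra_simps exp_diff exp_pi_i exp_minus inverse_eq_divide)
  moreover have "nome (\<tau> - (z + 1)) = nome (\<tau> - z)" by (simp add: nome_diff nome_add)
  ultimately show ?thesis by (simp add: theta_def nome_add)
qed

lemma theta_plus_period:
  assumes "\<tau> \<in> upper_half"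
  shows "theta \<tau> (z + \<tau>) = - exp (- (of_real pi * \<i> * (\<tau> + 2 * z))) * theta \<tau> z"
proof -
  note fe = euler_product_functional_equation[OF norm_nome_less_1[OF assms]]
  let ?E = "euler_product (nome \<tau>)"
  have 1: "?E (nome (-z)) = (1 - 1 / nome z) * ?E (nome (\<tau> - z))"
    using fe[of "nome (-z)"] nome_diff[of 0 z] by (simp add: nome_diff)
  have 2: "?E (nome z) = (1 - nome z) * ?E (nome (z + \<tau>))"
    using fe[of "nome z"] by (simp add: nome_add mult.commute)
  have "theta \<tau> (z + \<tau>) = exp (- (of_real pi * \<i> * (z + \<tau>))) * ?E (nome (z + \<tau>)) * ?E (nome (-z))"
    by (simp add: theta_def)
  also have "\<dots> = - (exp (- (of_real pi * \<i> * (z + \<tau>))) / nome z) *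
      ((1 - nome z) * ?E (nome (z + \<tau>))) * ?E (nome (\<tau> - z))"
    by (simp add: 1 field_simps)
  also have "exp (- (of_real pi * \<i> * (z + \<tau>))) / nome z =
      exp (- (of_real pi * \<i> * (\<tau> + 2 * z))) * exp (- (of_real pi * \<i> * z))"
    unfolding nome_def by (simp add: algebra_simps flip: exp_diff exp_add)
  finally show ?thesis by (simp add: theta_def 2)
qed

text \<open>The exponent is quadratic in n. Taken at n z, the formula shows that theta at n z has,
  up to sign, the multiplier of theta at z raised to the power n^2.\<close>

lemma theta_plus_multiple:
  assumes "\<tau> \<in> upper_half"
  shows "theta \<tau> (z + of_nat n * \<tau>) =
    (-1) ^ n * exp (- (of_real pi * \<i> * (of_nat n ^ 2 * \<tau> + 2 * of_nat n * z))) * theta \<tau> z"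
proof (induction n)
  case (Suc n)
  have "theta \<tau> (z + of_nat (Suc n) * \<tau>) = theta \<tau> ((z + of_nat n * \<tau>) + \<tau>)"
    by (simp add: algebra_simps)
  also have "\<dots> = - exp (- (of_real pi * \<i> * (\<tau> + 2 * (z + of_nat n * \<tau>)))) *
      ((-1) ^ n * exp (- (of_real pi * \<i> * (of_nat n ^ 2 * \<tau> + 2 * of_nat n * z))) * theta \<tau> z)"
    by (simp only: theta_plus_period[OF assms] Suc)
  also have "\<dots> = (-1) ^ Suc n * (exp (- (of_real pi * \<i> * (\<tau> + 2 * (z + of_nat n * \<tau>)))) *
      exp (- (of_real pi * \<i> * (of_nat n ^ 2 * \<tau> + 2 * of_nat n * z)))) * theta \<tau> z"
    by simp
  also have "exp (- (of_real pi * \<i> * (\<tau> + 2 * (z + of_nat n * \<tau>)))) *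
      exp (- (of_real pi * \<i> * (of_nat n ^ 2 * \<tau> + 2 * of_nat n * z))) =
      exp (- (of_real pi * \<i> * (of_nat (Suc n) ^ 2 * \<tau> + 2 * of_nat (Suc n) * z)))"
    by (simp add: algebra_simps power2_eq_square flip: exp_add)
  finally show ?case .
qed simp

lemma theta_plus_of_nat: "theta \<tau> (z + of_nat n) = (-1) ^ n * theta \<tau> z"
proof (induction n)
  case (Suc n)
  have "theta \<tau> (z + of_nat (Suc n)) = theta \<tau> ((z + of_nat n) + 1)" by (simp add: algebra_simps)
  thus ?case by (simp only: theta_plus_1 Suc) simp
qed simp

lemma theta_eq_0_iff:
  assumes \<tau>: "\<tau> \<in> upper_half"
  shows "theta \<tau> z = 0 \<longleftrightarrow> z \<in> period_lattice \<tau>"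
proof -
  note zero = euler_product_eq_0_iff[OF norm_nome_less_1[OF \<tau>]]
  have "theta \<tau> z = 0 \<longleftrightarrow> (\<exists>n. nome \<tau> ^ n * nome z = 1) \<or> (\<exists>n. nome \<tau> ^ n * nome (\<tau> - z) = 1)"
    by (simp add: theta_def zero)
  also have "\<dots> \<longleftrightarrow> (\<exists>n m. of_nat n * \<tau> + z = of_int m) \<or> (\<exists>n m. of_nat (Suc n) * \<tau> - z = of_int m)"
    by (simp add: nome_power nome_eq_1_iff algebra_simps flip: nome_add)
  also have "\<dots> \<longleftrightarrow> z \<in> period_lattice \<tau>"
  proof
    assume "(\<exists>n m. of_nat n * \<tau> + z = of_int m) \<or> (\<exists>n m. of_nat (Suc n) * \<tau> - z = of_int m)"
    thus "z \<in> period_lattice \<tau>"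
    proof (elim disjE exE)
      fix n m assume "of_nat n * \<tau> + z = of_int m"
      hence "z = of_int m + of_int (- int n) * \<tau>" by (simp add: algebra_simps)
      thus ?thesis unfolding period_lattice_def by blast
    next
      fix n m assume "of_nat (Suc n) * \<tau> - z = of_int m"
      hence "z = of_int (- m) + of_int (int (Suc n)) * \<tau>" by (simp add: algebra_simps)
      thus ?thesis unfolding period_lattice_def by blast
    qed
  next
    assume "z \<in> period_lattice \<tau>"
    then obtain m n where z: "z = of_int m + of_int n * \<tau>" unfolding period_lattice_def by blast
    show "(\<exists>n m. of_nat n * \<tau> + z = of_int m) \<or> (\<exists>n m. of_nat (Suc n) * \<tau> - z = of_int m)"
    \<comment> \<open>The first product supplies the zeros with coefficient n \<le> 0, the second,
      which starts one step later, those with n > 0.\<close>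
    proof (cases "n \<le> 0")
      case True
      hence "of_nat (nat (-n)) * \<tau> + z = of_int m" by (simp add: z)
      thus ?thesis by blast
    next
      case False
      hence "of_nat (Suc (nat (n - 1))) = (of_int n :: complex)"
        by (simp add: of_nat_nat)
      hence "of_nat (Suc (nat (n - 1))) * \<tau> - z = of_int (-m)" by (simp only: z) simp
      thus ?thesis by blast
    qed
  qed
  finally show ?thesis .
qed

lemma theta_has_derivative:
  assumes "\<tau> \<in> upper_half"
  shows "(theta \<tau> has_field_derivative deriv (theta \<tau>) z) (at z)"
  using holomorphic_derivI[OF holomorphic_theta[OF assms, of UNIV]] by simp

text \<open>Splitting off the factor 1 - \<open>nome z\<close>, which has a simple zero at 0, leaves
  a function that is nonzero there because no positive power of \<open>nome \<tau>\<close> equals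
  1.\<close>

lemma deriv_theta_0:
  assumes \<tau>: "\<tau> \<in> upper_half"
  shows "deriv (theta \<tau>) 0 \<noteq> 0"
proof -
  let ?E = "euler_product (nome \<tau>)"
  define h where "h z = exp (- (of_real pi * \<i> * z)) * ?E (nome (\<tau> + z)) * ?E (nome (\<tau> - z))" for z
  have *: "(\<lambda>z. ?E (f z)) holomorphic_on UNIV" if "f holomorphic_on UNIV" for f
    using holomorphic_on_compose_gen[OF that holomorphic_euler_product[OF norm_nome_less_1[OF \<tau>]]]
    by (simp add: o_def)
  have "h holomorphic_on UNIV" unfolding h_def by (intro holomorphic_intros *)
  hence h: "(h has_field_derivative deriv h 0) (at 0)" using holomorphic_derivI by blast
  have "theta \<tau> z = (1 - nome z) * h z" for z
    using euler_product_functional_equation[OF norm_nome_less_1[OF \<tau>], of "nome z"]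
    by (simp add: theta_def h_def nome_add)
  hence th: "theta \<tau> = (\<lambda>z. (1 - nome z) * h z)" by blast
  have "((\<lambda>z. 1 - nome z) has_field_derivative - (2 * of_real pi * \<i>)) (at 0)"
    unfolding nome_def by (auto intro!: derivative_eq_intros)
  from DERIV_mult[OF this h] have "deriv (theta \<tau>) 0 = - (2 * of_real pi * \<i>) * h 0"
    unfolding th by (intro DERIV_imp_deriv) simp
  moreover have "?E (nome \<tau>) \<noteq> 0"
  proof
    assume "?E (nome \<tau>) = 0"
    then obtain n where "nome \<tau> ^ n * nome \<tau> = 1"
      unfolding euler_product_eq_0_iff[OF norm_nome_less_1[OF \<tau>]] by blast
    thus False using one_minus_power_neq_0[OF norm_nome_less_1[OF \<tau>], of n] by (simp add: mult.commute)
  qed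
  ultimately show ?thesis by (simp add: h_def)
qed

text \<open>At a zero, differentiating a relation theta(z + v) = E(z) theta(z) merely multiplies the
  derivative by E(z), which is nonzero. So simplicity travels from 0 along the periods.\<close>

lemma deriv_theta_nonzero:
  assumes \<tau>: "\<tau> \<in> upper_half" and w: "w \<in> period_lattice \<tau>"
  shows "deriv (theta \<tau>) w \<noteq> 0"
proof -
  \<comment> \<open>The statement is vacuous off the lattice, which makes \<open>P\<close> periodic
    on the whole plane, as \<open>periodic_of_int\<close> demands.\<close>
  define P where "P z \<longleftrightarrow> (z \<in> period_lattice \<tau> \<longrightarrow> deriv (theta \<tau>) z \<noteq> 0)" for z
  have *: "P (z + v) = P z" if v: "v \<in> period_lattice \<tau>" and
    E: "E holomorphic_on UNIV" "\<And>z. E z \<noteq> 0" "\<And>z. theta \<tau> (z + v) = E z * theta \<tau> z" for z v E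
  proof -
    have "deriv (theta \<tau>) (z + v) = E z * deriv (theta \<tau>) z" if "z \<in> period_lattice \<tau>"
    proof -
      have "(E has_field_derivative deriv E z) (at z)" using E(1) holomorphic_derivI by blast
      from DERIV_mult[OF this theta_has_derivative[OF \<tau>, of z]]
      have "((\<lambda>z. theta \<tau> (z + v)) has_field_derivative E z * deriv (theta \<tau>) z) (at z)"
        unfolding E(3) using theta_eq_0_iff[OF \<tau>, of z] that by (simp add: mult.commute)
      moreover have "((\<lambda>z. theta \<tau> (z + v)) has_field_derivative deriv (theta \<tau>) (z + v)) (at z)"
        using theta_has_derivative[OF \<tau>, of "z + v"] by (simp add: DERIV_shift)
      ultimately show ?thesis by (rule DERIV_unique[rotated])
    qed
    thus ?thesis using v E(2)[of z] by (auto simp: P_def)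
  qed
  have 1: "P (z + 1) = P z" for z
    by (rule *[of _ "\<lambda>_. -1"]) (auto simp: theta_plus_1)
  have 2: "P (z + \<tau>) = P z" for z
    by (rule *[of _ "\<lambda>z. - exp (- (of_real pi * \<i> * (\<tau> + 2 * z)))"])
       (auto simp: theta_plus_period[OF \<tau>] intro!: holomorphic_intros)
  obtain m n where mn: "w = of_int m + of_int n * \<tau>" using w by (auto simp: period_lattice_def)
  have "P w = P ((0 + of_int m * 1) + of_int n * \<tau>)" by (simp add: mn)
  also have "\<dots> = P 0" unfolding periodic_of_int[of P \<tau>, OF 2] periodic_of_int[of P 1, OF 1] ..
  also have "P 0" by (simp add: P_def deriv_theta_0[OF \<tau>])
  finally show ?thesis using w by (simp add: P_def)
qed

text \<open>At a common zero the quotient f/g is the quotient of the two difference quotients, both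
  of which extend holomorphically. The value of the extension is recorded because it decides whether
  the quotient vanishes at a lattice point.\<close>

lemma holomorphic_quotient_simple_zeros:
  assumes f: "f holomorphic_on UNIV" and g: "g holomorphic_on UNIV"
    and zero: "\<And>w. g w = 0 \<Longrightarrow> f w = 0 \<and> deriv g w \<noteq> 0"
  obtains h where "h holomorphic_on UNIV" "\<And>w. f w = g w * h w"
    "\<And>w. g w = 0 \<Longrightarrow> h w = deriv f w / deriv g w"
proof -
  define h where "h w = (if g w = 0 then deriv f w / deriv g w else f w / g w)" for w
  have slope: "(\<lambda>z. if z = w then deriv F w else (F z - F w) / (z - w)) analytic_on {w}"
    if "F holomorphic_on UNIV" for F :: "complex \<Rightarrow> complex" and w
    using pole_lemma[OF that, of w] analytic_at by fastforce
  have "h analytic_on {w}" for w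
  proof (cases "g w = 0")
    case False
    have "g analytic_on {w}" "f analytic_on {w}" using f g analytic_at open_UNIV UNIV_I by blast+
    hence an: "(\<lambda>z. f z / g z) analytic_on {w}" using False by (intro analytic_intros) auto
    have "eventually (\<lambda>z. g z \<noteq> 0) (nhds w)"
      using analytic_at_imp_isCont[OF \<open>g analytic_on {w}\<close>] False
      by (simp add: isCont_def tendsto_imp_eventually_ne eventually_nhds_conv_at)
    hence "eventually (\<lambda>z. h z = f z / g z) (nhds w)" by eventually_elim (simp add: h_def)
    from analytic_at_cong[OF this refl] an show ?thesis by simp
  next
    case True
    define F where "F z = (if z = w then deriv f w else (f z - f w) / (z - w))" for z
    define G where "G z = (if z = w then deriv g w else (g z - g w) / (z - w))" for z
    have FG: "F analytic_on {w}" "G analytic_on {w}"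
      unfolding F_def G_def by (rule slope[OF f] slope[OF g])+
    have "G w \<noteq> 0" using zero[OF True] by (simp add: G_def)
    hence an: "(\<lambda>z. F z / G z) analytic_on {w}" using FG by (intro analytic_intros) auto
    have "eventually (\<lambda>z. G z \<noteq> 0) (nhds w)"
      using analytic_at_imp_isCont[OF FG(2)] \<open>G w \<noteq> 0\<close>
      by (simp add: isCont_def tendsto_imp_eventually_ne eventually_nhds_conv_at)
    hence "eventually (\<lambda>z. h z = F z / G z) (nhds w)"
    proof eventually_elim
      case (elim z)
      thus ?case using True zero[OF True] by (auto simp: h_def F_def G_def)
    qed
    from analytic_at_cong[OF this refl] an show ?thesis by simp
  qed
  hence "h analytic_on UNIV" by (subst analytic_on_analytic_at) blast
  hence "h holomorphic_on UNIV" by (rule analytic_imp_holomorphic)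
  thus ?thesis
    by (rule that) (use zero in \<open>auto simp: h_def\<close>)
qed

section \<open>Division functions\<close>

lemma eventually_nhds_0_mult:
  fixes a :: complex
  assumes "\<forall>\<^sub>F z in nhds 0. P z"
  shows "\<forall>\<^sub>F z in nhds 0. P (a * z)"
proof -
  have "filterlim (\<lambda>z. a * z) (nhds (a * 0)) (nhds 0)"
    by (intro tendsto_mult tendsto_const filterlim_ident)
  hence "filterlim (\<lambda>z. a * z) (nhds 0) (nhds 0)" by simp
  from eventually_compose_filterlim[OF assms this] show ?thesis .
qed

lemma even_fpsI:
  fixes f :: "complex \<Rightarrow> complex"
  assumes f: "f has_fps_expansion A" and ev: "\<forall>\<^sub>F z in nhds 0. f (-z) = f z"
  shows "even_fps A"
proof -
  have "(\<lambda>z::complex. -1 * z) has_fps_expansion fps_const (-1) * fps_X"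
    by (intro fps_expansion_intros)
  from has_fps_expansion_compose[OF f this]
  have "(\<lambda>z. f (-z)) has_fps_expansion (A oo (fps_const (-1) * fps_X))" by (simp add: o_def)
  hence "f has_fps_expansion (A oo (fps_const (-1) * fps_X))"
    using has_fps_expansion_cong[OF ev refl] by blast
  hence "A = A oo (fps_const (-1) * fps_X)" using f fps_expansion_unique_complex by blast
  hence *: "fps_nth A n = (-1) ^ n * fps_nth A n" for n
    unfolding fps_compose_linear by (metis fps_nth_Abs_fps)
  have "fps_nth A n = 0" if "odd n" for n
    using *[of n] that by simp
  thus ?thesis by (simp add: even_fps_def)
qed

lemma has_fps_expansion_compose_linear:
  fixes f :: "complex \<Rightarrow> complex"
  assumes "f has_fps_expansion A"
  shows "(\<lambda>z. f (a * z)) has_fps_expansion (A oo (fps_const a * fps_X))"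
proof -
  have "(\<lambda>z::complex. a * z) has_fps_expansion fps_const a * fps_X"
    by (intro fps_expansion_intros)
  from has_fps_expansion_compose[OF assms this] show ?thesis by (simp add: o_def)
qed

text \<open>A multiplier u exp(b z) adds the constant b to the logarithmic derivative, and one more
  derivative removes it.\<close>

lemma elliptic_theta_log_deriv:
  assumes \<tau>: "\<tau> \<in> upper_half"
  shows "elliptic \<tau> (deriv (\<lambda>z. deriv (theta \<tau>) z / theta \<tau> z))"
  unfolding elliptic_def
proof (intro conjI allI impI)
  let ?L = "\<lambda>z. deriv (theta \<tau>) z / theta \<tau> z"
  have op: "open (- period_lattice \<tau>)" using closed_period_lattice[OF \<tau>] by auto
  have dhol: "deriv (theta \<tau>) holomorphic_on - period_lattice \<tau>"
    by (intro holomorphic_deriv holomorphic_theta \<tau> op)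
  have hol: "?L holomorphic_on - period_lattice \<tau>"
    by (intro holomorphic_intros dhol holomorphic_theta \<tau>) (auto simp: theta_eq_0_iff[OF \<tau>])
  thus "deriv ?L holomorphic_on - period_lattice \<tau>"
    by (rule holomorphic_deriv) (rule op)
  fix z assume z: "z \<notin> period_lattice \<tau>"
  have *: "deriv ?L (z + v) = deriv ?L z"
    if v: "v \<in> period_lattice \<tau>" and u: "\<And>z. theta \<tau> (z + v) = u * exp (b * z) * theta \<tau> z" "u \<noteq> 0" for u b v
  proof -
    have L: "?L (w + v) = b + ?L w" if w: "w \<notin> period_lattice \<tau>" for w
    proof -
      have "((\<lambda>z. theta \<tau> (z + v)) has_field_derivative deriv (theta \<tau>) (w + v)) (at w)"
        using theta_has_derivative[OF \<tau>, of "w + v"] by (simp add: DERIV_shift)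
      moreover have "((\<lambda>z. theta \<tau> (z + v)) has_field_derivative
          u * (b * exp (b * w)) * theta \<tau> w + deriv (theta \<tau>) w * (u * exp (b * w))) (at w)"
        unfolding u(1)
        by (auto intro!: derivative_eq_intros theta_has_derivative \<tau>)
      ultimately have "deriv (theta \<tau>) (w + v) =
          u * (b * exp (b * w)) * theta \<tau> w + deriv (theta \<tau>) w * (u * exp (b * w))"
        by (rule DERIV_unique)
      thus ?thesis unfolding u(1) using u(2) w by (simp add: theta_eq_0_iff[OF \<tau>] field_simps)
    qed
    have "deriv ?L (z + v) = deriv (\<lambda>w. ?L (w + v)) z" by (simp add: deriv_def DERIV_shift)
    also have "\<dots> = deriv (\<lambda>w. b + ?L w) z"
      by (rule deriv_cong_ev)
         (use eventually_nhds_in_open[OF op, of z] z L in \<open>auto elim!: eventually_mono\<close>)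
    also have "\<dots> = deriv ?L z"
    proof (rule DERIV_imp_deriv)
      have "(?L has_field_derivative deriv ?L z) (at z)"
        using holomorphic_derivI[OF hol op, of z] z by simp
      from DERIV_add[OF DERIV_const this] show "((\<lambda>w. b + ?L w) has_field_derivative deriv ?L z) (at z)"
        by simp
    qed
    finally show ?thesis .
  qed
  show "deriv ?L (z + 1) = deriv ?L z"
    by (rule *[of 1 "-1" 0]) (simp_all add: theta_plus_1)
  show "deriv ?L (z + \<tau>) = deriv ?L z"
  proof (rule *[of \<tau> "- exp (- (of_real pi * \<i> * \<tau>))" "- (2 * of_real pi * \<i>)"])
    fix w
    have "exp (- (of_real pi * \<i> * (\<tau> + 2 * w))) =
        exp (- (of_real pi * \<i> * \<tau>)) * exp (- (2 * of_real pi * \<i>) * w)"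
      by (simp add: algebra_simps flip: exp_add)
    thus "theta \<tau> (w + \<tau>) = - exp (- (of_real pi * \<i> * \<tau>)) * exp (- (2 * of_real pi * \<i>) * w) * theta \<tau> w"
      by (simp add: theta_plus_period[OF \<tau>])
  qed auto
qed

text \<open>The factor z of theta contributes the double pole -1/z^2, which is to cancel against the
  pole of \<wp>.\<close>

lemma theta_log_deriv_near_0:
  assumes \<tau>: "\<tau> \<in> upper_half" and G: "g has_fps_expansion G" and G0: "fps_nth G 0 \<noteq> 0"
    and th: "\<forall>\<^sub>F z in nhds 0. theta \<tau> z = z * g z"
  shows "\<forall>\<^sub>F z in at 0. deriv (\<lambda>z. deriv (theta \<tau>) z / theta \<tau> z) z =
    - 1 / z\<^sup>2 + deriv (\<lambda>z. deriv g z / g z) z"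
proof -
  have g0: "g 0 \<noteq> 0" using has_fps_expansion_imp_0_eq_fps_nth_0[OF G] G0 by simp
  have an: "g analytic_on {0}" by (rule has_fps_expansion_imp_analytic_0[OF G])
  then obtain S1 where S1: "open S1" "0 \<in> S1" "g holomorphic_on S1" by (auto simp: analytic_at)
  obtain S2 where S2: "open S2" "0 \<in> S2" "\<And>z. z \<in> S2 \<Longrightarrow> theta \<tau> z = z * g z"
    using th unfolding eventually_nhds by blast
  have "\<forall>\<^sub>F z in nhds 0. g z \<noteq> 0"
    using analytic_at_imp_isCont[OF an] g0
    by (simp add: isCont_def tendsto_imp_eventually_ne eventually_nhds_conv_at)
  then obtain S3 where S3: "open S3" "0 \<in> S3" "\<And>z. z \<in> S3 \<Longrightarrow> g z \<noteq> 0"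
    unfolding eventually_nhds by blast
  define S where "S = S1 \<inter> S2 \<inter> S3"
  have S: "open S" "0 \<in> S" "g holomorphic_on S" "\<And>z. z \<in> S \<Longrightarrow> theta \<tau> z = z * g z" "\<And>z. z \<in> S \<Longrightarrow> g z \<noteq> 0"
    using S1 S2 S3 by (auto simp: S_def intro: holomorphic_on_subset)
  have opS: "open (S - {0})" using S by auto
  have d1: "deriv (theta \<tau>) z / theta \<tau> z = 1 / z + deriv g z / g z" if z: "z \<in> S - {0}" for z
  proof -
    have "deriv (theta \<tau>) z = deriv (\<lambda>z. z * g z) z"
      by (rule deriv_cong_ev)
         (use eventually_nhds_in_open[OF S(1), of z] z S(4) in \<open>auto elim!: eventually_mono\<close>)
    also have "\<dots> = 1 * g z + deriv g z * z"
      using holomorphic_derivI[OF S(3,1), of z] z by (intro DERIV_imp_deriv DERIV_mult DERIV_ident) auto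
    finally show ?thesis using z S(4,5) by (simp add: field_simps)
  qed
  have "deriv (\<lambda>z. deriv (theta \<tau>) z / theta \<tau> z) z = - 1 / z\<^sup>2 + deriv (\<lambda>z. deriv g z / g z) z"
    if z: "z \<in> S - {0}" for z
  proof -
    have "deriv (\<lambda>z. deriv (theta \<tau>) z / theta \<tau> z) z = deriv (\<lambda>z. 1 / z + deriv g z / g z) z"
      by (rule deriv_cong_ev)
         (use eventually_nhds_in_open[OF opS, of z] z d1 in \<open>auto elim!: eventually_mono\<close>)
    also have "\<dots> = - 1 / z\<^sup>2 + deriv (\<lambda>z. deriv g z / g z) z"
    proof (rule DERIV_imp_deriv, rule DERIV_add)
      show "((\<lambda>z. 1 / z) has_field_derivative - 1 / z\<^sup>2) (at z)"
        using z by (auto intro!: derivative_eq_intros simp: power2_eq_square)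
      have "(\<lambda>z. deriv g z / g z) holomorphic_on S"
        using S by (intro holomorphic_intros holomorphic_deriv) auto
      from holomorphic_derivI[OF this S(1), of z] z
      show "((\<lambda>z. deriv g z / g z) has_field_derivative deriv (\<lambda>z. deriv g z / g z) z) (at z)" by auto
    qed
    finally show ?thesis .
  qed
  moreover have "\<forall>\<^sub>F z in at 0. z \<in> S - {0}"
    using S(1,2) by (rule eventually_at_in_open)
  ultimately show ?thesis by (auto elim: eventually_mono)
qed

lemma has_fps_expansion_log_deriv:
  fixes g :: "complex \<Rightarrow> complex"
  assumes "g has_fps_expansion G" "fps_nth G 0 \<noteq> 0"
  shows "(\<lambda>z. deriv g z / g z) has_fps_expansion (fps_deriv G * inverse G)"
proof -
  have "(\<lambda>z. deriv g z * inverse (g z)) has_fps_expansion (fps_deriv G * inverse G)"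
    by (intro fps_expansion_intros assms)
  thus ?thesis by (simp add: field_simps)
qed

text \<open>Here \<open>z * s z\<close> is the Weierstrass sigma function, which determines \<open>s\<close> by its second
  logarithmic derivative \<open>-\<wp>\<close>. The constants \<open>c\<close> and \<open>\<kappa>\<close> cancel in the division functions.\<close>

lemma theta_normal_form:
  assumes \<tau>: "\<tau> \<in> upper_half"
  obtains c \<kappa> s S where "c \<noteq> 0" "s has_fps_expansion S"
    "\<forall>\<^sub>F z in nhds 0. theta \<tau> z = c * z * s z * exp (\<kappa> * z\<^sup>2)"
    "fps_nth S 0 = 1" "even_fps S" "fps_deriv (fps_deriv S * inverse S) = - wp_fps \<tau>"
proof -
  have "theta \<tau> analytic_on {0}"
    using holomorphic_theta[OF \<tau>, of UNIV] by (auto simp: analytic_at)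
  then obtain Th where Th: "theta \<tau> has_fps_expansion Th"
    using analytic_at_imp_has_fps_expansion_0 by blast
  have "fps_nth Th 0 = 0"
    using has_fps_expansion_imp_0_eq_fps_nth_0[OF Th] theta_eq_0_iff[OF \<tau>, of 0] by simp
  then obtain g where g: "g has_fps_expansion fps_shift 1 Th" "\<forall>\<^sub>F z in nhds 0. theta \<tau> z = z ^ 1 * g z"
    using has_fps_expansion_shift[OF Th, of 1] by auto
  define G where "G = fps_shift 1 Th"
  define c where "c = fps_nth G 0"
  have gG: "g has_fps_expansion G" using g(1) by (simp add: G_def)
  have c: "c \<noteq> 0"
    using fps_nth_fps_expansion[OF Th, of 1] deriv_theta_0[OF \<tau>] by (simp add: c_def G_def)
  have thg: "\<forall>\<^sub>F z in nhds 0. theta \<tau> z = z * g z" using g(2) by simp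
  let ?L = "\<lambda>z. deriv (theta \<tau>) z / theta \<tau> z"
  note gl = has_fps_expansion_log_deriv[OF gG c[unfolded c_def]]
  \<comment> \<open>The constant that Liouville's theorem assigns to the sum of \<wp> and the second
    logarithmic derivative of theta. The constant term of \<open>wp_fps\<close> is 0, so the value
    comes from \<open>G\<close> alone.\<close>
  define k where "k = fps_nth (fps_deriv (fps_deriv G * inverse G)) 0"
  have near: "\<forall>\<^sub>F z in at 0. deriv ?L z + weierstrass_p \<tau> z =
      deriv (\<lambda>z. deriv g z / g z) z + wp_regular \<tau> z"
    using theta_log_deriv_near_0[OF \<tau> gG c[unfolded c_def] thg]
    by eventually_elim (simp add: weierstrass_p_eq_regular[OF \<tau>])
  have exp: "(\<lambda>z. deriv (\<lambda>z. deriv g z / g z) z + wp_regular \<tau> z) has_fps_expansion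
      fps_deriv (fps_deriv G * inverse G) + wp_fps \<tau>"
    by (intro fps_expansion_intros gl wp_regular_has_fps_expansion \<tau>)
  have "((\<lambda>z. deriv ?L z + weierstrass_p \<tau> z) \<longlongrightarrow> k) (at 0)"
  proof (rule Lim_transform_eventually)
    show "((\<lambda>z. deriv (\<lambda>z. deriv g z / g z) z + wp_regular \<tau> z) \<longlongrightarrow> k) (at 0)"
      using has_fps_expansion_tendsto_at[OF exp] by (simp add: k_def)
    show "\<forall>\<^sub>F z in at 0. deriv (\<lambda>z. deriv g z / g z) z + wp_regular \<tau> z =
        deriv ?L z + weierstrass_p \<tau> z"
      using near by eventually_elim simp
  qed
  hence const: "deriv ?L z + weierstrass_p \<tau> z = k" if "z \<notin> period_lattice \<tau>" for z
    using elliptic_constant[OF \<tau> elliptic_add[OF elliptic_theta_log_deriv[OF \<tau>] elliptic_weierstrass_p[OF \<tau>]]] that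
    by blast
  have "\<forall>\<^sub>F z in at 0. (deriv (\<lambda>z. deriv g z / g z) z + wp_regular \<tau> z) - k = 0"
    using near eventually_not_in_period_lattice[OF \<tau>] by eventually_elim (simp add: const)
  moreover have "(\<lambda>z. (deriv (\<lambda>z. deriv g z / g z) z + wp_regular \<tau> z) - k) has_fps_expansion
      fps_deriv (fps_deriv G * inverse G) + wp_fps \<tau> - fps_const k"
    by (intro fps_expansion_intros exp)
  ultimately have "fps_deriv (fps_deriv G * inverse G) + wp_fps \<tau> - fps_const k = 0"
    by (rule has_fps_expansion_eventually_0[rotated])
  hence LG: "fps_deriv (fps_deriv G * inverse G) = fps_const k - wp_fps \<tau>"
    by (simp add: algebra_simps)
  \<comment> \<open>This Gaussian has second logarithmic derivative -k, which removes the constant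
    from \<open>fps_const k - wp_fps \<tau>\<close>.\<close>
  define E where "E z = exp (- (k / 2) * z\<^sup>2)" for z
  have "E analytic_on {0}" unfolding E_def by (intro analytic_intros)
  then obtain EE where EE: "E has_fps_expansion EE"
    using analytic_at_imp_has_fps_expansion_0 by blast
  have EE0: "fps_nth EE 0 = 1"
    using has_fps_expansion_imp_0_eq_fps_nth_0[OF EE] by (simp add: E_def)
  have "deriv E = (\<lambda>z. - k * z * E z)"
    unfolding E_def by (auto intro!: DERIV_imp_deriv derivative_eq_intros)
  moreover have "(\<lambda>z. - k * z * E z) has_fps_expansion fps_const (-k) * fps_X * EE"
    by (intro fps_expansion_intros EE)
  ultimately have dEE: "fps_deriv EE = fps_const (-k) * fps_X * EE"
    using has_fps_expansion_deriv[OF EE] fps_expansion_unique_complex by metis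
  define s where "s z = 1 / c * (g z * E z)" for z
  define S where "S = fps_const (1 / c) * (G * EE)"
  have sS: "s has_fps_expansion S" unfolding s_def S_def by (intro fps_expansion_intros gG EE)
  have S0: "fps_nth S 0 = 1" using c EE0 by (simp add: S_def c_def)
  have thE: "theta \<tau> z = c * z * s z * exp (k / 2 * z\<^sup>2)" if "theta \<tau> z = z * g z" for z
    using c that by (simp add: s_def E_def exp_minus field_simps)
  show ?thesis
  proof (rule that[OF c sS])
    show "\<forall>\<^sub>F z in nhds 0. theta \<tau> z = c * z * s z * exp (k / 2 * z\<^sup>2)"
      using thg thE by (auto elim: eventually_mono)
    show "fps_nth S 0 = 1" by fact
    show "even_fps S"
    proof (rule even_fpsI[OF sS])
      have "\<forall>\<^sub>F z in nhds 0. theta \<tau> (-z) = - z * g (-z)"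
        using eventually_nhds_0_mult[OF thg, of "-1"] by simp
      with thg show "\<forall>\<^sub>F z in nhds 0. s (- z) = s z"
      proof eventually_elim
        case (elim z)
        thus ?case by (cases "z = 0") (auto simp: s_def E_def theta_uminus[OF \<tau>])
      qed
    qed
    have nz: "fps_nth G 0 \<noteq> 0" "fps_nth EE 0 \<noteq> 0" using c EE0 by (auto simp: c_def)
    hence inv: "G * inverse G = 1" "EE * inverse EE = 1"
      by (auto intro: inverse_mult_eq_1')
    have "fps_deriv S * inverse S = fps_const (1 / c) * (fps_deriv G * EE + G * (fps_const (-k) * fps_X * EE)) *
        (fps_const c * (inverse G * inverse EE))"
      unfolding S_def using c by (simp add: fps_inverse_mult dEE fps_const_inverse algebra_simps)
    also have "\<dots> = (fps_const (1 / c) * fps_const c) * ((fps_deriv G * inverse G) * (EE * inverse EE) -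
        fps_const k * fps_X * (G * inverse G) * (EE * inverse EE))"
      by (simp add: algebra_simps fps_const_neg[symmetric] del: fps_const_neg)
    also have "\<dots> = fps_deriv G * inverse G - fps_const k * fps_X"
      using c by (simp add: inv)
    finally have "fps_deriv (fps_deriv S * inverse S) =
        fps_deriv (fps_deriv G * inverse G) - fps_deriv (fps_const k * fps_X)"
      by (simp only: fps_deriv_sub)
    thus "fps_deriv (fps_deriv S * inverse S) = - wp_fps \<tau>"
      unfolding LG by simp
  qed
qed

text \<open>The data are chosen for each \<tau> independently, yet the coefficients of
  \<open>S\<close> are forced: its logarithmic derivative L is an integral of -\<open>wp_fps\<close>
  whose constant vanishes by evenness, and S' = L S with constant term 1 is a recursion that
  respects weights.\<close>

lemma theta_normal_form_graded:
  obtains c \<kappa> s S where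
    "\<And>\<tau>. \<tau> \<in> upper_half \<Longrightarrow> c \<tau> \<noteq> 0"
    "\<And>\<tau>. \<tau> \<in> upper_half \<Longrightarrow> s \<tau> has_fps_expansion S \<tau>"
    "\<And>\<tau>. \<tau> \<in> upper_half \<Longrightarrow> \<forall>\<^sub>F z in nhds 0. theta \<tau> z = c \<tau> * z * s \<tau> z * exp (\<kappa> \<tau> * z\<^sup>2)"
    "\<And>\<tau>. \<tau> \<in> upper_half \<Longrightarrow> fps_nth (S \<tau>) 0 = 1"
    "\<And>\<tau>. \<tau> \<in> upper_half \<Longrightarrow> even_fps (S \<tau>)"
    "graded_fps 0 S"
proof -
  define P where "P \<tau> = (\<lambda>(c, \<kappa>, s, S). c \<noteq> 0 \<and> s has_fps_expansion S \<and>
    (\<forall>\<^sub>F z in nhds 0. theta \<tau> z = c * z * s z * exp (\<kappa> * z\<^sup>2)) \<and>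
    fps_nth S 0 = 1 \<and> even_fps S \<and> fps_deriv (fps_deriv S * inverse S) = - wp_fps \<tau>)" for \<tau>
  have "\<exists>x. P \<tau> x" if "\<tau> \<in> upper_half" for \<tau>
    by (rule theta_normal_form[OF that]) (auto simp: P_def intro!: exI)
  then obtain x where x: "P \<tau> (x \<tau>)" if "\<tau> \<in> upper_half" for \<tau> by metis
  define c where "c \<tau> = fst (x \<tau>)" for \<tau>
  define \<kappa> where "\<kappa> \<tau> = fst (snd (x \<tau>))" for \<tau>
  define s where "s \<tau> = fst (snd (snd (x \<tau>)))" for \<tau>
  define S where "S \<tau> = snd (snd (snd (x \<tau>)))" for \<tau>
  have P: "c \<tau> \<noteq> 0" "s \<tau> has_fps_expansion S \<tau>"
    "\<forall>\<^sub>F z in nhds 0. theta \<tau> z = c \<tau> * z * s \<tau> z * exp (\<kappa> \<tau> * z\<^sup>2)"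
    "fps_nth (S \<tau>) 0 = 1" "even_fps (S \<tau>)"
    "fps_deriv (fps_deriv (S \<tau>) * inverse (S \<tau>)) = - wp_fps \<tau>" if "\<tau> \<in> upper_half" for \<tau>
    using x[OF that] by (auto simp: P_def c_def \<kappa>_def s_def S_def case_prod_unfold)
  have "weighted_form n (\<lambda>p. fps_nth (S (fst p)) n)" for n
  proof (induction n rule: less_induct)
    case (less n)
    show ?case
    proof (cases n)
      case 0
      have "weighted_form 0 (\<lambda>p. fps_nth (S (fst p)) 0)"
        by (rule weighted_form_cong[OF weighted_form_const[of 1]]) (simp add: P(4) fst_Tor12)
      thus ?thesis using 0 by simp
    next
      case (Suc m)
      \<comment> \<open>The coefficients of the logarithmic derivative of \<open>S \<tau>\<close>,
        obtained by integrating -\<open>wp_fps\<close> termwise; the value 0 at index 0 comes from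
        evenness.\<close>
      define N where "N \<tau> i = (if i = 0 then 0 else - fps_nth (wp_fps \<tau>) (i - 1) / of_nat i)" for \<tau> i
      have "weighted_form n (\<lambda>p. 1 / of_nat n * (\<Sum>i=0..m. N (fst p) i * fps_nth (S (fst p)) (m - i)))"
      proof (intro weighted_form_cmult weighted_form_sum)
        fix i assume i: "i \<in> {0..m}"
        show "weighted_form n (\<lambda>p. N (fst p) i * fps_nth (S (fst p)) (m - i))"
        proof (cases "i = 0")
          case False
          have "weighted_form (i - 1 + 2) (\<lambda>p. (- 1 / of_nat i) * fps_nth (wp_fps (fst p)) (i - 1))"
            by (intro weighted_form_cmult graded_fpsD[OF graded_fps_wp_fps])
          moreover have "weighted_form (m - i) (\<lambda>p. fps_nth (S (fst p)) (m - i))"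
            using Suc by (intro less) simp
          ultimately have "weighted_form ((i - 1 + 2) + (m - i))
              (\<lambda>p. (- 1 / of_nat i) * fps_nth (wp_fps (fst p)) (i - 1) * fps_nth (S (fst p)) (m - i))"
            by (rule weighted_form_mult)
          moreover have "(i - 1 + 2) + (m - i) = n" using i False Suc by auto
          ultimately show ?thesis using False by (simp add: N_def)
        qed (simp add: N_def weighted_form_0)
      qed auto
      thus ?thesis
      proof (rule weighted_form_cong)
        fix p assume "p \<in> Tor12"
        hence \<tau>: "fst p \<in> upper_half" by (rule fst_Tor12)
        let ?S = "S (fst p)"
        define L where "L = fps_deriv ?S * inverse ?S"
        have "L * ?S = fps_deriv ?S * (inverse ?S * ?S)" by (simp add: L_def mult_ac)
        also have "inverse ?S * ?S = 1" using P(4)[OF \<tau>] by (intro inverse_mult_eq_1) auto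
        finally have LS: "L * ?S = fps_deriv ?S" by simp
        have "fps_nth ?S 1 = 0" using P(5)[OF \<tau>] by (simp add: even_fps_def)
        hence L0: "fps_nth L 0 = 0" by (simp add: L_def)
        have Li: "fps_nth L i = N (fst p) i" for i
        proof (cases i)
          case 0
          thus ?thesis by (simp add: L0 N_def)
        next
          case (Suc j)
          have "fps_nth (fps_deriv L) j = - fps_nth (wp_fps (fst p)) j"
            using P(6)[OF \<tau>] by (simp add: L_def)
          hence "of_nat (Suc j) * fps_nth L (Suc j) = - fps_nth (wp_fps (fst p)) j"
            by (simp only: fps_deriv_nth Suc_eq_plus1)
          thus ?thesis using Suc by (simp add: N_def field_simps del: of_nat_Suc)
        qed
        have "of_nat n * fps_nth ?S n = fps_nth (fps_deriv ?S) m" using Suc by simp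
        also have "\<dots> = (\<Sum>i=0..m. N (fst p) i * fps_nth ?S (m - i))"
          by (simp add: LS[symmetric] fps_mult_nth Li)
        finally show "fps_nth ?S n = 1 / of_nat n * (\<Sum>i=0..m. N (fst p) i * fps_nth ?S (m - i))"
          using Suc by (simp add: field_simps del: of_nat_Suc)
      qed
    qed
  qed
  hence "graded_fps 0 S" by (simp add: graded_fps_def)
  with P show ?thesis using that[of c s S \<kappa>] by blast
qed

lemma even_fps_iff: "even_fps A \<longleftrightarrow> A oo (fps_const (-1) * fps_X) = A"
proof
  assume A: "even_fps A"
  show "A oo (fps_const (-1) * fps_X) = A"
    unfolding fps_compose_linear
  proof (rule fps_ext)
    fix n show "fps_nth (Abs_fps (\<lambda>n. (-1) ^ n * fps_nth A n)) n = fps_nth A n"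
      using A by (cases "even n") (auto simp: even_fps_def)
  qed
next
  assume "A oo (fps_const (-1) * fps_X) = A"
  hence *: "fps_nth A n = (-1) ^ n * fps_nth A n" for n
    unfolding fps_compose_linear by (metis fps_nth_Abs_fps)
  have "fps_nth A n = 0" if "odd n" for n
    using *[of n] that by simp
  thus "even_fps A" by (simp add: even_fps_def)
qed

lemma even_fps_inverse:
  assumes "even_fps A" "fps_nth A 0 \<noteq> 0"
  shows "even_fps (inverse A)"
  using assms fps_inverse_compose[of "fps_const (-1) * fps_X" A] by (simp add: even_fps_iff)

lemma even_fps_compose_linear: "even_fps A \<Longrightarrow> even_fps (A oo (fps_const a * fps_X))"
  unfolding fps_compose_linear by (simp add: even_fps_def)

text \<open>At a period both theta functions have simple zeros, so these cancel and the quotient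
  takes a nonzero value there. What survives are the zeros of theta at k w away from the
  periods.\<close>

lemma theta_multiplication_quotient:
  assumes \<tau>: "\<tau> \<in> upper_half" and k: "k > 0"
  obtains T where "T holomorphic_on UNIV" "\<And>w. theta \<tau> (of_nat k * w) = theta \<tau> w * T w"
    "\<And>w. T w = 0 \<longleftrightarrow> of_nat k * w \<in> period_lattice \<tau> \<and> w \<notin> period_lattice \<tau>"
proof -
  let ?f = "\<lambda>w. theta \<tau> (of_nat k * w)"
  have mult: "of_nat k * w \<in> period_lattice \<tau>" if "w \<in> period_lattice \<tau>" for w
    using period_lattice_of_int_mult[OF that, of "int k"] by simp
  have df: "deriv ?f w = of_nat k * deriv (theta \<tau>) (of_nat k * w)" for w
  proof -
    have "((\<lambda>w. of_nat k * w) has_field_derivative of_nat k) (at w)"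
      by (auto intro!: derivative_eq_intros)
    from DERIV_chain2[OF theta_has_derivative[OF \<tau>] this] show ?thesis
      by (intro DERIV_imp_deriv) (simp add: mult.commute)
  qed
  have hf: "?f holomorphic_on UNIV"
    using holomorphic_on_compose_gen[of "\<lambda>w. of_nat k * w" UNIV "theta \<tau>" UNIV]
      holomorphic_theta[OF \<tau>, of UNIV] by (auto simp: o_def intro!: holomorphic_intros)
  obtain T where T: "T holomorphic_on UNIV" "\<And>w. ?f w = theta \<tau> w * T w"
    "\<And>w. theta \<tau> w = 0 \<Longrightarrow> T w = deriv ?f w / deriv (theta \<tau>) w"
    by (rule holomorphic_quotient_simple_zeros[OF hf holomorphic_theta[OF \<tau>]])
       (use mult in \<open>auto simp: theta_eq_0_iff[OF \<tau>] deriv_theta_nonzero[OF \<tau>]\<close>)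
  have "T w = 0 \<longleftrightarrow> of_nat k * w \<in> period_lattice \<tau> \<and> w \<notin> period_lattice \<tau>" for w
  proof (cases "w \<in> period_lattice \<tau>")
    case True
    hence "T w = of_nat k * deriv (theta \<tau>) (of_nat k * w) / deriv (theta \<tau>) w"
      using T(3)[of w] by (simp add: theta_eq_0_iff[OF \<tau>] df)
    thus ?thesis using True mult[OF True] k by (simp add: deriv_theta_nonzero[OF \<tau>])
  next
    case False
    thus ?thesis using T(2)[of w] theta_eq_0_iff[OF \<tau>, of w] theta_eq_0_iff[OF \<tau>, of "of_nat k * w"] by auto
  qed
  with T show ?thesis using that by blast
qed

text \<open>The M-division points are isolated, so an identity valid off them extends by
  continuity.\<close>

lemma eventually_multiple_not_in_period_lattice:
  assumes \<tau>: "\<tau> \<in> upper_half" and M: "M > 0"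
  shows "\<forall>\<^sub>F z in at z0. of_nat M * z \<notin> period_lattice \<tau>"
proof -
  have at: "\<forall>\<^sub>F w in at w0. w \<notin> period_lattice \<tau>" for w0
  proof (cases "w0 \<in> period_lattice \<tau>")
    case True
    hence "\<forall>\<^sub>F w in at 0. w + w0 \<notin> period_lattice \<tau>"
      using eventually_not_in_period_lattice[OF \<tau>] by simp
    thus ?thesis by (subst eventually_at_to_0) simp
  next
    case False
    have "open (- period_lattice \<tau>)" using closed_period_lattice[OF \<tau>] by auto
    from eventually_at_in_open'[OF this, of w0] False show ?thesis by simp
  qed
  have "filterlim (\<lambda>z. of_nat M * z :: complex) (at (of_nat M * z0)) (at z0)"
    unfolding filterlim_at
    using M by (auto intro!: tendsto_intros simp: eventually_at_filter)
  from eventually_compose_filterlim[OF at this] show ?thesis .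
qed

text \<open>The function is theta(k M z) / (theta(M z) theta(z)^d), with \<open>T\<close> in place
  of the first quotient. A period multiplies theta(n z) by (-1)^n u^(n^2), so the exponents of u
  balance exactly when k^2 M^2 = M^2 + d.\<close>

lemma elliptic_division_function:
  assumes \<tau>: "\<tau> \<in> upper_half" and M: "M > 0" and d: "M\<^sup>2 * k\<^sup>2 = M\<^sup>2 + d"
    and T: "T holomorphic_on UNIV" "\<And>w. theta \<tau> (of_nat k * w) = theta \<tau> w * T w"
  shows "elliptic \<tau> (\<lambda>z. T (of_nat M * z) / theta \<tau> z ^ d)"
  unfolding elliptic_def
proof (intro conjI allI impI)
  let ?F = "\<lambda>z. T (of_nat M * z) / theta \<tau> z ^ d"
  have op: "open (- period_lattice \<tau>)" using closed_period_lattice[OF \<tau>] by auto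
  have "(\<lambda>z. T (of_nat M * z)) holomorphic_on UNIV"
    using holomorphic_on_compose_gen[of "\<lambda>w. of_nat M * w" UNIV T UNIV] T(1)
    by (auto simp: o_def intro!: holomorphic_intros)
  hence "(\<lambda>z. T (of_nat M * z)) holomorphic_on - period_lattice \<tau>"
    by (rule holomorphic_on_subset) auto
  thus hol: "?F holomorphic_on - period_lattice \<tau>"
    by (intro holomorphic_intros holomorphic_theta \<tau>) (auto simp: theta_eq_0_iff[OF \<tau>])
  fix z assume z: "z \<notin> period_lattice \<tau>"
  \<comment> \<open>A square has the parity of its base, so the relation between the exponents of u
    settles the signs too.\<close>
  have "even (k * M + (M + d))"
  proof -
    have "even ((M * k)\<^sup>2) \<longleftrightarrow> even (M\<^sup>2 + d)" using d by (simp add: power_mult_distrib)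
    thus ?thesis by auto
  qed
  hence sign: "(-1 :: complex) ^ (k * M) = (-1) ^ (M + d)"
    by (cases "even (k * M)") auto
  \<comment> \<open>Both periods at once: u = 1 serves the period 1, and the exponential multiplier
    serves \<tau>.\<close>
  have *: "?F (z + v) = ?F z"
    if v: "v \<in> period_lattice \<tau>" and
      u: "\<And>z n. theta \<tau> (of_nat n * (z + v)) = (-1) ^ n * u z ^ n\<^sup>2 * theta \<tau> (of_nat n * z)" "\<And>z. u z \<noteq> 0"
    for v u
  proof -
    have gen: "?F (w + v) - ?F w = 0" if w: "of_nat M * w \<notin> period_lattice \<tau>" for w
    proof -
      define e where "e n = (-1) ^ n * u w ^ n\<^sup>2" for n :: nat
      have e: "e n \<noteq> 0" for n by (simp add: e_def u(2))
      have nz: "theta \<tau> (of_nat M * w) \<noteq> 0" using w theta_eq_0_iff[OF \<tau>] by blast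
      have "e (k * M) * (theta \<tau> (of_nat M * w) * T (of_nat M * w)) = theta \<tau> (of_nat (k * M) * (w + v))"
        using u(1)[of "k * M" w] T(2)[of "of_nat M * w"] by (simp add: e_def mult.assoc)
      also have "\<dots> = theta \<tau> (of_nat M * (w + v)) * T (of_nat M * (w + v))"
        using T(2)[of "of_nat M * (w + v)"] by (simp add: mult.assoc)
      also have "\<dots> = e M * theta \<tau> (of_nat M * w) * T (of_nat M * (w + v))"
        using u(1)[of M w] by (simp add: e_def)
      finally have 1: "e (k * M) * T (of_nat M * w) = e M * T (of_nat M * (w + v))"
        using nz by simp
      have "e (k * M) = (-1) ^ (M + d) * u w ^ (M\<^sup>2 + d)"
        unfolding e_def sign using d by (simp add: power_mult_distrib mult.commute)
      also have "\<dots> = e M * (- u w) ^ d"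
        by (subst (2) power_minus) (simp add: e_def power_add mult_ac)
      finally have 2: "T (of_nat M * (w + v)) = (- u w) ^ d * T (of_nat M * w)"
        using 1 e[of M] by simp
      have "theta \<tau> (w + v) = - u w * theta \<tau> w" using u(1)[of 1 w] by simp
      thus ?thesis unfolding 2 using u(2)[of w] by (simp only: power_mult_distrib) simp
    qed
    have z': "z + v \<notin> period_lattice \<tau>" using z v by simp
    have an: "?F analytic_on {w}" if "w \<notin> period_lattice \<tau>" for w
      using hol op that analytic_at by blast
    \<comment> \<open>The identity \<open>gen\<close> was obtained by cancelling theta at M w, hence
      away from the M-division points; continuity yields it at z.\<close>
    have "isCont (\<lambda>w. ?F (w + v)) z"
      using analytic_at_imp_isCont[OF an[OF z']] 
      by (intro isCont_o2[where g = ?F and f = "\<lambda>w. w + v"]) (auto intro!: continuous_intros)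
    hence "isCont (\<lambda>w. ?F (w + v) - ?F w) z"
      using analytic_at_imp_isCont[OF an[OF z]] by (intro continuous_diff) auto
    hence "((\<lambda>w. ?F (w + v) - ?F w) \<longlongrightarrow> ?F (z + v) - ?F z) (at z)" by (simp only: isCont_def)
    moreover have "((\<lambda>w. ?F (w + v) - ?F w) \<longlongrightarrow> 0) (at z)"
      by (rule Lim_transform_eventually[of "\<lambda>_. 0"])
         (use eventually_multiple_not_in_period_lattice[OF \<tau> M, of z] gen in \<open>auto elim!: eventually_mono\<close>)
    ultimately have "?F (z + v) - ?F z = 0" using tendsto_unique[OF at_neq_bot] by blast
    thus ?thesis by simp
  qed
  show "?F (z + 1) = ?F z"
    by (rule *[of 1 "\<lambda>_. 1"]) (use theta_plus_of_nat[of \<tau>] in \<open>auto simp: ring_distribs\<close>)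
  show "?F (z + \<tau>) = ?F z"
  proof (rule *[of \<tau> "\<lambda>z. exp (- (of_real pi * \<i> * (\<tau> + 2 * z)))"])
    fix z n
    have "exp (- (of_real pi * \<i> * (\<tau> + 2 * z))) ^ n\<^sup>2 =
        exp (- (of_real pi * \<i> * (of_nat n ^ 2 * \<tau> + 2 * of_nat n * (of_nat n * z))))"
      by (simp add: algebra_simps power2_eq_square flip: exp_of_nat_mult)
    moreover have "of_nat n * (z + \<tau>) = of_nat n * z + of_nat n * \<tau>" by (simp add: ring_distribs)
    ultimately show "theta \<tau> (of_nat n * (z + \<tau>)) =
        (-1) ^ n * exp (- (of_real pi * \<i> * (\<tau> + 2 * z))) ^ n\<^sup>2 * theta \<tau> (of_nat n * z)"
      by (simp only: theta_plus_multiple[OF \<tau>])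
  qed auto
qed

text \<open>The square of the normalized division function is elliptic and even, with a pole of
  order 2 d at the origin, and its Laurent coefficients are built from the graded series S by
  scaling, products and inverses. Hence one polynomial serves all \<tau>.\<close>

theorem division_polynomial:
  assumes M: "M > 0" and k: "k > 0"
  obtains w c where "\<And>\<tau> z. (\<tau>, z) \<in> Tor12 \<Longrightarrow> weierstrass_poly w c (\<tau>, z) = 0 \<longleftrightarrow>
    of_nat (k * M) * z \<in> period_lattice \<tau> \<and> of_nat M * z \<notin> period_lattice \<tau>"
proof -
  define d where "d = M\<^sup>2 * (k\<^sup>2 - 1)"
  have d: "M\<^sup>2 * k\<^sup>2 = M\<^sup>2 + d"
  proof -
    have "k\<^sup>2 = 1 + (k\<^sup>2 - 1)" using k by simp
    hence "M\<^sup>2 * k\<^sup>2 = M\<^sup>2 * (1 + (k\<^sup>2 - 1))" by simp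
    thus ?thesis by (simp only: d_def distrib_left mult_1_right)
  qed
  have "\<forall>\<tau>\<in>upper_half. \<exists>T. T holomorphic_on UNIV \<and> (\<forall>w. theta \<tau> (of_nat k * w) = theta \<tau> w * T w) \<and>
      (\<forall>w. T w = 0 \<longleftrightarrow> of_nat k * w \<in> period_lattice \<tau> \<and> w \<notin> period_lattice \<tau>)"
  proof
    fix \<tau> assume "\<tau> \<in> upper_half"
    from theta_multiplication_quotient[OF this k] show "\<exists>T. T holomorphic_on UNIV \<and>
        (\<forall>w. theta \<tau> (of_nat k * w) = theta \<tau> w * T w) \<and>
        (\<forall>w. T w = 0 \<longleftrightarrow> of_nat k * w \<in> period_lattice \<tau> \<and> w \<notin> period_lattice \<tau>)" by metis
  qed
  from bchoice[OF this] obtain T where "\<forall>\<tau>\<in>upper_half. T \<tau> holomorphic_on UNIV \<and>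
      (\<forall>w. theta \<tau> (of_nat k * w) = theta \<tau> w * T \<tau> w) \<and>
      (\<forall>w. T \<tau> w = 0 \<longleftrightarrow> of_nat k * w \<in> period_lattice \<tau> \<and> w \<notin> period_lattice \<tau>)" ..
  hence T: "\<And>\<tau>. \<tau> \<in> upper_half \<Longrightarrow> T \<tau> holomorphic_on UNIV"
      "\<And>\<tau> w. \<tau> \<in> upper_half \<Longrightarrow> theta \<tau> (of_nat k * w) = theta \<tau> w * T \<tau> w"
      "\<And>\<tau> w. \<tau> \<in> upper_half \<Longrightarrow> T \<tau> w = 0 \<longleftrightarrow> of_nat k * w \<in> period_lattice \<tau> \<and> w \<notin> period_lattice \<tau>"
    by blast+
  obtain c \<kappa> s S where S:
    "\<And>\<tau>. \<tau> \<in> upper_half \<Longrightarrow> c \<tau> \<noteq> 0"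
    "\<And>\<tau>. \<tau> \<in> upper_half \<Longrightarrow> s \<tau> has_fps_expansion S \<tau>"
    "\<And>\<tau>. \<tau> \<in> upper_half \<Longrightarrow> \<forall>\<^sub>F z in nhds 0. theta \<tau> z = c \<tau> * z * s \<tau> z * exp (\<kappa> \<tau> * z\<^sup>2)"
    "\<And>\<tau>. \<tau> \<in> upper_half \<Longrightarrow> fps_nth (S \<tau>) 0 = 1"
    "\<And>\<tau>. \<tau> \<in> upper_half \<Longrightarrow> even_fps (S \<tau>)"
    "graded_fps 0 S"
    by (rule theta_normal_form_graded) blast
  \<comment> \<open>Near 0 the quotient of theta functions behaves like k / (c^d z^d); the factor
    c^d / k normalizes this to 1 / z^d. Squaring makes the pole order even also when d is
    odd.\<close>
  define f where "f \<tau> z = (c \<tau> ^ d / of_nat k * (T \<tau> (of_nat M * z) / theta \<tau> z ^ d))\<^sup>2" for \<tau> z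
  define A where "A \<tau> = ((S \<tau> oo (fps_const (of_nat (k * M)) * fps_X)) *
     (inverse (S \<tau> oo (fps_const (of_nat M) * fps_X)) * inverse (S \<tau>) ^ d)) ^ 2" for \<tau>
  have S0: "fps_nth (S \<tau> oo (fps_const a * fps_X)) 0 = 1" if "\<tau> \<in> upper_half" for \<tau> a
    using S(4)[OF that] by (simp add: fps_compose_linear)
  have "weighted_form (2 * d + 0) (\<lambda>p. f (fst p) (snd p))"
  proof (rule weighted_form_elliptic)
    have "graded_fps (0 + 0) (\<lambda>\<tau>. (S \<tau> oo (fps_const (of_nat (k * M)) * fps_X)) *
     (inverse (S \<tau> oo (fps_const (of_nat M) * fps_X)) * inverse (S \<tau>) ^ d))"
      using graded_fps_mult[OF graded_fps_inverse[OF graded_fps_compose_linear[OF S(6)]]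
          graded_fps_power[OF graded_fps_inverse[OF S(6)]], of _ 1 1] S0 S(4)
      by (intro graded_fps_mult graded_fps_compose_linear S(6)) simp
    thus "graded_fps 0 A" unfolding A_def by (intro graded_fps_power) simp
    fix \<tau> assume \<tau>: "\<tau> \<in> upper_half"
    show "even_fps (A \<tau>)" unfolding A_def
      by (intro even_fps_power even_fps_mult even_fps_inverse even_fps_compose_linear S(5) \<tau>)
         (simp_all add: S0 S(4) \<tau>)
    show "elliptic \<tau> (f \<tau>)" unfolding f_def
      by (intro elliptic_power elliptic_mult elliptic_const elliptic_division_function[where k = k] T \<tau> M d)
    define a where "a z = (s \<tau> (of_nat (k * M) * z) *
        (inverse (s \<tau> (of_nat M * z)) * inverse (s \<tau> z) ^ d)) ^ 2" for z
    have a: "a has_fps_expansion A \<tau>" unfolding a_def A_def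
      by (intro fps_expansion_intros has_fps_expansion_compose_linear S(2) \<tau>)
         (simp_all add: S0[OF \<tau>] S(4)[OF \<tau>])
    have "s \<tau> 0 = 1" using has_fps_expansion_imp_0_eq_fps_nth_0[OF S(2)[OF \<tau>]] S(4)[OF \<tau>] by simp
    hence snz: "\<forall>\<^sub>F z in nhds 0. s \<tau> z \<noteq> 0"
      using analytic_at_imp_isCont[OF has_fps_expansion_imp_analytic_0[OF S(2)[OF \<tau>]]]
      by (simp add: isCont_def tendsto_imp_eventually_ne eventually_nhds_conv_at)
    note th = S(3)[OF \<tau>]
    have "\<forall>\<^sub>F z in nhds 0. z \<noteq> 0 \<longrightarrow> z ^ (2 * d) * f \<tau> z = a z"
      using snz eventually_nhds_0_mult[OF snz, of "of_nat M"] th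
        eventually_nhds_0_mult[OF th, of "of_nat M"] eventually_nhds_0_mult[OF th, of "of_nat (k * M)"]
    proof eventually_elim
      case (elim z)
      let ?E = "\<lambda>n. exp (of_nat n * (\<kappa> \<tau> * z\<^sup>2))"
      show ?case
      proof
        assume z: "z \<noteq> 0"
        have e1: "exp (\<kappa> \<tau> * (of_nat n * z)\<^sup>2) = ?E (n\<^sup>2)" for n
          by (simp add: power_mult_distrib mult_ac)
        have e2: "exp (\<kappa> \<tau> * z\<^sup>2) ^ d = ?E d" by (simp flip: exp_of_nat_mult)
        \<comment> \<open>Here the Gaussian factors cancel: their exponents are proportional to (k
          M)^2 on one side and to M^2 + d on the other.\<close>
        have "(k * M)\<^sup>2 = M\<^sup>2 + d" using d by (simp add: power_mult_distrib mult.commute)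
        hence e3: "?E ((k * M)\<^sup>2) = ?E (M\<^sup>2) * ?E d"
          by (simp only: of_nat_add distrib_right exp_add)
        have "theta \<tau> (of_nat (k * M) * z) = theta \<tau> (of_nat M * z) * T \<tau> (of_nat M * z)"
          using T(2)[OF \<tau>, of "of_nat M * z"] by (simp add: mult.assoc)
        hence "(c \<tau> * (of_nat M * z) * ?E (M\<^sup>2)) * (of_nat k * s \<tau> (of_nat (k * M) * z) * ?E d) =
            (c \<tau> * (of_nat M * z) * ?E (M\<^sup>2)) * (s \<tau> (of_nat M * z) * T \<tau> (of_nat M * z))"
          unfolding elim(4,5) e1 e3 by (simp add: mult_ac)
        moreover have "c \<tau> * (of_nat M * z) * ?E (M\<^sup>2) \<noteq> 0" using S(1)[OF \<tau>] M z by simp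
        ultimately have "of_nat k * s \<tau> (of_nat (k * M) * z) * ?E d = s \<tau> (of_nat M * z) * T \<tau> (of_nat M * z)"
          by (subst (asm) mult_cancel_left) simp
        hence TM: "T \<tau> (of_nat M * z) = of_nat k * s \<tau> (of_nat (k * M) * z) * ?E d / s \<tau> (of_nat M * z)"
          using elim(2) by (simp add: field_simps)
        have thd: "theta \<tau> z ^ d = c \<tau> ^ d * z ^ d * s \<tau> z ^ d * ?E d"
          by (simp add: elim(3) power_mult_distrib e2)
        have "z ^ d * (c \<tau> ^ d / of_nat k * (T \<tau> (of_nat M * z) / theta \<tau> z ^ d)) =
            s \<tau> (of_nat (k * M) * z) * (inverse (s \<tau> (of_nat M * z)) * inverse (s \<tau> z) ^ d)"
          unfolding TM thd using z k S(1)[OF \<tau>] elim(1,2) by (simp add: field_simps)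
        hence "(z ^ d * (c \<tau> ^ d / of_nat k * (T \<tau> (of_nat M * z) / theta \<tau> z ^ d)))\<^sup>2 = a z"
          by (simp only: a_def)
        thus "z ^ (2 * d) * f \<tau> z = a z"
          by (simp only: f_def power_mult_distrib[of "z ^ d"] power_mult[symmetric] mult.commute[of d 2])
      qed
    qed
    hence "\<forall>\<^sub>F z in at 0. z ^ (2 * d) * f \<tau> z = a z"
      by (simp add: eventually_at_filter)
    thus "\<exists>g. g has_fps_expansion A \<tau> \<and> (\<forall>\<^sub>F z in at 0. z ^ (2 * d) * f \<tau> z = g z)"
      using a by blast
  qed
  then obtain cc where cc: "\<forall>p\<in>Tor12. f (fst p) (snd p) = weierstrass_poly (2 * d) cc p"
    unfolding weighted_form_def by auto
  show ?thesis
  proof (rule that[of "2 * d" cc])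
    fix \<tau> z assume p: "(\<tau>, z) \<in> Tor12"
    hence \<tau>: "\<tau> \<in> upper_half" "z \<notin> period_lattice \<tau>" by (auto simp: Tor12_def)
    have "weierstrass_poly (2 * d) cc (\<tau>, z) = 0 \<longleftrightarrow> f \<tau> z = 0" using cc p by force
    also have "\<dots> \<longleftrightarrow> T \<tau> (of_nat M * z) = 0"
      using S(1)[OF \<tau>(1)] k theta_eq_0_iff[OF \<tau>(1), of z] \<tau>(2) by (simp add: f_def)
    also have "\<dots> \<longleftrightarrow> of_nat (k * M) * z \<in> period_lattice \<tau> \<and> of_nat M * z \<notin> period_lattice \<tau>"
      using T(3)[OF \<tau>(1), of "of_nat M * z"] by (simp add: mult.assoc)
    finally show "weierstrass_poly (2 * d) cc (\<tau>, z) = 0 \<longleftrightarrow>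
      of_nat (k * M) * z \<in> period_lattice \<tau> \<and> of_nat M * z \<notin> period_lattice \<tau>" .
  qed
qed

section \<open>The Zariski topology on torsion curves\<close>

lemma open_upper_half: "open upper_half"
  unfolding upper_half_def by (rule open_halfspace_Im_gt)

lemma connected_upper_half: "connected upper_half"
  unfolding upper_half_def by (intro convex_connected convex_halfspace_Im_gt)

lemma holomorphic_lattice_infsum:
  fixes f :: "int \<times> int \<Rightarrow> complex \<Rightarrow> complex"
  assumes "\<And>p. p \<in> A \<Longrightarrow> f p holomorphic_on upper_half"
    and bound: "\<And>\<tau>0. \<tau>0 \<in> upper_half \<Longrightarrow>
      \<exists>C d. d > 0 \<and> (\<forall>\<tau>\<in>cball \<tau>0 d. \<forall>p\<in>A. norm (f p \<tau>) \<le> C / lattice_size p ^ 3)"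
  shows "(\<lambda>\<tau>. \<Sum>\<^sub>\<infinity>p\<in>A. f p \<tau>) holomorphic_on upper_half"
proof (rule holomorphic_infsum[OF open_upper_half assms(1)])
  fix \<tau>0 assume "\<tau>0 \<in> upper_half"
  from bound[OF this] obtain C d where Cd: "d > 0"
    "\<And>\<tau> p. \<tau> \<in> cball \<tau>0 d \<Longrightarrow> p \<in> A \<Longrightarrow> norm (f p \<tau>) \<le> C / lattice_size p ^ 3" by blast
  have "(\<lambda>p. C * (1 / lattice_size p ^ 3)) summable_on A"
    by (intro summable_on_cmult_right summable_on_subset_banach[OF summable_on_lattice_size]) auto
  thus "\<exists>d>0. \<exists>M. M summable_on A \<and> (\<forall>p\<in>A. \<forall>\<tau>\<in>cball \<tau>0 d \<inter> upper_half. norm (f p \<tau>) \<le> M p)"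
    using Cd by (intro exI[of _ d] conjI exI[of _ "\<lambda>p. C * (1 / lattice_size p ^ 3)"]) auto
qed

lemma holomorphic_lattice_sum:
  assumes "n \<ge> 3"
  shows "(\<lambda>\<tau>. lattice_sum \<tau> n) holomorphic_on upper_half"
  unfolding lattice_sum_def
proof (rule holomorphic_lattice_infsum)
  fix p :: "int \<times> int" assume "p \<in> - {(0,0)}"
  thus "(\<lambda>\<tau>. 1 / lattice_point \<tau> p ^ n) holomorphic_on upper_half"
    using lattice_point_eq_0_iff[of _ p] unfolding lattice_point_def
    by (intro holomorphic_intros) auto
next
  fix \<tau>0 assume "\<tau>0 \<in> upper_half"
  then obtain c d where cd: "c > 0" "d > 0" "\<And>\<tau> p. \<tau> \<in> cball \<tau>0 d \<Longrightarrow> p \<noteq> (0, 0) \<Longrightarrow>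
      c * lattice_size p \<le> norm (lattice_point \<tau> p)"
    by (rule lattice_point_lower_bound) blast
  have "norm (1 / lattice_point \<tau> p ^ n) \<le> (1 / c ^ n) / lattice_size p ^ 3"
    if "\<tau> \<in> cball \<tau>0 d" "p \<noteq> (0,0)" for \<tau> p
  proof -
    have pos: "c * lattice_size p > 0" using cd(1) lattice_size_pos[of p] by simp
    have "norm (1 / lattice_point \<tau> p ^ n) \<le> 1 / (c * lattice_size p) ^ n"
      unfolding norm_divide norm_power using cd(3)[OF that] pos
      by (intro frac_le power_mono) auto
    also have "\<dots> = (1 / c ^ n) / lattice_size p ^ n" by (simp add: power_mult_distrib)
    also have "\<dots> \<le> (1 / c ^ n) / lattice_size p ^ 3"
      using cd(1) lattice_size_ge_1[of p] assms
      by (intro divide_left_mono power_increasing) auto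
    finally show ?thesis .
  qed
  thus "\<exists>C d. d > 0 \<and> (\<forall>\<tau>\<in>cball \<tau>0 d. \<forall>p\<in>-{(0,0)}. norm (1 / lattice_point \<tau> p ^ n) \<le> C / lattice_size p ^ 3)"
    using cd(2) by (intro exI[of _ "1 / c ^ n"] exI[of _ d]) auto
qed

text \<open>Here the point z = x stays fixed and \<tau> varies, in contrast to
  \<open>lattice_distance_bound_cball\<close>. Since x \<le> 1/2, no integer is nearer to x than 0,
  so |m| \<le> 2 |x - m|.\<close>

lemma torsion_point_distance_bound:
  assumes \<tau>0: "\<tau>0 \<in> upper_half" and x: "0 < x" "x \<le> 1 / 2"
  obtains c d where "c > 0" "d > 0" "cball \<tau>0 d \<subseteq> upper_half"
    "\<And>\<tau> p. \<tau> \<in> cball \<tau>0 d \<Longrightarrow> c * lattice_size p \<le> norm (complex_of_real x - lattice_point \<tau> p)"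
    "\<And>\<tau> p. \<tau> \<in> cball \<tau>0 d \<Longrightarrow> p \<noteq> (0, 0) \<Longrightarrow> c * lattice_size p \<le> norm (lattice_point \<tau> p)"
proof -
  obtain c d where cd: "c > 0" "d > 0" "cball \<tau>0 d \<subseteq> upper_half"
    "\<And>\<tau> x y. \<tau> \<in> cball \<tau>0 d \<Longrightarrow> c * (\<bar>x\<bar> + \<bar>y\<bar>) \<le> norm (complex_of_real x + complex_of_real y * \<tau>)"
    by (rule upper_half_linear_form_bound[OF \<tau>0]) blast
  \<comment> \<open>The value c/4 serves p off the origin, where a factor 2 is lost to the size and
    another to the shift by x; the value x serves the origin, whose size is 1.\<close>
  define e where "e = min (c / 4) x"
  have e: "e > 0" "e \<le> c / 4" "e \<le> x" using cd(1) x by (auto simp: e_def)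
  have size: "lattice_size p \<le> 2 * (\<bar>of_int (fst p)\<bar> + \<bar>of_int (snd p)\<bar>)" if "p \<noteq> (0,0)" for p
  proof -
    have "1 \<le> \<bar>fst p\<bar> + \<bar>snd p\<bar>" using that by (cases p) auto
    hence "1 \<le> \<bar>real_of_int (fst p)\<bar> + \<bar>real_of_int (snd p)\<bar>" by linarith
    thus ?thesis by (simp add: lattice_size_def)
  qed
  have shift: "\<bar>of_int m\<bar> \<le> 2 * \<bar>x - of_int m\<bar>" for m :: int
  proof (cases "m = 0")
    case False
    hence "\<bar>real_of_int m\<bar> \<ge> 1" by linarith
    thus ?thesis using x abs_triangle_ineq2_sym[of "real_of_int m" x] by (simp add: abs_minus_commute)
  qed simp
  show ?thesis
  proof (rule that[OF e(1) cd(2,3)])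
    fix \<tau> p assume t: "\<tau> \<in> cball \<tau>0 d"
    have half: "e * lattice_size p \<le> c / 2 * (\<bar>of_int (fst p)\<bar> + \<bar>of_int (snd p)\<bar>)"
      if p: "p \<noteq> (0,0)"
    proof -
      have "e * lattice_size p \<le> c / 4 * (2 * (\<bar>of_int (fst p)\<bar> + \<bar>of_int (snd p)\<bar>))"
        using e cd(1) size[OF p] lattice_size_pos[of p] by (intro mult_mono) auto
      also have "\<dots> = c / 2 * (\<bar>of_int (fst p)\<bar> + \<bar>of_int (snd p)\<bar>)" by simp
      finally show ?thesis .
    qed
    show "e * lattice_size p \<le> norm (lattice_point \<tau> p)" if p: "p \<noteq> (0, 0)"
    proof -
      note half[OF p]
      also have "c / 2 * (\<bar>of_int (fst p)\<bar> + \<bar>of_int (snd p)\<bar>) \<le> c * (\<bar>of_int (fst p)\<bar> + \<bar>of_int (snd p)\<bar>)"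
        using cd(1) by (intro mult_right_mono) auto
      also have "\<dots> \<le> norm (lattice_point \<tau> p)"
        using cd(4)[OF t, of "of_int (fst p)" "of_int (snd p)"] by (simp add: lattice_point_def)
      finally show ?thesis .
    qed
    show "e * lattice_size p \<le> norm (complex_of_real x - lattice_point \<tau> p)"
    proof (cases "p = (0,0)")
      case True
      thus ?thesis using e x by (simp add: lattice_size_def)
    next
      case False
      note half[OF False]
      also have "c / 2 * (\<bar>of_int (fst p)\<bar> + \<bar>of_int (snd p)\<bar>) \<le> c / 2 * (2 * (\<bar>x - of_int (fst p)\<bar> + \<bar>- of_int (snd p)\<bar>))"
        using cd(1) shift[of "fst p"] by (intro mult_left_mono) auto
      also have "\<dots> = c * (\<bar>x - of_int (fst p)\<bar> + \<bar>- of_int (snd p)\<bar>)" by simp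
      also have "\<dots> \<le> norm (complex_of_real (x - of_int (fst p)) + complex_of_real (- of_int (snd p)) * \<tau>)"
        by (rule cd(4)[OF t])
      also have "\<dots> = norm (complex_of_real x - lattice_point \<tau> p)"
        by (simp add: lattice_point_def algebra_simps)
      finally show ?thesis .
    qed
  qed
qed

lemma torsion_point_not_in_period_lattice:
  assumes "\<tau> \<in> upper_half" "0 < x" "x \<le> 1 / 2"
  shows "complex_of_real x \<notin> period_lattice \<tau>"
proof
  assume "complex_of_real x \<in> period_lattice \<tau>"
  hence "x \<in> \<int>" using period_lattice_coordinates[OF assms(1), of x 0] by simp
  thus False using assms(2,3) by (auto elim!: Ints_cases)
qed

lemma holomorphic_weierstrass_p_torsion:
  assumes x: "0 < x" "x \<le> 1 / 2"
  shows "(\<lambda>\<tau>. weierstrass_p \<tau> (complex_of_real x)) holomorphic_on upper_half"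
proof -
  have "(\<lambda>\<tau>. \<Sum>\<^sub>\<infinity>p\<in>-{(0,0)}. wp_term \<tau> (complex_of_real x) p) holomorphic_on upper_half"
  proof (rule holomorphic_lattice_infsum)
    fix p :: "int \<times> int" assume p: "p \<in> - {(0,0)}"
    have "complex_of_real x - lattice_point \<tau> p \<noteq> 0" if "\<tau> \<in> upper_half" for \<tau>
      using torsion_point_not_in_period_lattice[OF that x] by (auto simp: period_lattice_eq_range)
    thus "(\<lambda>\<tau>. wp_term \<tau> (complex_of_real x) p) holomorphic_on upper_half"
      using lattice_point_eq_0_iff[of _ p] p unfolding lattice_point_def wp_term_def
      by (intro holomorphic_intros) auto
  next
    fix \<tau>0 assume "\<tau>0 \<in> upper_half"
    then obtain c d where cd: "c > 0" "d > 0"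
      "\<And>\<tau> p. \<tau> \<in> cball \<tau>0 d \<Longrightarrow> c * lattice_size p \<le> norm (complex_of_real x - lattice_point \<tau> p)"
      "\<And>\<tau> p. \<tau> \<in> cball \<tau>0 d \<Longrightarrow> p \<noteq> (0, 0) \<Longrightarrow> c * lattice_size p \<le> norm (lattice_point \<tau> p)"
      by (rule torsion_point_distance_bound[OF _ x]) blast
    have "norm (wp_term \<tau> (complex_of_real x) p) \<le> (2 * x / c ^ 3) / lattice_size p ^ 3"
      if "\<tau> \<in> cball \<tau>0 d" "p \<noteq> (0, 0)" for \<tau> p
      using x that by (intro wp_term_bound cd) auto
    thus "\<exists>C d. d > 0 \<and> (\<forall>\<tau>\<in>cball \<tau>0 d. \<forall>p\<in>-{(0,0)}.
        norm (wp_term \<tau> (complex_of_real x) p) \<le> C / lattice_size p ^ 3)"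
      using cd(2) by (intro exI[of _ "2 * x / c ^ 3"] exI[of _ d]) auto
  qed
  hence "(\<lambda>\<tau>. 1 / (complex_of_real x)\<^sup>2 + (\<Sum>\<^sub>\<infinity>p\<in>-{(0,0)}. wp_term \<tau> (complex_of_real x) p)) holomorphic_on upper_half"
    by (intro holomorphic_intros) (use x in auto)
  thus ?thesis by (rule holomorphic_transform) (simp add: weierstrass_p_eq)
qed

lemma holomorphic_weierstrass_p'_torsion:
  assumes x: "0 < x" "x \<le> 1 / 2"
  shows "(\<lambda>\<tau>. weierstrass_p' \<tau> (complex_of_real x)) holomorphic_on upper_half"
proof -
  have "(\<lambda>\<tau>. \<Sum>\<^sub>\<infinity>p\<in>UNIV. 1 / (complex_of_real x - lattice_point \<tau> p) ^ 3) holomorphic_on upper_half"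
  proof (rule holomorphic_lattice_infsum)
    fix p :: "int \<times> int"
    have "complex_of_real x - lattice_point \<tau> p \<noteq> 0" if "\<tau> \<in> upper_half" for \<tau>
      using torsion_point_not_in_period_lattice[OF that x] by (auto simp: period_lattice_eq_range)
    thus "(\<lambda>\<tau>. 1 / (complex_of_real x - lattice_point \<tau> p) ^ 3) holomorphic_on upper_half"
      unfolding lattice_point_def by (intro holomorphic_intros) auto
  next
    fix \<tau>0 assume "\<tau>0 \<in> upper_half"
    then obtain c d where cd: "c > 0" "d > 0"
      "\<And>\<tau> p. \<tau> \<in> cball \<tau>0 d \<Longrightarrow> c * lattice_size p \<le> norm (complex_of_real x - lattice_point \<tau> p)"
      by (rule torsion_point_distance_bound[OF _ x]) blast
    have "norm (1 / (complex_of_real x - lattice_point \<tau> p) ^ 3) \<le> (1 / c ^ 3) / lattice_size p ^ 3"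
      if "\<tau> \<in> cball \<tau>0 d" for \<tau> p
    proof -
      have "norm (1 / (complex_of_real x - lattice_point \<tau> p) ^ 3) \<le> 1 / (c * lattice_size p) ^ 3"
        unfolding norm_divide norm_power using cd(1) cd(3)[OF that] lattice_size_pos[of p]
        by (intro frac_le power_mono) auto
      thus ?thesis by (simp add: power_mult_distrib)
    qed
    thus "\<exists>C d. d > 0 \<and> (\<forall>\<tau>\<in>cball \<tau>0 d. \<forall>p\<in>UNIV.
        norm (1 / (complex_of_real x - lattice_point \<tau> p) ^ 3) \<le> C / lattice_size p ^ 3)"
      using cd(2) by (intro exI[of _ "1 / c ^ 3"] exI[of _ d]) auto
  qed
  hence "(\<lambda>\<tau>. - 2 * (\<Sum>\<^sub>\<infinity>p. 1 / (complex_of_real x - lattice_point \<tau> p) ^ 3)) holomorphic_on upper_half"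
    by (intro holomorphic_intros)
  thus ?thesis
    by (rule holomorphic_transform) (simp add: weierstrass_p'_def infsum_period_lattice)
qed

lemma holomorphic_weierstrass_poly_torsion:
  assumes x: "0 < x" "x \<le> 1 / 2"
  shows "(\<lambda>\<tau>. weierstrass_poly d c (\<tau>, complex_of_real x)) holomorphic_on upper_half"
proof -
  have "(\<lambda>\<tau>. 60 * lattice_sum \<tau> 4) holomorphic_on upper_half"
    by (intro holomorphic_intros holomorphic_lattice_sum) simp
  hence g2: "g2 holomorphic_on upper_half"
    by (rule holomorphic_transform) (simp add: g2_eq)
  have "(\<lambda>\<tau>. 140 * lattice_sum \<tau> 6) holomorphic_on upper_half"
    by (intro holomorphic_intros holomorphic_lattice_sum) simp
  hence g3: "g3 holomorphic_on upper_half"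
    by (rule holomorphic_transform) (simp add: g3_eq)
  show ?thesis
    unfolding weierstrass_poly_def case_prod_unfold fst_conv snd_conv
    by (intro holomorphic_intros holomorphic_weierstrass_p_torsion holomorphic_weierstrass_p'_torsion x g2 g3)
qed

text \<open>Where f is nonzero, a nonempty open set, g has to vanish, and the identity theorem on
  the connected half plane spreads this.\<close>

lemma holomorphic_upper_half_mult_eq_0:
  assumes f: "f holomorphic_on upper_half" and g: "g holomorphic_on upper_half"
    and fg: "\<And>\<tau>. \<tau> \<in> upper_half \<Longrightarrow> f \<tau> = 0 \<or> g \<tau> = 0"
    and \<tau>1: "\<tau>1 \<in> upper_half" "f \<tau>1 \<noteq> 0" and \<tau>2: "\<tau>2 \<in> upper_half"
  shows "g \<tau>2 = 0"
proof -
  define U where "U = upper_half \<inter> f -` (- {0})"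
  have "open U" unfolding U_def
    using f open_upper_half by (intro continuous_open_preimage holomorphic_on_imp_continuous_on) auto
  moreover have "U \<noteq> {}" using \<tau>1 by (auto simp: U_def)
  moreover have "g \<tau> = 0" if "\<tau> \<in> U" for \<tau> using fg that by (auto simp: U_def)
  ultimately show ?thesis
    using analytic_continuation_open[of U upper_half g "\<lambda>_. 0" \<tau>2] open_upper_half connected_upper_half g \<tau>2
    by (auto simp: U_def)
qed

lemma Tor12_torsion:
  assumes "\<tau> \<in> upper_half" "N \<ge> 2"
  shows "(\<tau>, 1 / of_nat N) \<in> Tor12"
  using torsion_point_not_in_period_lattice[OF assms(1), of "1 / real N"] assms
  by (simp add: Tor12_def divide_simps)

text \<open>A point of the curve off B provides a polynomial of B whose restriction is not
  identically zero. Its product with the restriction of any polynomial of A vanishes, so the latter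
  restriction is zero.\<close>

lemma zariski_irreducible_torsion_curve:
  assumes N: "N \<ge> 2"
  shows "zariski_irreducible ((\<lambda>\<tau>. moduli_proj (\<tau>, 1 / of_nat N)) ` upper_half)"
  unfolding zariski_irreducible_def
proof (intro conjI allI impI)
  let ?S = "(\<lambda>\<tau>. moduli_proj (\<tau>, 1 / of_nat N)) ` upper_half"
  have "\<i> \<in> upper_half" by (simp add: upper_half_def)
  thus "?S \<noteq> {}" by blast
  fix A B assume AB: "zariski_closed A \<and> zariski_closed B \<and> ?S \<subseteq> A \<union> B"
  have "\<exists>P. \<forall>p\<in>Tor12. moduli_proj p \<in> A \<longleftrightarrow> (\<forall>(d, c)\<in>P. weierstrass_poly d c p = 0)"
    using AB by (simp only: zariski_closed_def)
  then obtain PA where PA: "\<And>p. p \<in> Tor12 \<Longrightarrow>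
      moduli_proj p \<in> A \<longleftrightarrow> (\<forall>(d, c)\<in>PA. weierstrass_poly d c p = 0)"
    by (elim exE) (rule that, erule bspec)
  have "\<exists>P. \<forall>p\<in>Tor12. moduli_proj p \<in> B \<longleftrightarrow> (\<forall>(d, c)\<in>P. weierstrass_poly d c p = 0)"
    using AB by (simp only: zariski_closed_def)
  then obtain PB where PB: "\<And>p. p \<in> Tor12 \<Longrightarrow>
      moduli_proj p \<in> B \<longleftrightarrow> (\<forall>(d, c)\<in>PB. weierstrass_poly d c p = 0)"
    by (elim exE) (rule that, erule bspec)
  let ?w = "\<lambda>d c \<tau>. weierstrass_poly d c (\<tau>, 1 / of_nat N)"
  have hol: "?w d c holomorphic_on upper_half" for d c
    using holomorphic_weierstrass_poly_torsion[of "1 / real N" d c] N by (simp add: divide_simps)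
  note T = Tor12_torsion[OF _ N]
  show "?S \<subseteq> A \<or> ?S \<subseteq> B"
  proof (rule disjCI)
    assume "\<not> ?S \<subseteq> B"
    then obtain \<tau>1 where \<tau>1: "\<tau>1 \<in> upper_half" "moduli_proj (\<tau>1, 1 / of_nat N) \<notin> B" by blast
    then obtain d c where dc: "(d, c) \<in> PB" "?w d c \<tau>1 \<noteq> 0" using PB[OF T[OF \<tau>1(1)]] by auto
    have "moduli_proj (\<tau>2, 1 / of_nat N) \<in> A" if \<tau>2: "\<tau>2 \<in> upper_half" for \<tau>2
    proof -
      have "?w d' c' \<tau>2 = 0" if dc': "(d', c') \<in> PA" for d' c'
      proof (rule holomorphic_upper_half_mult_eq_0[OF hol hol _ \<tau>1(1) dc(2) \<tau>2])
        fix \<tau> assume \<tau>: "\<tau> \<in> upper_half"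
        hence "moduli_proj (\<tau>, 1 / of_nat N) \<in> A \<union> B" using AB by blast
        thus "?w d c \<tau> = 0 \<or> ?w d' c' \<tau> = 0"
          using PA[OF T[OF \<tau>]] PB[OF T[OF \<tau>]] dc(1) dc' by auto
      qed
      thus ?thesis using PA[OF T[OF \<tau>2]] by auto
    qed
    thus "?S \<subseteq> A" by blast
  qed
qed

section \<open>Points of exact order N\<close>

definition exact_torsion :: "nat \<Rightarrow> complex \<times> complex \<Rightarrow> bool" where
  "exact_torsion N p \<longleftrightarrow> of_nat N * snd p \<in> period_lattice (fst p) \<and>
     (\<forall>n. 0 < n \<and> n < N \<longrightarrow> of_nat n * snd p \<notin> period_lattice (fst p))"

text \<open>The integers that carry z into the lattice are closed under integral combinations, so by
  Bezout it suffices to exclude proper divisors of N. The condition on N z may stand under the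
  quantifier because M = 1 always qualifies; each instance is then the zero condition of one
  division polynomial.\<close>

lemma exact_torsion_iff_divisors:
  assumes N: "N \<ge> 2"
  shows "exact_torsion N (\<tau>, z) \<longleftrightarrow> (\<forall>M. M > 0 \<and> M < N \<and> M dvd N \<longrightarrow>
    of_nat N * z \<in> period_lattice \<tau> \<and> of_nat M * z \<notin> period_lattice \<tau>)"
proof (intro iffI allI impI)
  assume R: "\<forall>M. M > 0 \<and> M < N \<and> M dvd N \<longrightarrow>
    of_nat N * z \<in> period_lattice \<tau> \<and> of_nat M * z \<notin> period_lattice \<tau>"
  have Nz: "of_nat N * z \<in> period_lattice \<tau>" using R[rule_format, of 1] N by auto
  have "of_nat n * z \<notin> period_lattice \<tau>" if n: "0 < n" "n < N" for n
  proof
    assume nz: "of_nat n * z \<in> period_lattice \<tau>"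
    obtain a b where ab: "a * int n + b * int N = gcd (int n) (int N)" using bezout_int by blast
    have "of_int a * (of_nat n * z) + of_int b * (of_nat N * z) \<in> period_lattice \<tau>"
      by (intro period_lattice_add period_lattice_of_int_mult nz Nz)
    also have "of_int a * (of_nat n * z) + of_int b * (of_nat N * z) = of_int (a * int n + b * int N) * z"
      by (simp add: algebra_simps)
    also have "a * int n + b * int N = int (gcd n N)" using ab by simp
    finally have "of_nat (gcd n N) * z \<in> period_lattice \<tau>" by simp
    moreover have "gcd n N \<le> n" using n by (simp add: gcd_le1_nat)
    ultimately show False using R[rule_format, of "gcd n N"] n by auto
  qed
  thus "exact_torsion N (\<tau>, z)" using Nz by (simp add: exact_torsion_def)
qed (auto simp: exact_torsion_def)

lemma zariski_closed_torsion:
  assumes N: "N \<ge> 2" and S: "S \<subseteq> M12" "\<And>p. p \<in> Tor12 \<Longrightarrow> moduli_proj p \<in> S \<longleftrightarrow> exact_torsion N p"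
  shows "zariski_closed S"
proof -
  have "\<exists>dc. \<forall>p\<in>Tor12. weierstrass_poly (fst dc) (snd dc) p = 0 \<longleftrightarrow>
      of_nat N * snd p \<in> period_lattice (fst p) \<and> of_nat M * snd p \<notin> period_lattice (fst p)"
    if M: "M > 0 \<and> M < N \<and> M dvd N" for M
  proof -
    define k where "k = N div M"
    have k: "k > 0" "k * M = N" using M N by (auto simp: k_def div_greater_zero_iff)
    obtain d c where "\<And>\<tau> z. (\<tau>, z) \<in> Tor12 \<Longrightarrow> weierstrass_poly d c (\<tau>, z) = 0 \<longleftrightarrow>
        of_nat (k * M) * z \<in> period_lattice \<tau> \<and> of_nat M * z \<notin> period_lattice \<tau>"
      by (rule division_polynomial[of M k]) (use M k in auto)
    thus ?thesis unfolding k(2) by (intro exI[of _ "(d, c)"]) auto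
  qed
  then obtain P where P: "\<And>M p. M > 0 \<and> M < N \<and> M dvd N \<Longrightarrow> p \<in> Tor12 \<Longrightarrow>
      weierstrass_poly (fst (P M)) (snd (P M)) p = 0 \<longleftrightarrow>
      of_nat N * snd p \<in> period_lattice (fst p) \<and> of_nat M * snd p \<notin> period_lattice (fst p)"
    by metis
  have "moduli_proj p \<in> S \<longleftrightarrow>
      (\<forall>(d, c)\<in>P ` {M. M > 0 \<and> M < N \<and> M dvd N}. weierstrass_poly d c p = 0)" if p: "p \<in> Tor12" for p
    using S(2)[OF p] exact_torsion_iff_divisors[OF N, of "fst p" "snd p"] P[OF _ p]
    by (auto simp: case_prod_unfold)
  thus ?thesis unfolding zariski_closed_def using S(1) by blast
qed

unbundle no Formal_Power_Series.fps_syntax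

section \<open>Quotient orbifolds as orbit spaces\<close>

text \<open>The record does not by itself tie the quotient map to the group; this says that the
  fibres are the orbits.\<close>

definition orbit_quotient :: "('x, 'g, 'q) quotient_orbifold \<Rightarrow> bool" where
  "orbit_quotient X \<longleftrightarrow> (\<forall>x\<in>cover X. \<forall>y\<in>cover X.
     quot_map X x = quot_map X y \<longleftrightarrow> (\<exists>g\<in>carrier (deck X). deck_act X g x = y))"

text \<open>A bijection that is equivariant along a group isomorphism matches orbits with orbits. As
  fibres are orbits on both sides, it descends to a bijection of the quotients.\<close>

lemma orbifold_isoI:
  fixes X :: "('x, 'g, 'q) quotient_orbifold" and Y :: "('y, 'h, 'r) quotient_orbifold"
  assumes X: "orbit_quotient X" and Y: "orbit_quotient Y"
    and \<phi>: "biholomorphism X Y \<phi>" and \<theta>: "\<theta> \<in> iso (deck X) (deck Y)"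
    and equiv: "\<And>g x. g \<in> carrier (deck X) \<Longrightarrow> x \<in> cover X \<Longrightarrow> deck_act X g x \<in> cover X \<and>
       \<phi> (deck_act X g x) = deck_act Y (\<theta> g) (\<phi> x)"
  shows "\<exists>f. orbifold_iso X Y f \<and> (\<forall>x\<in>cover X. f (quot_map X x) = quot_map Y (\<phi> x))"
proof -
  have bij: "bij_betw \<phi> (cover X) (cover Y)" using \<phi> by (simp add: biholomorphism_def)
  have \<theta>c: "\<theta> ` carrier (deck X) = carrier (deck Y)"
    using \<theta> by (auto simp: iso_def bij_betw_def)
  have fib: "quot_map X x = quot_map X y \<longleftrightarrow> quot_map Y (\<phi> x) = quot_map Y (\<phi> y)"
    if xy: "x \<in> cover X" "y \<in> cover X" for x y
  proof -
    have \<phi>xy: "\<phi> x \<in> cover Y" "\<phi> y \<in> cover Y" using bij xy by (auto simp: bij_betw_def)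
    have "quot_map Y (\<phi> x) = quot_map Y (\<phi> y) \<longleftrightarrow> (\<exists>g\<in>carrier (deck X). deck_act Y (\<theta> g) (\<phi> x) = \<phi> y)"
      using Y \<phi>xy unfolding orbit_quotient_def \<theta>c[symmetric] by blast
    also have "\<dots> \<longleftrightarrow> (\<exists>g\<in>carrier (deck X). deck_act X g x = y)"
      using equiv[OF _ xy(1)] bij xy unfolding bij_betw_def inj_on_def by metis
    finally show ?thesis using X xy unfolding orbit_quotient_def by blast
  qed
  define f where "f q = quot_map Y (\<phi> (SOME x. x \<in> cover X \<and> quot_map X x = q))" for q
  have f: "f (quot_map X x) = quot_map Y (\<phi> x)" if x: "x \<in> cover X" for x
  proof -
    let ?y = "SOME y. y \<in> cover X \<and> quot_map X y = quot_map X x"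
    have "?y \<in> cover X \<and> quot_map X ?y = quot_map X x"
      by (rule someI[of "\<lambda>y. y \<in> cover X \<and> quot_map X y = quot_map X x" x]) (use x in simp)
    thus ?thesis using fib[of ?y x] x by (simp add: f_def)
  qed
  have "bij_betw f (points X) (points Y)"
    unfolding points_def
  proof (rule bij_betw_imageI)
    show "inj_on f (quot_map X ` cover X)"
      by (auto simp: inj_on_def f fib)
    have "f ` quot_map X ` cover X = quot_map Y ` \<phi> ` cover X"
      unfolding image_image by (intro image_cong refl f)
    thus "f ` quot_map X ` cover X = quot_map Y ` cover Y"
      using bij by (simp add: bij_betw_def)
  qed
  hence "orbifold_iso X Y f"
    unfolding orbifold_iso_def using \<phi> \<theta> equiv f by blast
  thus ?thesis using f by blast
qed

section \<open>The modular group and its affine extension\<close>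

definition mat2 :: "int \<Rightarrow> int \<Rightarrow> int \<Rightarrow> int \<Rightarrow> int^2^2" where
  "mat2 p q r s = (\<chi> i. \<chi> j. if i = 1 then (if j = 1 then p else q) else (if j = 1 then r else s))"

lemma mat2_nth [simp]:
  "mat2 p q r s $ 1 $ 1 = p" "mat2 p q r s $ 1 $ 2 = q"
  "mat2 p q r s $ 2 $ 1 = r" "mat2 p q r s $ 2 $ 2 = s"
  by (simp_all add: mat2_def)

lemma mat2_eqI:
  fixes A B :: "int^2^2"
  assumes "A$1$1 = B$1$1" "A$1$2 = B$1$2" "A$2$1 = B$2$1" "A$2$2 = B$2$2"
  shows "A = B"
  using assms by (simp add: vec_eq_iff forall_2)


lemma matrix_mult_nth2:
  fixes A B :: "int^2^2"
  shows "(A ** B)$1$1 = A$1$1 * B$1$1 + A$1$2 * B$2$1" "(A ** B)$1$2 = A$1$1 * B$1$2 + A$1$2 * B$2$2"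
    "(A ** B)$2$1 = A$2$1 * B$1$1 + A$2$2 * B$2$1" "(A ** B)$2$2 = A$2$1 * B$1$2 + A$2$2 * B$2$2"
  by (simp_all add: matrix_matrix_mult_def sum_2)

lemma mat_1_nth2 [simp]:
  "(mat 1 :: int^2^2)$1$1 = 1" "(mat 1 :: int^2^2)$1$2 = 0"
  "(mat 1 :: int^2^2)$2$1 = 0" "(mat 1 :: int^2^2)$2$2 = 1"
  by (simp_all add: mat_def)

text \<open>The adjugate: for determinant 1 it is the inverse, with integer entries.\<close>

definition adj2 :: "int^2^2 \<Rightarrow> int^2^2" where
  "adj2 A = mat2 (A$2$2) (- A$1$2) (- A$2$1) (A$1$1)"

lemma carrier_SL2Z: "A \<in> carrier SL2Z \<longleftrightarrow> A$1$1 * A$2$2 - A$1$2 * A$2$1 = 1"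
  by (simp add: SL2Z_def det_2)

lemma mat_1_in_SL2Z: "mat 1 \<in> carrier SL2Z"
  by (simp add: carrier_SL2Z)

lemma SL2Z_mult_closed: "A \<in> carrier SL2Z \<Longrightarrow> B \<in> carrier SL2Z \<Longrightarrow> A ** B \<in> carrier SL2Z"
  by (simp add: SL2Z_def det_mul)

lemma adj2_in_SL2Z: "A \<in> carrier SL2Z \<Longrightarrow> adj2 A \<in> carrier SL2Z"
  by (simp add: carrier_SL2Z adj2_def algebra_simps)

lemma adj2_mult:
  assumes "A \<in> carrier SL2Z"
  shows "A ** adj2 A = mat 1" "adj2 A ** A = mat 1"
  using assms
  by (auto intro!: mat2_eqI simp: adj2_def matrix_mult_nth2 carrier_SL2Z algebra_simps)

section \<open>The Moebius action on the half plane\<close>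

definition automorphy :: "int^2^2 \<Rightarrow> complex \<Rightarrow> complex" where
  "automorphy A \<tau> = of_int (A$2$1) * \<tau> + of_int (A$2$2)"

lemma automorphy_nonzero:
  assumes "A \<in> carrier SL2Z" "\<tau> \<in> upper_half"
  shows "automorphy A \<tau> \<noteq> 0"
proof
  assume *: "automorphy A \<tau> = 0"
  hence "of_int (A$2$1) * Im \<tau> = 0" by (auto simp: automorphy_def complex_eq_iff)
  hence "A$2$1 = 0" using assms(2) by (simp add: upper_half_def)
  moreover from this have "A$2$2 = 0" using * by (simp add: automorphy_def)
  ultimately show False using assms(1) by (simp add: carrier_SL2Z)
qed

lemma moebius_eq: "moebius A \<tau> = (of_int (A$1$1) * \<tau> + of_int (A$1$2)) / automorphy A \<tau>"
  by (simp add: moebius_def automorphy_def)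

lemma moebius_in_upper_half:
  assumes "A \<in> carrier SL2Z" "\<tau> \<in> upper_half"
  shows "moebius A \<tau> \<in> upper_half"
proof -
  let ?j = "automorphy A \<tau>"
  have j: "?j \<noteq> 0" by (rule automorphy_nonzero[OF assms])
  have "moebius A \<tau> = (of_int (A$1$1) * \<tau> + of_int (A$1$2)) * cnj ?j / of_real ((cmod ?j)\<^sup>2)"
    unfolding moebius_eq by (subst complex_div_cnj) simp
  hence "Im (moebius A \<tau>) = Im ((of_int (A$1$1) * \<tau> + of_int (A$1$2)) * cnj ?j) / (cmod ?j)\<^sup>2"
    by (simp only: Im_divide_of_real)
  also have "Im ((of_int (A$1$1) * \<tau> + of_int (A$1$2)) * cnj ?j) =
      of_int (A$1$1 * A$2$2 - A$1$2 * A$2$1) * Im \<tau>"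
    by (simp add: automorphy_def algebra_simps)
  also have "A$1$1 * A$2$2 - A$1$2 * A$2$1 = 1" using assms(1) by (simp add: carrier_SL2Z)
  finally show ?thesis using assms(2) j by (simp add: upper_half_def)
qed

lemma automorphy_mult:
  assumes "B \<in> carrier SL2Z" "\<tau> \<in> upper_half"
  shows "automorphy (A ** B) \<tau> = automorphy A (moebius B \<tau>) * automorphy B \<tau>"
  using automorphy_nonzero[OF assms]
  by (simp add: automorphy_def matrix_mult_nth2 moebius_def field_simps)

lemma moebius_mult:
  assumes "A \<in> carrier SL2Z" "B \<in> carrier SL2Z" "\<tau> \<in> upper_half"
  shows "moebius (A ** B) \<tau> = moebius A (moebius B \<tau>)"
proof -
  note jB = automorphy_nonzero[OF assms(2,3)]
  note jA = automorphy_nonzero[OF assms(1) moebius_in_upper_half[OF assms(2,3)]]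
  have "moebius (A ** B) \<tau> * automorphy (A ** B) \<tau> =
      of_int (A$1$1) * (of_int (B$1$1) * \<tau> + of_int (B$1$2)) + of_int (A$1$2) * automorphy B \<tau>"
    using automorphy_nonzero[OF SL2Z_mult_closed[OF assms(1,2)] assms(3)]
    by (simp add: moebius_eq) (simp add: automorphy_def matrix_mult_nth2 algebra_simps)
  also have "\<dots> = (of_int (A$1$1) * moebius B \<tau> + of_int (A$1$2)) * automorphy B \<tau>"
    using jB by (simp add: moebius_eq[of B] field_simps)
  also have "\<dots> = moebius A (moebius B \<tau>) * automorphy (A ** B) \<tau>"
    using jA by (simp add: moebius_eq[of A] automorphy_mult[OF assms(2,3)])
  finally show ?thesis
    using automorphy_nonzero[OF SL2Z_mult_closed[OF assms(1,2)] assms(3)] by simp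
qed

lemma moebius_1 [simp]: "moebius (mat 1) \<tau> = \<tau>"
  by (simp add: moebius_def)

lemma moebius_adj2:
  assumes "A \<in> carrier SL2Z" "\<tau> \<in> upper_half"
  shows "moebius A (moebius (adj2 A) \<tau>) = \<tau>" "moebius (adj2 A) (moebius A \<tau>) = \<tau>"
  using moebius_mult[OF assms(1) adj2_in_SL2Z[OF assms(1)] assms(2)]
    moebius_mult[OF adj2_in_SL2Z[OF assms(1)] assms] adj2_mult[OF assms(1)] by simp_all

lemma holomorphic_moebius:
  assumes "A \<in> carrier SL2Z"
  shows "moebius A holomorphic_on upper_half"
  unfolding moebius_def
  by (intro holomorphic_intros) (use automorphy_nonzero[OF assms] in \<open>auto simp: automorphy_def\<close>)

section \<open>The affine action and its orbits\<close>

lemma tor_act_eq: "tor_act (A, (k, l)) (\<tau>, z) =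
    (moebius A \<tau>, (z + of_int k + of_int l * \<tau>) / automorphy A \<tau>)"
  by (simp add: tor_act_def automorphy_def)

lemma carrier_affine_SL2Z: "carrier affine_SL2Z = carrier SL2Z \<times> UNIV"
  by (simp add: affine_SL2Z_def)

lemma affine_mult: "(A, (k, l)) \<otimes>\<^bsub>affine_SL2Z\<^esub> (B, (k', l')) =
    (A ** B, (k' + l * B$1$2 + k * B$2$2, l' + l * B$1$1 + k * B$2$1))"
  by (simp add: affine_SL2Z_def)

lemma affine_one: "\<one>\<^bsub>affine_SL2Z\<^esub> = (mat 1, (0, 0))"
  by (simp add: affine_SL2Z_def)

lemma tor_act_mult:
  assumes g: "g \<in> carrier affine_SL2Z" and h: "h \<in> carrier affine_SL2Z" and p: "fst p \<in> upper_half"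
  shows "tor_act (g \<otimes>\<^bsub>affine_SL2Z\<^esub> h) p = tor_act g (tor_act h p)"
proof -
  obtain A k l B k' l' \<tau> z where e: "g = (A, (k, l))" "h = (B, (k', l'))" "p = (\<tau>, z)"
    by (metis prod.exhaust_sel)
  have A: "A \<in> carrier SL2Z" and B: "B \<in> carrier SL2Z" and \<tau>: "\<tau> \<in> upper_half"
    using g h p by (auto simp: e carrier_affine_SL2Z)
  note jB = automorphy_nonzero[OF B \<tau>]
  note jA = automorphy_nonzero[OF A moebius_in_upper_half[OF B \<tau>]]
  have m: "moebius B \<tau> * automorphy B \<tau> = of_int (B$1$1) * \<tau> + of_int (B$1$2)"
    using jB by (simp add: moebius_eq)
  have "((z + of_int k' + of_int l' * \<tau>) / automorphy B \<tau> + of_int k + of_int l * moebius B \<tau>) * automorphy B \<tau> =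
      z + of_int k' + of_int l' * \<tau> + of_int k * automorphy B \<tau> + of_int l * (moebius B \<tau> * automorphy B \<tau>)"
    using jB by (simp add: field_simps)
  also have "\<dots> = z + of_int (k' + l * B$1$2 + k * B$2$2) + of_int (l' + l * B$1$1 + k * B$2$1) * \<tau>"
    unfolding m by (simp add: automorphy_def algebra_simps)
  finally have "z + of_int (k' + l * B$1$2 + k * B$2$2) + of_int (l' + l * B$1$1 + k * B$2$1) * \<tau> =
    ((z + of_int k' + of_int l' * \<tau>) / automorphy B \<tau> + of_int k + of_int l * moebius B \<tau>) * automorphy B \<tau>" ..
  hence "(z + of_int (k' + l * B$1$2 + k * B$2$2) + of_int (l' + l * B$1$1 + k * B$2$1) * \<tau>) /
      (automorphy A (moebius B \<tau>) * automorphy B \<tau>) =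
    ((z + of_int k' + of_int l' * \<tau>) / automorphy B \<tau> + of_int k + of_int l * moebius B \<tau>) / automorphy A (moebius B \<tau>)"
    using jB by simp
  thus ?thesis
    unfolding e affine_mult tor_act_eq moebius_mult[OF A B \<tau>] automorphy_mult[OF B \<tau>] by simp
qed

lemma tor_act_one: "tor_act \<one>\<^bsub>affine_SL2Z\<^esub> p = p"
  by (cases p) (simp add: affine_one tor_act_eq automorphy_def)

text \<open>The translation part is minus the row vector (l, k) times the adjugate of A.\<close>

definition affine_inv :: "(int^2^2) \<times> (int \<times> int) \<Rightarrow> (int^2^2) \<times> (int \<times> int)" where
  "affine_inv g = (case g of (A, (k, l)) \<Rightarrow>
     (adj2 A, (l * A$1$2 - k * A$1$1, k * A$2$1 - l * A$2$2)))"

lemma affine_inv_closed: "g \<in> carrier affine_SL2Z \<Longrightarrow> affine_inv g \<in> carrier affine_SL2Z"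
  by (auto simp: carrier_affine_SL2Z affine_inv_def adj2_in_SL2Z)

lemma affine_inv_mult:
  assumes "g \<in> carrier affine_SL2Z"
  shows "affine_inv g \<otimes>\<^bsub>affine_SL2Z\<^esub> g = \<one>\<^bsub>affine_SL2Z\<^esub>" "g \<otimes>\<^bsub>affine_SL2Z\<^esub> affine_inv g = \<one>\<^bsub>affine_SL2Z\<^esub>"
proof -
  obtain A k l where g: "g = (A, (k, l))" by (metis prod.exhaust_sel)
  have A: "A \<in> carrier SL2Z" using assms by (simp add: g carrier_affine_SL2Z)
  have det: "A$1$1 * A$2$2 = 1 + A$1$2 * A$2$1" using A by (simp add: carrier_SL2Z)
  have *: "k + (k * A$2$1 - l * A$2$2) * A$1$2 + (l * A$1$2 - k * A$1$1) * A$2$2 =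
      k * (1 + A$1$2 * A$2$1 - A$1$1 * A$2$2)"
    "l + (k * A$2$1 - l * A$2$2) * A$1$1 + (l * A$1$2 - k * A$1$1) * A$2$1 =
      l * (1 + A$1$2 * A$2$1 - A$1$1 * A$2$2)"
    by (simp_all add: algebra_simps)
  show "affine_inv g \<otimes>\<^bsub>affine_SL2Z\<^esub> g = \<one>\<^bsub>affine_SL2Z\<^esub>"
    unfolding g affine_inv_def case_prod_conv affine_mult affine_one * adj2_mult[OF A] det by simp
  show "g \<otimes>\<^bsub>affine_SL2Z\<^esub> affine_inv g = \<one>\<^bsub>affine_SL2Z\<^esub>"
    unfolding g affine_inv_def case_prod_conv affine_mult affine_one adj2_mult[OF A]
    by (simp add: adj2_def algebra_simps)
qed

lemma affine_mult_closed:
  "g \<in> carrier affine_SL2Z \<Longrightarrow> h \<in> carrier affine_SL2Z \<Longrightarrow> g \<otimes>\<^bsub>affine_SL2Z\<^esub> h \<in> carrier affine_SL2Z"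
  by (cases g; cases h) (auto simp: affine_mult carrier_affine_SL2Z SL2Z_mult_closed)

lemma fst_tor_act:
  assumes "g \<in> carrier affine_SL2Z" "fst p \<in> upper_half"
  shows "fst (tor_act g p) \<in> upper_half"
  using assms by (cases g; cases p) (auto simp: tor_act_eq carrier_affine_SL2Z moebius_in_upper_half)

lemma moduli_proj_eq_iff:
  assumes p: "fst p \<in> upper_half"
  shows "moduli_proj p = moduli_proj q \<longleftrightarrow> (\<exists>g\<in>carrier affine_SL2Z. tor_act g p = q)"
proof
  assume "moduli_proj p = moduli_proj q"
  moreover have "\<one>\<^bsub>affine_SL2Z\<^esub> \<in> carrier affine_SL2Z"
    by (simp add: affine_one carrier_affine_SL2Z mat_1_in_SL2Z)
  from imageI[OF this, of "\<lambda>g. tor_act g q"] have "q \<in> moduli_proj q"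
    by (simp add: moduli_proj_def tor_act_one)
  ultimately have "q \<in> moduli_proj p" by simp
  thus "\<exists>g\<in>carrier affine_SL2Z. tor_act g p = q" unfolding moduli_proj_def by blast
next
  assume "\<exists>g\<in>carrier affine_SL2Z. tor_act g p = q"
  then obtain g where g: "g \<in> carrier affine_SL2Z" "tor_act g p = q" by blast
  have q: "fst q \<in> upper_half" using fst_tor_act[OF g(1) p] g(2) by simp
  have gi: "tor_act (affine_inv g) q = p"
    using tor_act_mult[OF affine_inv_closed[OF g(1)] g(1) p] affine_inv_mult[OF g(1)] tor_act_one[of p] g(2)
    by simp
  show "moduli_proj p = moduli_proj q"
    unfolding moduli_proj_def
  proof (intro equalityI subsetI)
    fix x assume "x \<in> (\<lambda>h. tor_act h p) ` carrier affine_SL2Z"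
    then obtain h where h: "h \<in> carrier affine_SL2Z" "x = tor_act h p" by blast
    hence "x = tor_act (h \<otimes>\<^bsub>affine_SL2Z\<^esub> affine_inv g) q"
      using tor_act_mult[OF h(1) affine_inv_closed[OF g(1)] q] gi by simp
    thus "x \<in> (\<lambda>h. tor_act h q) ` carrier affine_SL2Z"
      using affine_mult_closed[OF h(1) affine_inv_closed[OF g(1)]] by blast
  next
    fix x assume "x \<in> (\<lambda>h. tor_act h q) ` carrier affine_SL2Z"
    then obtain h where h: "h \<in> carrier affine_SL2Z" "x = tor_act h q" by blast
    hence "x = tor_act (h \<otimes>\<^bsub>affine_SL2Z\<^esub> g) p"
      using tor_act_mult[OF h(1) g(1) p] g(2) by simp
    thus "x \<in> (\<lambda>h. tor_act h p) ` carrier affine_SL2Z"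
      using affine_mult_closed[OF h(1) g(1)] by blast
  qed
qed

section \<open>Leaves and their stabilizers\<close>

text \<open>On a leaf the point \<open>z\<close> has constant real coordinates \<open>x\<close> with respect to the basis
  \<open>(\<tau>, 1)\<close>. The modular group acts on these coordinates, viewed as row vectors, from the right.\<close>

definition leaf_point :: "real \<times> real \<Rightarrow> complex \<Rightarrow> complex \<times> complex" where
  "leaf_point x \<tau> = (\<tau>, of_real (fst x) * \<tau> + of_real (snd x))"

definition row_act :: "int^2^2 \<Rightarrow> real \<times> real \<Rightarrow> real \<times> real" where
  "row_act A x = (fst x * of_int (A$1$1) + snd x * of_int (A$2$1),
                  fst x * of_int (A$1$2) + snd x * of_int (A$2$2))"

definition int_pairs :: "(real \<times> real) set" where
  "int_pairs = {x. fst x \<in> \<int> \<and> snd x \<in> \<int>}"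

lemma int_pairs_add: "x \<in> int_pairs \<Longrightarrow> y \<in> int_pairs \<Longrightarrow> x + y \<in> int_pairs"
  by (auto simp: int_pairs_def)

lemma int_pairs_diff: "x \<in> int_pairs \<Longrightarrow> y \<in> int_pairs \<Longrightarrow> x - y \<in> int_pairs"
  by (auto simp: int_pairs_def)

lemma int_pairsE:
  assumes "x \<in> int_pairs"
  obtains m n :: int where "x = (of_int m, of_int n)"
  using assms by (auto simp: int_pairs_def elim!: Ints_cases) (metis prod.exhaust_sel)

lemma int_pairsI [simp]: "(of_int m, of_int n) \<in> int_pairs"
  by (simp add: int_pairs_def)

lemma row_act_mult: "row_act (A ** B) x = row_act B (row_act A x)"
  by (simp add: row_act_def matrix_mult_nth2 algebra_simps)

lemma row_act_1 [simp]: "row_act (mat 1) x = x"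
  by (simp add: row_act_def)


lemma row_act_diff: "row_act A (x - y) = row_act A x - row_act A y"
  by (simp add: row_act_def algebra_simps)

lemma row_act_scaleR: "row_act A (c *\<^sub>R x) = c *\<^sub>R row_act A x"
  by (simp add: row_act_def algebra_simps)

lemma row_act_int_pairs: "x \<in> int_pairs \<Longrightarrow> row_act A x \<in> int_pairs"
  by (auto simp: row_act_def int_pairs_def)

lemma row_act_adj2:
  assumes "A \<in> carrier SL2Z"
  shows "row_act A (row_act (adj2 A) x) = x" "row_act (adj2 A) (row_act A x) = x"
  using adj2_mult[OF assms] by (simp_all flip: row_act_mult)

lemma row_act_int_pairs_iff:
  assumes "A \<in> carrier SL2Z"
  shows "row_act A x \<in> int_pairs \<longleftrightarrow> x \<in> int_pairs"
  using row_act_int_pairs[of x A] row_act_int_pairs[of "row_act A x" "adj2 A"] row_act_adj2[OF assms, of x]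
  by auto

text \<open>The matrix A carries the column (\<tau>, 1) to \<open>automorphy A \<tau>\<close> times
  the column (\<open>moebius A \<tau>\<close>, 1), so coordinates change by the inverse of A;
  putting A on the side of y avoids the inverse. The translation adds l to the coefficient of \<tau>
  and k to the constant one, hence the order (l, k).\<close>

lemma tor_act_leaf_point:
  assumes A: "A \<in> carrier SL2Z" and \<tau>: "\<tau> \<in> upper_half"
    and y: "row_act A y = x + (of_int l, of_int k)"
  shows "tor_act (A, (k, l)) (leaf_point x \<tau>) = leaf_point y (moebius A \<tau>)"
proof -
  have 1: "of_real (fst y) * of_int (A$1$1) + of_real (snd y) * of_int (A$2$1) =
      (of_real (fst x) + of_int l :: complex)"
    using arg_cong[OF y, of "\<lambda>p. complex_of_real (fst p)"] by (simp add: row_act_def)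
  have 2: "of_real (fst y) * of_int (A$1$2) + of_real (snd y) * of_int (A$2$2) =
      (of_real (snd x) + of_int k :: complex)"
    using arg_cong[OF y, of "\<lambda>p. complex_of_real (snd p)"] by (simp add: row_act_def)
  have "(of_real (fst x) * \<tau> + of_real (snd x)) + of_int k + of_int l * \<tau> =
      (of_real (fst x) + of_int l) * \<tau> + (of_real (snd x) + of_int k)"
    by (simp add: algebra_simps)
  also have "\<dots> = of_real (fst y) * (of_int (A$1$1) * \<tau> + of_int (A$1$2)) + of_real (snd y) * automorphy A \<tau>"
    unfolding 1[symmetric] 2[symmetric] by (simp add: automorphy_def algebra_simps)
  also have "\<dots> / automorphy A \<tau> = of_real (fst y) * moebius A \<tau> + of_real (snd y)"
    using automorphy_nonzero[OF A \<tau>] by (simp add: moebius_eq add_divide_distrib ring_distribs)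
  finally show ?thesis by (simp add: leaf_point_def tor_act_eq)
qed

lemma row_act_solve:
  assumes "A \<in> carrier SL2Z"
  obtains y where "row_act A y = x"
  using row_act_adj2(1)[OF assms, of x] by blast

lemma leaf_point_eq_iff:
  assumes "\<tau> \<in> upper_half"
  shows "leaf_point x \<tau> = leaf_point y \<tau>' \<longleftrightarrow> \<tau> = \<tau>' \<and> x = y"
proof
  assume *: "leaf_point x \<tau> = leaf_point y \<tau>'"
  hence "complex_of_real (snd x - snd y) + complex_of_real (fst x - fst y) * \<tau> = 0"
    by (auto simp: leaf_point_def algebra_simps)
  from upper_half_linear_form_eq_0[OF assms this] * show "\<tau> = \<tau>' \<and> x = y"
    by (simp add: leaf_point_def prod_eq_iff)
qed simp

lemma tor_act_leaf_point_eq_iff: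
  assumes A: "A \<in> carrier SL2Z" and \<tau>: "\<tau> \<in> upper_half"
  shows "tor_act (A, (k, l)) (leaf_point x \<tau>) = leaf_point y \<tau>' \<longleftrightarrow>
    \<tau>' = moebius A \<tau> \<and> row_act A y = x + (of_int l, of_int k)"
proof -
  obtain y' where y': "row_act A y' = x + (of_int l, of_int k)" by (rule row_act_solve[OF A])
  have "tor_act (A, (k, l)) (leaf_point x \<tau>) = leaf_point y' (moebius A \<tau>)"
    by (rule tor_act_leaf_point[OF A \<tau> y'])
  hence "tor_act (A, (k, l)) (leaf_point x \<tau>) = leaf_point y \<tau>' \<longleftrightarrow> \<tau>' = moebius A \<tau> \<and> y' = y"
    using leaf_point_eq_iff[OF moebius_in_upper_half[OF A \<tau>]] by auto
  also have "y' = y \<longleftrightarrow> row_act A y = x + (of_int l, of_int k)"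
    using y' row_act_adj2(2)[OF A] by metis
  finally show ?thesis .
qed

lemma Tor12_leaf_point:
  assumes "p \<in> Tor12"
  obtains x where "fst p \<in> upper_half" "x \<notin> int_pairs" "p = leaf_point x (fst p)"
proof -
  have \<tau>: "fst p \<in> upper_half" "snd p \<notin> period_lattice (fst p)" using assms by (auto simp: Tor12_def)
  obtain s t where st: "snd p = complex_of_real s + complex_of_real t * fst p"
    by (rule upper_half_coordinates[OF \<tau>(1)])
  hence "(t, s) \<notin> int_pairs"
    using \<tau>(2) period_lattice_coordinates[OF \<tau>(1), of s t] by (auto simp: int_pairs_def)
  moreover have "p = leaf_point (t, s) (fst p)"
    using st by (simp add: leaf_point_def prod_eq_iff add.commute)
  ultimately show ?thesis using that \<tau>(1) by blast
qed

lemma leaf_point_in_Tor12: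
  assumes "\<tau> \<in> upper_half" "x \<notin> int_pairs"
  shows "leaf_point x \<tau> \<in> Tor12"
  using period_lattice_coordinates[OF assms(1), of "snd x" "fst x"] assms
  by (simp add: leaf_point_def Tor12_def int_pairs_def add.commute conj_commute)

text \<open>The equation of the leaf solved for z, which is (a_0/\<alpha>) \<tau> -
  a_\<infinity>/\<alpha>; this explains the sign.\<close>

definition leaf_coords :: "real \<Rightarrow> real \<times> real \<Rightarrow> real \<times> real" where
  "leaf_coords \<alpha> a = (fst a / \<alpha>, - snd a / \<alpha>)"

lemma scaled_lattice_iff:
  assumes "\<alpha> \<noteq> 0"
  shows "a \<in> scaled_lattice \<alpha> \<longleftrightarrow> leaf_coords \<alpha> a \<in> int_pairs"
proof
  assume "a \<in> scaled_lattice \<alpha>"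
  then obtain m n :: int where "a = (\<alpha> * of_int m, \<alpha> * of_int n)" unfolding scaled_lattice_def by blast
  thus "leaf_coords \<alpha> a \<in> int_pairs" using assms by (simp add: leaf_coords_def int_pairs_def)
next
  assume "leaf_coords \<alpha> a \<in> int_pairs"
  then obtain m n :: int where "leaf_coords \<alpha> a = (of_int m, of_int n)" by (rule int_pairsE)
  hence "a = (\<alpha> * of_int m, \<alpha> * of_int (-n))"
    using assms by (auto simp: leaf_coords_def prod_eq_iff field_simps)
  thus "a \<in> scaled_lattice \<alpha>" unfolding scaled_lattice_def by blast
qed

lemma leaf_coords_scaleR: "leaf_coords \<alpha> (c *\<^sub>R a) = c *\<^sub>R leaf_coords \<alpha> a"
  by (simp add: leaf_coords_def)

lemma leaf_eq:
  assumes "\<alpha> \<noteq> 0" "a \<notin> scaled_lattice \<alpha>"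
  shows "leaf \<alpha> a = leaf_point (leaf_coords \<alpha> a) ` upper_half"
proof (intro equalityI subsetI)
  fix p assume "p \<in> leaf \<alpha> a"
  hence p: "fst p \<in> upper_half"
    "complex_of_real (fst a) * fst p - complex_of_real \<alpha> * snd p = complex_of_real (snd a)"
    by (auto simp: leaf_def Tor12_def)
  hence "snd p = (complex_of_real (fst a) * fst p - complex_of_real (snd a)) / complex_of_real \<alpha>"
    using assms(1) by (simp add: field_simps)
  hence "p = leaf_point (leaf_coords \<alpha> a) (fst p)"
    by (simp add: leaf_point_def leaf_coords_def prod_eq_iff diff_divide_distrib)
  thus "p \<in> leaf_point (leaf_coords \<alpha> a) ` upper_half" using p(1) by blast
next
  fix p assume "p \<in> leaf_point (leaf_coords \<alpha> a) ` upper_half"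
  then obtain \<tau> where \<tau>: "\<tau> \<in> upper_half" "p = leaf_point (leaf_coords \<alpha> a) \<tau>" by blast
  have "p \<in> Tor12" unfolding \<tau>(2)
    by (rule leaf_point_in_Tor12) (use \<tau> assms scaled_lattice_iff in auto)
  thus "p \<in> leaf \<alpha> a"
    using assms(1) by (simp add: leaf_def \<tau>(2) leaf_point_def leaf_coords_def ring_distribs)
qed

definition row_stabilizes :: "real \<times> real \<Rightarrow> int^2^2 \<Rightarrow> bool" where
  "row_stabilizes x A \<longleftrightarrow> A \<in> carrier SL2Z \<and> row_act A x - x \<in> int_pairs"

text \<open>The coordinates of the leaf are fixed, so the matrix determines the translation. The
  floor merely turns a real number known to be integral into an integer, and the coordinates are
  swapped because the row vector is (l, k).\<close>

definition stabilizer_lift :: "real \<times> real \<Rightarrow> int^2^2 \<Rightarrow> (int^2^2) \<times> (int \<times> int)" where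
  "stabilizer_lift x A = (A, (\<lfloor>snd (row_act A x - x)\<rfloor>, \<lfloor>fst (row_act A x - x)\<rfloor>))"

text \<open>A change of basis by B acts on the coordinates and conjugates the stabilizer; this
  permits passing to normal forms.\<close>

lemma row_stabilizes_conj:
  assumes B: "B \<in> carrier SL2Z" and A: "row_stabilizes (row_act B x) A"
  shows "row_stabilizes x (B ** A ** adj2 B)"
proof -
  have "row_act (B ** A ** adj2 B) x - x = row_act (adj2 B) (row_act A (row_act B x) - row_act B x)"
    by (simp add: row_act_mult row_act_diff row_act_adj2[OF B])
  thus ?thesis using A B
    by (simp add: row_stabilizes_def row_act_int_pairs SL2Z_mult_closed adj2_in_SL2Z)
qed

lemma adj2_adj2 [simp]: "adj2 (adj2 B) = B"
  by (rule mat2_eqI) (simp_all add: adj2_def)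

lemma row_stabilizes_conj_iff:
  assumes B: "B \<in> carrier SL2Z"
  shows "row_stabilizes x (B ** A ** adj2 B) \<longleftrightarrow> row_stabilizes (row_act B x) A"
proof
  assume "row_stabilizes x (B ** A ** adj2 B)"
  hence "row_stabilizes (row_act (adj2 B) (row_act B x)) (B ** A ** adj2 B)"
    by (simp add: row_act_adj2[OF B])
  from row_stabilizes_conj[OF adj2_in_SL2Z[OF B] this]
  have "row_stabilizes (row_act B x) (adj2 B ** (B ** A ** adj2 B) ** B)" by simp
  also have "adj2 B ** (B ** A ** adj2 B) ** B = (adj2 B ** B) ** A ** (adj2 B ** B)"
    by (simp add: matrix_mul_assoc)
  also have "\<dots> = A" by (simp add: adj2_mult[OF B])
  finally show "row_stabilizes (row_act B x) A" .
qed (rule row_stabilizes_conj[OF B])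

locale veech_leaf =
  fixes \<alpha> :: real and a x :: "real \<times> real"
  assumes \<alpha>: "\<alpha> \<noteq> 0" and a: "a \<notin> scaled_lattice \<alpha>"
  defines "x \<equiv> leaf_coords \<alpha> a"
begin

lemma leaf: "leaf \<alpha> a = leaf_point x ` upper_half"
  unfolding x_def by (rule leaf_eq[OF \<alpha> a])


text \<open>The action sends points with the same coordinates to points with the same coordinates,
  so for necessity it is enough to follow the single point over \<i>.\<close>

lemma carrier_leaf_stabilizer:
  "(A, (k, l)) \<in> carrier (leaf_stabilizer \<alpha> a) \<longleftrightarrow> A \<in> carrier SL2Z \<and> row_act A x = x + (of_int l, of_int k)"
proof
  assume *: "(A, (k, l)) \<in> carrier (leaf_stabilizer \<alpha> a)"
  hence A: "A \<in> carrier SL2Z" and im: "tor_act (A, (k, l)) ` leaf \<alpha> a = leaf \<alpha> a"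
    by (auto simp: leaf_stabilizer_def carrier_affine_SL2Z)
  have i: "\<i> \<in> upper_half" by (simp add: upper_half_def)
  hence "tor_act (A, (k, l)) (leaf_point x \<i>) \<in> leaf_point x ` upper_half" using im leaf by blast
  then obtain \<tau>' where "tor_act (A, (k, l)) (leaf_point x \<i>) = leaf_point x \<tau>'" by blast
  thus "A \<in> carrier SL2Z \<and> row_act A x = x + (of_int l, of_int k)"
    using A tor_act_leaf_point_eq_iff[OF A i] by blast
next
  assume *: "A \<in> carrier SL2Z \<and> row_act A x = x + (of_int l, of_int k)"
  have "tor_act (A, (k, l)) ` leaf_point x ` upper_half = leaf_point x ` moebius A ` upper_half"
    unfolding image_image using * by (intro image_cong refl tor_act_leaf_point) auto
  also have "moebius A ` upper_half = upper_half"
  proof (intro equalityI subsetI)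
    fix \<tau> assume "\<tau> \<in> upper_half"
    thus "\<tau> \<in> moebius A ` upper_half"
      using moebius_adj2(1)[of A \<tau>] * moebius_in_upper_half[OF adj2_in_SL2Z, of A \<tau>]
      by (metis imageI)
  qed (use * moebius_in_upper_half in blast)
  finally show "(A, (k, l)) \<in> carrier (leaf_stabilizer \<alpha> a)"
    using * by (simp add: leaf_stabilizer_def carrier_affine_SL2Z leaf)
qed

lemma stabilizer_lift_in_stabilizer:
  assumes "row_stabilizes x A"
  shows "stabilizer_lift x A \<in> carrier (leaf_stabilizer \<alpha> a)"
proof -
  obtain l k :: int where lk: "row_act A x - x = (of_int l, of_int k)"
    using assms by (auto simp: row_stabilizes_def elim!: int_pairsE)
  hence "row_act A x = x + (of_int l, of_int k)" by (simp only: diff_eq_eq add.commute)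
  thus ?thesis using assms lk
    by (simp add: stabilizer_lift_def carrier_leaf_stabilizer row_stabilizes_def)
qed

lemma stabilizer_eq_lift:
  assumes "g \<in> carrier (leaf_stabilizer \<alpha> a)"
  shows "row_stabilizes x (fst g) \<and> g = stabilizer_lift x (fst g)"
proof -
  obtain A k l where g: "g = (A, (k, l))" by (metis prod.exhaust_sel)
  have *: "A \<in> carrier SL2Z" "row_act A x = x + (of_int l, of_int k)"
    using assms by (auto simp: g carrier_leaf_stabilizer)
  hence "row_act A x - x = (of_int l, of_int k)" by simp
  thus ?thesis using *(1) by (simp add: g row_stabilizes_def stabilizer_lift_def)
qed

lemma stabilizer_mult_closed:
  assumes g: "g \<in> carrier (leaf_stabilizer \<alpha> a)" and h: "h \<in> carrier (leaf_stabilizer \<alpha> a)"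
  shows "g \<otimes>\<^bsub>affine_SL2Z\<^esub> h \<in> carrier (leaf_stabilizer \<alpha> a)"
proof -
  have gh: "g \<in> carrier affine_SL2Z" "h \<in> carrier affine_SL2Z"
    "tor_act g ` leaf \<alpha> a = leaf \<alpha> a" "tor_act h ` leaf \<alpha> a = leaf \<alpha> a"
    using g h by (auto simp: leaf_stabilizer_def)
  have "tor_act (g \<otimes>\<^bsub>affine_SL2Z\<^esub> h) ` leaf \<alpha> a = tor_act g ` tor_act h ` leaf \<alpha> a"
    unfolding image_image
    by (intro image_cong refl tor_act_mult gh) (auto simp: leaf leaf_point_def)
  thus ?thesis using gh by (simp add: leaf_stabilizer_def affine_mult_closed)
qed

text \<open>Both sides are elements of the stabilizer over the same matrix, and such an element is
  determined by its matrix.\<close>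

lemma stabilizer_lift_mult:
  assumes "row_stabilizes x A" "row_stabilizes x B"
  shows "stabilizer_lift x (A ** B) = stabilizer_lift x A \<otimes>\<^bsub>leaf_stabilizer \<alpha> a\<^esub> stabilizer_lift x B"
proof -
  let ?g = "stabilizer_lift x A \<otimes>\<^bsub>affine_SL2Z\<^esub> stabilizer_lift x B"
  have "?g \<in> carrier (leaf_stabilizer \<alpha> a)"
    by (intro stabilizer_mult_closed stabilizer_lift_in_stabilizer assms)
  from stabilizer_eq_lift[OF this] have "?g = stabilizer_lift x (fst ?g)" by blast
  moreover have "fst ?g = A ** B" by (simp add: stabilizer_lift_def affine_mult)
  ultimately show ?thesis by (simp add: leaf_stabilizer_def)
qed

text \<open>A group element that carries one point of the leaf to another point of it must preserve
  the coordinates, hence stabilizes the whole leaf. So two points of the leaf are identified in the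
  moduli space only by its stabilizer.\<close>

lemma orbit_quotient_leaf_orbifold: "orbit_quotient (leaf_orbifold \<alpha> a)"
  unfolding orbit_quotient_def
proof (intro ballI)
  fix p q assume "p \<in> cover (leaf_orbifold \<alpha> a)" "q \<in> cover (leaf_orbifold \<alpha> a)"
  then obtain \<tau> \<tau>' where \<tau>: "\<tau> \<in> upper_half" "p = leaf_point x \<tau>" "\<tau>' \<in> upper_half" "q = leaf_point x \<tau>'"
    by (auto simp: leaf_orbifold_def leaf)
  have "moduli_proj p = moduli_proj q \<longleftrightarrow> (\<exists>g\<in>carrier affine_SL2Z. tor_act g p = q)"
    by (rule moduli_proj_eq_iff) (simp add: \<tau> leaf_point_def)
  also have "\<dots> \<longleftrightarrow> (\<exists>g\<in>carrier (leaf_stabilizer \<alpha> a). tor_act g p = q)"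
  proof
    assume "\<exists>g\<in>carrier affine_SL2Z. tor_act g p = q"
    then obtain A k l where g: "A \<in> carrier SL2Z" "tor_act (A, (k, l)) p = q"
      by (auto simp: carrier_affine_SL2Z)
    hence "row_act A x = x + (of_int l, of_int k)"
      using tor_act_leaf_point_eq_iff[OF g(1) \<tau>(1)] by (simp add: \<tau>)
    hence "(A, (k, l)) \<in> carrier (leaf_stabilizer \<alpha> a)" using g(1) carrier_leaf_stabilizer by blast
    thus "\<exists>g\<in>carrier (leaf_stabilizer \<alpha> a). tor_act g p = q" using g(2) by blast
  qed (auto simp: leaf_stabilizer_def)
  finally show "quot_map (leaf_orbifold \<alpha> a) p = quot_map (leaf_orbifold \<alpha> a) q \<longleftrightarrow>
      (\<exists>g\<in>carrier (deck (leaf_orbifold \<alpha> a)). deck_act (leaf_orbifold \<alpha> a) g p = q)"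
    by (simp add: leaf_orbifold_def)
qed

text \<open>The common tool for the three types of leaves. \<open>B\<close> brings the coordinates
  into normal form, \<psi> rescales the half plane as the cylinder requires, and \<theta> identifies
  the deck group with the stabilizer of the normal form; conjugation by \<open>B\<close> leads back
  to the given leaf.\<close>

lemma leaf_orbifold_uniformization:
  fixes X :: "(complex, 'g, 'q) quotient_orbifold"
  assumes X: "orbit_quotient X" "cover X = upper_half" "chart X = (\<lambda>\<tau>. \<tau>)"
    and B: "B \<in> carrier SL2Z"
    and \<psi>: "\<psi> holomorphic_on upper_half" "\<psi>' holomorphic_on upper_half"
      "\<And>\<tau>. \<tau> \<in> upper_half \<Longrightarrow> \<psi> \<tau> \<in> upper_half \<and> \<psi>' \<tau> \<in> upper_half \<and> \<psi> (\<psi>' \<tau>) = \<tau> \<and> \<psi>' (\<psi> \<tau>) = \<tau>"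
    and \<theta>: "bij_betw \<theta> (carrier (deck X)) {A. row_stabilizes (row_act B x) A}"
      "\<And>g h. g \<in> carrier (deck X) \<Longrightarrow> h \<in> carrier (deck X) \<Longrightarrow> \<theta> (g \<otimes>\<^bsub>deck X\<^esub> h) = \<theta> g ** \<theta> h"
    and act: "\<And>g \<tau>. g \<in> carrier (deck X) \<Longrightarrow> \<tau> \<in> upper_half \<Longrightarrow>
      deck_act X g \<tau> \<in> upper_half \<and> \<psi> (deck_act X g \<tau>) = moebius (\<theta> g) (\<psi> \<tau>)"
  obtains f where "orbifold_iso X (leaf_orbifold \<alpha> a) f"
    "\<And>\<tau>. \<tau> \<in> upper_half \<Longrightarrow> f (quot_map X \<tau>) = moduli_proj (leaf_point x (moebius B (\<psi> \<tau>)))"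
proof -
  let ?Y = "leaf_orbifold \<alpha> a"
  define \<phi> where "\<phi> \<tau> = leaf_point x (moebius B (\<psi> \<tau>))" for \<tau>
  define conj where "conj A = B ** A ** adj2 B" for A
  define \<Theta> where "\<Theta> g = stabilizer_lift x (conj (\<theta> g))" for g
  have conj_mult: "conj (A ** A') = conj A ** conj A'" for A A'
  proof -
    have "conj A ** conj A' = B ** A ** (adj2 B ** B) ** A' ** adj2 B"
      by (simp add: conj_def matrix_mul_assoc)
    thus ?thesis by (simp add: adj2_mult[OF B] conj_def matrix_mul_assoc)
  qed
  have conj_inv: "adj2 B ** conj A ** B = A" "conj (adj2 B ** A ** B) = A" for A
  proof -
    have "adj2 B ** conj A ** B = (adj2 B ** B) ** A ** (adj2 B ** B)"
      by (simp add: conj_def matrix_mul_assoc)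
    thus "adj2 B ** conj A ** B = A" by (simp add: adj2_mult[OF B])
    have "conj (adj2 B ** A ** B) = (B ** adj2 B) ** A ** (B ** adj2 B)"
      by (simp add: conj_def matrix_mul_assoc)
    thus "conj (adj2 B ** A ** B) = A" by (simp add: adj2_mult[OF B])
  qed
  have \<theta>s: "row_stabilizes (row_act B x) (\<theta> g)" if "g \<in> carrier (deck X)" for g
    using \<theta>(1) that by (auto simp: bij_betw_def)
  have \<theta>SL: "\<theta> g \<in> carrier SL2Z" if "g \<in> carrier (deck X)" for g
    using \<theta>s[OF that] by (simp add: row_stabilizes_def)
  have cs: "row_stabilizes x (conj (\<theta> g))" if "g \<in> carrier (deck X)" for g
    unfolding conj_def by (rule row_stabilizes_conj[OF B \<theta>s[OF that]])
  have \<phi>_leaf: "\<phi> \<tau> \<in> leaf \<alpha> a" if "\<tau> \<in> upper_half" for \<tau>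
    using \<psi>(3)[OF that] moebius_in_upper_half[OF B] by (auto simp: \<phi>_def leaf)
  define \<phi>' where "\<phi>' p = \<psi>' (moebius (adj2 B) (fst p))" for p :: "complex \<times> complex"
  have \<phi>': "\<phi>' (\<phi> \<tau>) = \<tau>" if "\<tau> \<in> upper_half" for \<tau>
    using \<psi>(3)[OF that] moebius_adj2(2)[OF B] by (simp add: \<phi>_def \<phi>'_def leaf_point_def)
  have \<phi>'_upper: "\<phi>' p \<in> upper_half \<and> \<phi> (\<phi>' p) = p" if p: "p \<in> leaf \<alpha> a" for p
  proof -
    obtain \<tau> where \<tau>: "\<tau> \<in> upper_half" "p = leaf_point x \<tau>" using p by (auto simp: leaf)
    have "moebius (adj2 B) \<tau> \<in> upper_half" using moebius_in_upper_half[OF adj2_in_SL2Z[OF B] \<tau>(1)] .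
    from \<psi>(3)[OF this] show ?thesis
      using moebius_adj2(1)[OF B \<tau>(1)] by (simp add: \<phi>_def \<phi>'_def \<tau>(2) leaf_point_def)
  qed
  have bij: "bij_betw \<phi> upper_half (leaf \<alpha> a)"
    by (rule bij_betwI[of _ _ _ \<phi>']) (use \<phi>_leaf \<phi>' \<phi>'_upper in auto)
  have fst_leaf: "fst ` leaf \<alpha> a = upper_half" by (force simp: leaf leaf_point_def image_image)
  have inj_fst: "inj_on fst (leaf \<alpha> a)" by (auto simp: inj_on_def leaf leaf_point_def)
  have bihol: "biholomorphism X ?Y \<phi>"
    unfolding biholomorphism_def
  proof (intro conjI)
    show "bij_betw \<phi> (cover X) (cover ?Y)" using bij by (simp add: X leaf_orbifold_def)
    have "(\<lambda>w. moebius B (\<psi> w)) holomorphic_on upper_half"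
      using holomorphic_on_compose_gen[OF \<psi>(1) holomorphic_moebius[OF B]] \<psi>(3) by (auto simp: o_def)
    moreover have "inv_into upper_half (\<lambda>\<tau>. \<tau>) w = w" if "w \<in> upper_half" for w
      using that by (intro inv_into_f_eq) (auto simp: inj_on_def)
    ultimately show "(\<lambda>w. chart ?Y (\<phi> (inv_into (cover X) (chart X) w))) holomorphic_on chart X ` cover X"
      by (auto simp: X leaf_orbifold_def \<phi>_def leaf_point_def intro: holomorphic_transform)
    have "(\<lambda>w. \<psi>' (moebius (adj2 B) w)) holomorphic_on upper_half"
      using holomorphic_on_compose_gen[OF holomorphic_moebius[OF adj2_in_SL2Z[OF B]] \<psi>(2)]
        moebius_in_upper_half[OF adj2_in_SL2Z[OF B]] by (auto simp: o_def)
    moreover have "inv_into upper_half \<phi> (inv_into (leaf \<alpha> a) fst w) = \<psi>' (moebius (adj2 B) w)"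
      if w: "w \<in> upper_half" for w
    proof -
      have "inv_into (leaf \<alpha> a) fst w = leaf_point x w"
        by (rule inv_into_f_eq[OF inj_fst]) (use w in \<open>auto simp: leaf leaf_point_def\<close>)
      moreover have "inv_into upper_half \<phi> (leaf_point x w) = \<phi>' (leaf_point x w)"
        using \<phi>'_upper[of "leaf_point x w"] w bij
        by (intro inv_into_f_eq) (auto simp: leaf bij_betw_def)
      ultimately show ?thesis by (simp add: \<phi>'_def leaf_point_def)
    qed
    ultimately show "(\<lambda>w. chart X (inv_into (cover X) \<phi> (inv_into (cover ?Y) (chart ?Y) w)))
        holomorphic_on chart ?Y ` cover ?Y"
      by (auto simp: X leaf_orbifold_def fst_leaf intro: holomorphic_transform)
  qed
  have iso: "\<Theta> \<in> iso (deck X) (deck ?Y)"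
  proof (rule isoI)
    show "\<Theta> \<in> hom (deck X) (deck ?Y)"
    proof (rule homI)
      fix g assume "g \<in> carrier (deck X)"
      thus "\<Theta> g \<in> carrier (deck ?Y)"
        using stabilizer_lift_in_stabilizer[OF cs] by (simp add: \<Theta>_def leaf_orbifold_def)
    next
      fix g h assume gh: "g \<in> carrier (deck X)" "h \<in> carrier (deck X)"
      show "\<Theta> (g \<otimes>\<^bsub>deck X\<^esub> h) = \<Theta> g \<otimes>\<^bsub>deck ?Y\<^esub> \<Theta> h"
        using stabilizer_lift_mult[OF cs[OF gh(1)] cs[OF gh(2)]]
        by (simp add: \<Theta>_def \<theta>(2)[OF gh] conj_mult leaf_orbifold_def)
    qed
    have inj: "inj_on \<Theta> (carrier (deck X))"
    proof (rule inj_onI)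
      fix g h assume gh: "g \<in> carrier (deck X)" "h \<in> carrier (deck X)" "\<Theta> g = \<Theta> h"
      hence "conj (\<theta> g) = conj (\<theta> h)" by (simp add: \<Theta>_def stabilizer_lift_def)
      hence "\<theta> g = \<theta> h" using conj_inv(1) by metis
      thus "g = h" using \<theta>(1) gh by (auto simp: bij_betw_def inj_on_def)
    qed
    have "\<Theta> ` carrier (deck X) = carrier (leaf_stabilizer \<alpha> a)"
    proof (intro equalityI subsetI)
      fix s assume "s \<in> \<Theta> ` carrier (deck X)"
      thus "s \<in> carrier (leaf_stabilizer \<alpha> a)"
        using stabilizer_lift_in_stabilizer[OF cs] by (auto simp: \<Theta>_def)
    next
      fix s assume "s \<in> carrier (leaf_stabilizer \<alpha> a)"
      from stabilizer_eq_lift[OF this] have s: "row_stabilizes x (fst s)" "s = stabilizer_lift x (fst s)" by auto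
      define A where "A = adj2 B ** fst s ** B"
      have cA: "conj A = fst s" by (simp add: A_def conj_inv)
      hence "row_stabilizes x (B ** A ** adj2 B)" using s(1) by (simp add: conj_def)
      hence "row_stabilizes (row_act B x) A" by (rule row_stabilizes_conj_iff[OF B, THEN iffD1])
      then obtain g where g: "g \<in> carrier (deck X)" "A = \<theta> g" using \<theta>(1) by (auto simp: bij_betw_def)
      have "s = \<Theta> g" using s(2) by (simp add: \<Theta>_def g(2)[symmetric] cA)
      thus "s \<in> \<Theta> ` carrier (deck X)" using g(1) by blast
    qed
    thus "bij_betw \<Theta> (carrier (deck X)) (carrier (deck ?Y))"
      using inj by (simp add: bij_betw_def leaf_orbifold_def)
  qed
  have equiv: "deck_act X g \<tau> \<in> cover X \<and> \<phi> (deck_act X g \<tau>) = deck_act ?Y (\<Theta> g) (\<phi> \<tau>)"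
    if g: "g \<in> carrier (deck X)" and \<tau>: "\<tau> \<in> cover X" for g \<tau>
  proof -
    have \<tau>': "\<tau> \<in> upper_half" using \<tau> by (simp add: X)
    have \<psi>\<tau>: "\<psi> \<tau> \<in> upper_half" using \<psi>(3)[OF \<tau>'] by blast
    have B\<psi>: "moebius B (\<psi> \<tau>) \<in> upper_half" by (rule moebius_in_upper_half[OF B \<psi>\<tau>])
    obtain k l where kl: "\<Theta> g = (conj (\<theta> g), (k, l))" by (simp add: \<Theta>_def stabilizer_lift_def)
    have "(conj (\<theta> g), (k, l)) \<in> carrier (leaf_stabilizer \<alpha> a)"
      using stabilizer_lift_in_stabilizer[OF cs[OF g]] kl by (simp add: \<Theta>_def)
    hence st: "conj (\<theta> g) \<in> carrier SL2Z" "row_act (conj (\<theta> g)) x = x + (of_int l, of_int k)"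
      using carrier_leaf_stabilizer by blast+
    have "tor_act (\<Theta> g) (\<phi> \<tau>) = leaf_point x (moebius (conj (\<theta> g)) (moebius B (\<psi> \<tau>)))"
      unfolding kl \<phi>_def by (rule tor_act_leaf_point[OF st(1) B\<psi> st(2)])
    also have "moebius (conj (\<theta> g)) (moebius B (\<psi> \<tau>)) = moebius (conj (\<theta> g) ** B) (\<psi> \<tau>)"
      by (rule moebius_mult[OF st(1) B \<psi>\<tau>, symmetric])
    also have "conj (\<theta> g) ** B = B ** \<theta> g ** (adj2 B ** B)" by (simp add: conj_def matrix_mul_assoc)
    also have "\<dots> = B ** \<theta> g" by (simp add: adj2_mult[OF B])
    also have "moebius (B ** \<theta> g) (\<psi> \<tau>) = moebius B (\<psi> (deck_act X g \<tau>))"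
      using act[OF g \<tau>'] moebius_mult[OF B \<theta>SL[OF g] \<psi>\<tau>] by simp
    finally show ?thesis using act[OF g \<tau>'] by (simp add: \<phi>_def leaf_orbifold_def X)
  qed
  obtain f where f: "orbifold_iso X ?Y f"
    "\<And>\<tau>. \<tau> \<in> cover X \<Longrightarrow> f (quot_map X \<tau>) = quot_map ?Y (\<phi> \<tau>)"
    using orbifold_isoI[OF X(1) orbit_quotient_leaf_orbifold bihol iso] equiv by blast
  show ?thesis
    by (rule that[OF f(1)]) (use f(2) in \<open>simp add: X leaf_orbifold_def \<phi>_def\<close>)
qed

end

section \<open>The three types of leaves\<close>

text \<open>The group laws are asked through their effect on the half plane, with the product as a
  parameter \<open>m\<close>, so that translations by integers and matrices are covered
  alike.\<close>

lemma orbit_quotient_half_plane_quotient: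
  assumes one: "e \<in> carrier G" "\<And>\<tau>. \<tau> \<in> upper_half \<Longrightarrow> act e \<tau> = \<tau>"
    and mult: "\<And>g h. g \<in> carrier G \<Longrightarrow> h \<in> carrier G \<Longrightarrow>
      m g h \<in> carrier G \<and> (\<forall>\<tau>\<in>upper_half. act (m g h) \<tau> = act g (act h \<tau>))"
    and inv: "\<And>g. g \<in> carrier G \<Longrightarrow> \<exists>h\<in>carrier G. \<forall>\<tau>\<in>upper_half. act h (act g \<tau>) = \<tau>"
    and closed: "\<And>g \<tau>. g \<in> carrier G \<Longrightarrow> \<tau> \<in> upper_half \<Longrightarrow> act g \<tau> \<in> upper_half"
  shows "orbit_quotient (half_plane_quotient G act)"
  unfolding orbit_quotient_def
proof (intro ballI iffI)
  let ?X = "half_plane_quotient G act"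
  fix x y assume "x \<in> cover ?X" "y \<in> cover ?X"
  hence xy: "x \<in> upper_half" "y \<in> upper_half" by (simp_all add: half_plane_quotient_def)
  {
    assume "quot_map ?X x = quot_map ?X y"
    hence "(\<lambda>g. act g x) ` carrier G = (\<lambda>g. act g y) ` carrier G" by (simp add: half_plane_quotient_def)
    moreover have "y \<in> (\<lambda>g. act g y) ` carrier G" using one xy(2) by (metis imageI)
    ultimately have "y \<in> (\<lambda>g. act g x) ` carrier G" by simp
    thus "\<exists>g\<in>carrier (deck ?X). deck_act ?X g x = y" by (auto simp: half_plane_quotient_def)
  next
    assume "\<exists>g\<in>carrier (deck ?X). deck_act ?X g x = y"
    then obtain g where g: "g \<in> carrier G" "act g x = y" by (auto simp: half_plane_quotient_def)
    obtain h where h: "h \<in> carrier G" "act h y = x" using inv[OF g(1)] g(2) xy(1) by blast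
    have sub: "(\<lambda>g. act g v) ` carrier G \<subseteq> (\<lambda>g. act g w) ` carrier G"
      if v: "w \<in> upper_half" "k \<in> carrier G" "act k w = v" for v w k
    proof
      fix p assume "p \<in> (\<lambda>g. act g v) ` carrier G"
      then obtain l where l: "l \<in> carrier G" "p = act l v" by blast
      hence "p = act (m l k) w" using mult[OF l(1) v(2)] v by auto
      thus "p \<in> (\<lambda>g. act g w) ` carrier G" using mult[OF l(1) v(2)] by blast
    qed
    have "(\<lambda>g. act g x) ` carrier G = (\<lambda>g. act g y) ` carrier G"
      using sub[OF xy(1) g] sub[OF xy(2) h] by blast
    thus "quot_map ?X x = quot_map ?X y" by (simp add: half_plane_quotient_def)
  }
qed

lemma orbit_quotient_trivial_quotient: "orbit_quotient (trivial_quotient S c)"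
  by (simp add: orbit_quotient_def trivial_quotient_def singleton_group_def)

lemma orbit_quotient_infinite_cylinder: "orbit_quotient infinite_cylinder"
  unfolding infinite_cylinder_def
proof (rule orbit_quotient_half_plane_quotient[of 0 _ _ "(+)"])
  fix g :: int
  show "\<exists>h\<in>carrier integer_group. \<forall>\<tau>\<in>upper_half. \<tau> + of_int g + of_int h = (\<tau> :: complex)"
    by (rule bexI[of _ "-g"]) (auto simp: integer_group_def)
qed (auto simp: integer_group_def upper_half_def)

lemma carrier_Gamma1: "A \<in> carrier (Gamma1 N) \<longleftrightarrow> A \<in> carrier SL2Z \<and>
    [A$1$1 = 1] (mod int N) \<and> [A$2$2 = 1] (mod int N) \<and> [A$2$1 = 0] (mod int N)"
  by (simp add: Gamma1_def)

text \<open>The congruence on the upper left entry is implied by the other two and the determinant.\<close>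

lemma row_stabilizes_torsion:
  assumes N: "N > 0" and x: "x - (0, 1 / real N) \<in> int_pairs"
  shows "row_stabilizes x A \<longleftrightarrow> A \<in> carrier (Gamma1 N)"
proof -
  have ints: "real_of_int c / real N \<in> \<int> \<longleftrightarrow> int N dvd c" for c
  proof
    assume "real_of_int c / real N \<in> \<int>"
    then obtain k :: int where "real_of_int c / real N = of_int k" by (auto elim: Ints_cases)
    hence "real_of_int c = of_int (k * int N)" using N by (simp add: field_simps)
    hence "c = k * int N" by (simp only: of_int_eq_iff)
    thus "int N dvd c" by simp
  next
    assume "int N dvd c"
    then obtain k where "c = int N * k" by blast
    thus "real_of_int c / real N \<in> \<int>" using N by simp
  qed
  define y where "y = (0 :: real, 1 / real N)"
  have "row_act A x - x = (row_act A y - y) + (row_act A (x - y) - (x - y))"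
    by (simp add: row_act_diff)
  moreover have "row_act A (x - y) - (x - y) \<in> int_pairs"
    using x by (auto simp: y_def intro: int_pairs_diff row_act_int_pairs)
  ultimately have "row_act A x - x \<in> int_pairs \<longleftrightarrow> row_act A y - y \<in> int_pairs"
    using int_pairs_add int_pairs_diff by (metis add_diff_cancel_right')
  also have "row_act A y - y = (of_int (A$2$1) / real N, of_int (A$2$2 - 1) / real N)"
    by (simp add: row_act_def y_def diff_divide_distrib)
  also have "\<dots> \<in> int_pairs \<longleftrightarrow> int N dvd A$2$1 \<and> int N dvd A$2$2 - 1"
    using ints[of "A$2$1"] ints[of "A$2$2 - 1"] by (simp add: int_pairs_def)
  finally have 1: "row_stabilizes x A \<longleftrightarrow> A \<in> carrier SL2Z \<and> int N dvd A$2$1 \<and> int N dvd A$2$2 - 1"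
    by (simp add: row_stabilizes_def)
  have "int N dvd A$1$1 - 1" if A: "A \<in> carrier SL2Z" "int N dvd A$2$1" "int N dvd A$2$2 - 1"
  proof -
    have "A$1$1 - 1 = A$1$2 * A$2$1 - A$1$1 * (A$2$2 - 1)"
      using A(1) by (simp add: carrier_SL2Z algebra_simps)
    thus ?thesis using A(2,3) by simp
  qed
  thus ?thesis unfolding 1 carrier_Gamma1 by (auto simp: cong_iff_dvd_diff)
qed

lemma row_stabilizes_mult:
  assumes "row_stabilizes x A" "row_stabilizes x B"
  shows "row_stabilizes x (A ** B)"
proof -
  have *: "row_act (A ** B) x - x = row_act B (row_act A x - x) + (row_act B x - x)"
    by (simp add: row_act_mult row_act_diff)
  show ?thesis using assms unfolding row_stabilizes_def *
    by (intro conjI SL2Z_mult_closed int_pairs_add row_act_int_pairs) auto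
qed

lemma row_stabilizes_adj2:
  assumes "row_stabilizes x A"
  shows "row_stabilizes x (adj2 A)"
proof -
  have A: "A \<in> carrier SL2Z" using assms by (simp add: row_stabilizes_def)
  have "row_act (adj2 A) x - x = 0 - row_act (adj2 A) (row_act A x - x)"
    by (simp add: row_act_diff row_act_adj2[OF A])
  moreover have "0 \<in> int_pairs" by (simp add: int_pairs_def)
  ultimately show ?thesis using assms
    by (simp only: row_stabilizes_def adj2_in_SL2Z) (blast intro: int_pairs_diff row_act_int_pairs)
qed

lemma row_stabilizes_1: "row_stabilizes x (mat 1)"
  by (simp add: row_stabilizes_def mat_1_in_SL2Z int_pairs_def)

text \<open>Closure of \<Gamma>_1(N) under products and inverses is inherited from its description
  as the row stabilizer of (0, 1/N), in place of a computation with congruences.\<close>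

lemma orbit_quotient_Y1:
  assumes "N > 0"
  shows "orbit_quotient (Y1 N)"
  unfolding Y1_def
proof (rule orbit_quotient_half_plane_quotient[of "mat 1" _ _ "(**)"])
  have x: "(0, 1 / real N) - (0, 1 / real N) \<in> int_pairs" by (simp add: int_pairs_def)
  note st = row_stabilizes_torsion[OF assms x, symmetric]
  show "mat 1 \<in> carrier (Gamma1 N)" by (simp add: st row_stabilizes_1)
  fix g assume g: "g \<in> carrier (Gamma1 N)"
  have gSL: "g \<in> carrier SL2Z" using g by (simp add: carrier_Gamma1)
  show "moebius g \<tau> \<in> upper_half" if "\<tau> \<in> upper_half" for \<tau>
    using moebius_in_upper_half[OF gSL that] .
  show "\<exists>h\<in>carrier (Gamma1 N). \<forall>\<tau>\<in>upper_half. moebius h (moebius g \<tau>) = \<tau>"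
    using g moebius_adj2(2)[OF gSL] by (intro bexI[of _ "adj2 g"]) (auto simp: st row_stabilizes_adj2)
  fix h assume h: "h \<in> carrier (Gamma1 N)"
  have hSL: "h \<in> carrier SL2Z" using h by (simp add: carrier_Gamma1)
  show "g ** h \<in> carrier (Gamma1 N) \<and> (\<forall>\<tau>\<in>upper_half. moebius (g ** h) \<tau> = moebius g (moebius h \<tau>))"
    using g h moebius_mult[OF gSL hSL] by (simp add: st row_stabilizes_mult)
qed simp

section \<open>Normal forms of coordinates under the modular group\<close>

lemma SL2Z_first_column:
  assumes "coprime m (n :: int)"
  obtains B where "B \<in> carrier SL2Z" "B$1$1 = m" "B$2$1 = n"
proof -
  obtain u v where "u * m + v * n = 1" using bezout_int[of m n] assms by (auto simp: coprime_iff_gcd_eq_1)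
  hence "mat2 m (-v) n u \<in> carrier SL2Z" by (simp add: carrier_SL2Z algebra_simps)
  thus ?thesis using that by simp
qed

lemma coprime_multiple:
  assumes "(c, d) \<noteq> (0, 0 :: int)"
  obtains g m n where "g > 0" "c = g * m" "d = g * n" "coprime m n"
proof
  let ?g = "gcd c d"
  show "?g > 0" using assms by auto
  show "c = ?g * (c div ?g)" "d = ?g * (d div ?g)" by simp_all
  show "coprime (c div ?g) (d div ?g)" using assms by (intro div_gcd_coprime) auto
qed

definition exact_order :: "nat \<Rightarrow> real \<times> real \<Rightarrow> bool" where
  "exact_order N x \<longleftrightarrow> real N *\<^sub>R x \<in> int_pairs \<and> (\<forall>n. 0 < n \<and> n < N \<longrightarrow> real n *\<^sub>R x \<notin> int_pairs)"

text \<open>Transitivity of the modular group on the vectors of exact order N modulo integer pairs: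
  Euclid removes the first coordinate, and exactness makes the remaining numerator invertible modulo
  N.\<close>

lemma exact_order_normal_form:
  assumes N: "N \<ge> 2" and x: "exact_order N x"
  obtains B where "B \<in> carrier SL2Z" "row_act B x - (0, 1 / real N) \<in> int_pairs"
proof -
  obtain c d :: int where cd: "real N *\<^sub>R x = (of_int c, of_int d)"
    using x by (auto simp: exact_order_def elim!: int_pairsE)
  have xcd: "x = (of_int c / real N, of_int d / real N)"
    using cd N by (auto simp: prod_eq_iff field_simps)
  have "(c, d) \<noteq> (0, 0)"
  proof
    assume "(c, d) = (0, 0)"
    hence "real 1 *\<^sub>R x \<in> int_pairs" by (simp add: xcd int_pairs_def)
    thus False using x N by (auto simp: exact_order_def)
  qed
  then obtain g m n where g: "g > 0" "c = g * m" "d = g * n" "coprime m n" by (rule coprime_multiple)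
  \<comment> \<open>If h divides both g and N, then N/h already carries x into the integer pairs, so
    exactness gives h = 1.\<close>
  have "coprime g (int N)"
  proof -
    define h where "h = nat (gcd g (int N))"
    have h: "int h = gcd g (int N)" "h > 0" using N by (auto simp: h_def)
    obtain N' where N': "N = h * N'" 
      using h(1) by (metis dvdE gcd_dvd2 int_dvd_int_iff)
    obtain g' where g': "g = int h * g'" using h(1) by (metis dvdE gcd_dvd1)
    have "N' > 0" using N N' by (cases N') auto
    have "real N' *\<^sub>R x = (of_int (g' * m), of_int (g' * n))"
      using h(2) \<open>N' > 0\<close> by (simp add: xcd g N' g' field_simps)
    hence "real N' *\<^sub>R x \<in> int_pairs" by (metis int_pairsI)
    hence "\<not> N' < N" using x \<open>N' > 0\<close> by (auto simp: exact_order_def)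
    hence "h = 1" using N' \<open>N' > 0\<close> h(2) by (cases "h = 1") auto
    thus ?thesis using h(1) by (simp add: coprime_iff_gcd_eq_1)
  qed
  then obtain s t where st: "s * g + t * int N = 1" using bezout_int[of g "int N"] by (auto simp: coprime_iff_gcd_eq_1)
  have "coprime s (int N)"
    using st by (metis coprime_iff_invertible_int cong_iff_lin mult.commute add.commute coprimeI dvd_add dvd_mult dvd_mult2)
  then obtain p q where pq: "p * s + q * int N = 1" using bezout_int[of s "int N"] by (auto simp: coprime_iff_gcd_eq_1)
  obtain u v where uv: "u * m + v * n = 1" using bezout_int[of m n] g(4) by (auto simp: coprime_iff_gcd_eq_1)
  \<comment> \<open>\<open>B1\<close> kills the first coordinate and leaves g/N in the second.
    \<open>B2\<close> has lower row (N, s) and sends (0, g/N) to (g, g s/N), where g s is 1 modulo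
    N.\<close>
  define B1 where "B1 = mat2 n u (-m) v"
  define B2 where "B2 = mat2 p (-q) (int N) s"
  have B: "B1 \<in> carrier SL2Z" "B2 \<in> carrier SL2Z"
    using uv pq by (simp_all add: carrier_SL2Z B1_def B2_def algebra_simps)
  have "real_of_int g * of_int m * of_int u + real_of_int g * of_int n * of_int v = of_int (g * (u * m + v * n))"
    by (simp add: algebra_simps)
  also have "\<dots> = of_int g" by (simp add: uv)
  finally have "row_act B1 x = (0, of_int g / real N)"
    using N by (simp add: row_act_def B1_def xcd g field_simps)
  hence "row_act (B1 ** B2) x = (of_int g, of_int (g * s) / real N)"
    using N by (simp add: row_act_mult) (simp add: row_act_def B2_def)
  also have "g * s = 1 - t * int N" using st by (simp add: algebra_simps)
  finally have "row_act (B1 ** B2) x - (0, 1 / real N) = (of_int g, of_int (-t))"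
    using N by (simp add: field_simps)
  hence "row_act (B1 ** B2) x - (0, 1 / real N) \<in> int_pairs" by (metis int_pairsI)
  thus ?thesis using that SL2Z_mult_closed[OF B] by blast
qed

lemma exact_torsion_leaf_point:
  assumes "\<tau> \<in> upper_half"
  shows "exact_torsion N (leaf_point x \<tau>) \<longleftrightarrow> exact_order N x"
proof -
  have "of_nat n * snd (leaf_point x \<tau>) \<in> period_lattice \<tau> \<longleftrightarrow> real n *\<^sub>R x \<in> int_pairs" for n
    using period_lattice_coordinates[OF assms, of "real n * snd x" "real n * fst x"]
    by (simp add: leaf_point_def int_pairs_def algebra_simps conj_commute)
  thus ?thesis by (simp add: exact_torsion_def exact_order_def leaf_point_def)
qed

lemma exact_order_row_act:
  assumes "A \<in> carrier SL2Z" "row_act A y - x \<in> int_pairs"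
  shows "exact_order N x \<longleftrightarrow> exact_order N y"
proof -
  have "real n *\<^sub>R x \<in> int_pairs \<longleftrightarrow> real n *\<^sub>R y \<in> int_pairs" for n
  proof -
    have "real n *\<^sub>R (row_act A y - x) \<in> int_pairs"
      using assms(2) by (auto simp: int_pairs_def)
    moreover have "real n *\<^sub>R x = row_act A (real n *\<^sub>R y) - real n *\<^sub>R (row_act A y - x)"
      "row_act A (real n *\<^sub>R y) = real n *\<^sub>R x + real n *\<^sub>R (row_act A y - x)"
      by (simp_all add: row_act_scaleR scaleR_diff_right)
    ultimately show ?thesis using row_act_int_pairs_iff[OF assms(1), of "real n *\<^sub>R y"]
        int_pairs_add int_pairs_diff by metis
  qed
  thus ?thesis by (simp add: exact_order_def)
qed

lemma exact_order_torsion: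
  assumes N: "N > 0"
  shows "exact_order N (0, 1 / real N)"
proof -
  have "real n * (1 / real N) \<notin> \<int>" if n: "0 < n" "n < N" for n
  proof
    assume "real n * (1 / real N) \<in> \<int>"
    then obtain k :: int where k: "real n / real N = of_int k" by (auto elim: Ints_cases)
    have "0 < real n / real N" "real n / real N < 1" using n by auto
    hence "0 < k" "k < 1" unfolding k by simp_all
    thus False by simp
  qed
  thus ?thesis using N by (simp add: exact_order_def int_pairs_def)
qed

lemma moduli_proj_leaf_point_torsion:
  assumes N: "N > 0" and B: "B \<in> carrier SL2Z" and x: "row_act B x - (0, 1 / real N) \<in> int_pairs"
    and \<tau>: "\<tau> \<in> upper_half"
  shows "moduli_proj (leaf_point x (moebius B \<tau>)) = moduli_proj (\<tau>, 1 / of_nat N)"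
proof -
  let ?y = "(0 :: real, 1 / real N)"
  have "row_act (adj2 B) (row_act B x - ?y) \<in> int_pairs" using x by (rule row_act_int_pairs)
  hence "x - row_act (adj2 B) ?y \<in> int_pairs" by (simp add: row_act_diff row_act_adj2[OF B])
  then obtain l k :: int where lk: "x - row_act (adj2 B) ?y = (of_int l, of_int k)" by (rule int_pairsE)
  have "row_act (adj2 B) ?y = x - (of_int l, of_int k)" unfolding lk[symmetric] by simp
  hence "row_act (adj2 B) ?y = x + (of_int (-l), of_int (-k))" by (simp add: prod_eq_iff)
  from tor_act_leaf_point[OF adj2_in_SL2Z[OF B] moebius_in_upper_half[OF B \<tau>] this]
  have "tor_act (adj2 B, (-k, -l)) (leaf_point x (moebius B \<tau>)) = leaf_point ?y \<tau>"
    using moebius_adj2(2)[OF B \<tau>] by simp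
  also have "leaf_point ?y \<tau> = (\<tau>, 1 / of_nat N)" by (simp add: leaf_point_def)
  finally have "tor_act (adj2 B, (-k, -l)) (leaf_point x (moebius B \<tau>)) = (\<tau>, 1 / of_nat N)" .
  moreover have "(adj2 B, (-k, -l)) \<in> carrier affine_SL2Z"
    using adj2_in_SL2Z[OF B] by (simp add: carrier_affine_SL2Z)
  ultimately show ?thesis
    using moduli_proj_eq_iff[of "leaf_point x (moebius B \<tau>)"] moebius_in_upper_half[OF B \<tau>]
    by (force simp: leaf_point_def)
qed

text \<open>By transitivity all points of exact order N lie over one curve, so the image of a single
  leaf is the whole locus that the division polynomials cut out.\<close>

lemma moduli_proj_torsion_iff:
  assumes N: "N \<ge> 2" and p: "p \<in> Tor12"
  shows "moduli_proj p \<in> (\<lambda>\<tau>. moduli_proj (\<tau>, 1 / of_nat N)) ` upper_half \<longleftrightarrow> exact_torsion N p"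
proof
  let ?y = "(0 :: real, 1 / real N)"
  obtain x where x: "fst p \<in> upper_half" "p = leaf_point x (fst p)" using Tor12_leaf_point[OF p] by metis
  {
    assume "moduli_proj p \<in> (\<lambda>\<tau>. moduli_proj (\<tau>, 1 / of_nat N)) ` upper_half"
    then obtain \<tau> where \<tau>: "\<tau> \<in> upper_half" "moduli_proj (\<tau>, 1 / of_nat N) = moduli_proj p" by auto
    have "(\<tau>, 1 / of_nat N) = leaf_point ?y \<tau>" by (simp add: leaf_point_def)
    hence "moduli_proj (leaf_point ?y \<tau>) = moduli_proj p" using \<tau>(2) by simp
    then obtain g where g: "g \<in> carrier affine_SL2Z" "tor_act g (leaf_point ?y \<tau>) = p"
      using moduli_proj_eq_iff[of "leaf_point ?y \<tau>" p] \<tau>(1) by (auto simp: leaf_point_def)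
    obtain A k l where A: "g = (A, (k, l))" by (metis prod.exhaust_sel)
    have ASL: "A \<in> carrier SL2Z" using g(1) by (simp add: A carrier_affine_SL2Z)
    have "row_act A x = ?y + (of_int l, of_int k)"
      using g(2) x(2) tor_act_leaf_point_eq_iff[OF ASL \<tau>(1), of k l ?y x "fst p"] A by metis
    hence rx: "row_act A x - ?y \<in> int_pairs" by (metis add_diff_cancel_left' int_pairsI)
    have "exact_order N x" using exact_order_row_act[OF ASL rx, of N] exact_order_torsion[of N] N by simp
    thus "exact_torsion N p" using exact_torsion_leaf_point[OF x(1), of N x] x(2) by simp
  next
    assume "exact_torsion N p"
    hence "exact_order N x" using exact_torsion_leaf_point[OF x(1), of N x] x(2) by simp
    then obtain B where B: "B \<in> carrier SL2Z" "row_act B x - ?y \<in> int_pairs"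
      by (rule exact_order_normal_form[OF N])
    define \<tau> where "\<tau> = moebius (adj2 B) (fst p)"
    have \<tau>: "\<tau> \<in> upper_half" unfolding \<tau>_def by (rule moebius_in_upper_half[OF adj2_in_SL2Z[OF B(1)] x(1)])
    have "moduli_proj (leaf_point x (moebius B \<tau>)) = moduli_proj (\<tau>, 1 / of_nat N)"
      by (rule moduli_proj_leaf_point_torsion[OF _ B \<tau>]) (use N in simp)
    moreover have "moebius B \<tau> = fst p" unfolding \<tau>_def by (rule moebius_adj2(1)[OF B(1) x(1)])
    ultimately show "moduli_proj p \<in> (\<lambda>\<tau>. moduli_proj (\<tau>, 1 / of_nat N)) ` upper_half"
      using x(2) \<tau> by (metis imageI)
  }
qed

lemma closed_algebraic_torsion_curve:
  assumes N: "N \<ge> 2"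
  shows "closed_algebraic_subvariety ((\<lambda>\<tau>. moduli_proj (\<tau>, 1 / of_nat N)) ` upper_half)"
  unfolding closed_algebraic_subvariety_def
proof
  show "zariski_closed ((\<lambda>\<tau>. moduli_proj (\<tau>, 1 / of_nat N)) ` upper_half)"
    using Tor12_torsion[OF _ N] moduli_proj_torsion_iff[OF N]
    by (intro zariski_closed_torsion[OF N]) (auto simp: M12_def)
qed (rule zariski_irreducible_torsion_curve[OF N])

lemma Rats_nat_fraction:
  assumes "(x :: real) \<in> \<rat>"
  obtains e f where "f > 0" "coprime e (int f)" "x = of_int e / of_nat f"
proof -
  obtain e b where eb: "b > 0" "coprime e b" "x = of_int e / of_int b"
    using assms by (rule Rats_cases')
  have "int (nat b) = b" using eb(1) by simp
  moreover have "real (nat b) = of_int b" using eb(1) by simp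
  ultimately show ?thesis using that[of "nat b" e] eb by simp
qed

section \<open>The three possible quotients of a leaf\<close>

context veech_leaf
begin

lemma trivial_leaf:
  assumes triv: "\<And>A. row_stabilizes x A \<Longrightarrow> A = mat 1"
  shows "orbifold_iso (leaf_curve \<alpha> a) (leaf_orbifold \<alpha> a) moduli_proj"
    and "orbifold_isomorphic half_plane (leaf_orbifold \<alpha> a)"
proof -
  have st: "{A. row_stabilizes x A} = {mat 1}" using triv row_stabilizes_1[of x] by blast
  have one: "carrier (leaf_stabilizer \<alpha> a) = {(mat 1, (0, 0))}"
  proof (intro equalityI subsetI)
    fix g assume "g \<in> carrier (leaf_stabilizer \<alpha> a)"
    from stabilizer_eq_lift[OF this] have "fst g = mat 1" "g = stabilizer_lift x (fst g)"
      using triv by auto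
    thus "g \<in> {(mat 1, (0, 0))}" by (simp add: stabilizer_lift_def)
  next
    fix g :: "(int^2^2) \<times> (int \<times> int)" assume "g \<in> {(mat 1, (0, 0))}"
    thus "g \<in> carrier (leaf_stabilizer \<alpha> a)"
      using stabilizer_lift_in_stabilizer[OF row_stabilizes_1] by (simp add: stabilizer_lift_def)
  qed
  let ?X = "leaf_curve \<alpha> a" and ?Y = "leaf_orbifold \<alpha> a"
  have inj_fst: "inj_on fst (leaf \<alpha> a)" by (auto simp: inj_on_def leaf leaf_point_def)
  have inv: "inv_into (leaf \<alpha> a) (\<lambda>p. p) p = p" if "p \<in> leaf \<alpha> a" for p
    using that by (intro inv_into_f_eq) (auto simp: inj_on_def)
  have bihol: "biholomorphism ?X ?Y (\<lambda>p. p)"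
    unfolding biholomorphism_def
  proof (intro conjI)
    show "bij_betw (\<lambda>p. p) (cover ?X) (cover ?Y)"
      by (simp add: leaf_curve_def trivial_quotient_def leaf_orbifold_def bij_betw_def inj_on_def)
    show "(\<lambda>w. chart ?Y (inv_into (cover ?X) (chart ?X) w)) holomorphic_on chart ?X ` cover ?X"
      by (rule holomorphic_transform[of "\<lambda>w. w"])
         (auto simp: leaf_curve_def trivial_quotient_def leaf_orbifold_def f_inv_into_f[of _ fst])
    show "(\<lambda>w. chart ?X (inv_into (cover ?X) (\<lambda>p. p) (inv_into (cover ?Y) (chart ?Y) w)))
        holomorphic_on chart ?Y ` cover ?Y"
    proof (rule holomorphic_transform[of "\<lambda>w. w"])
      fix w assume "w \<in> chart ?Y ` cover ?Y"
      hence w: "w \<in> fst ` leaf \<alpha> a" by (simp add: leaf_orbifold_def)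
      have "inv_into (leaf \<alpha> a) (\<lambda>p. p) (inv_into (leaf \<alpha> a) fst w) = inv_into (leaf \<alpha> a) fst w"
        by (rule inv[OF inv_into_into[OF w]])
      thus "w = chart ?X (inv_into (cover ?X) (\<lambda>p. p) (inv_into (cover ?Y) (chart ?Y) w))"
        using f_inv_into_f[OF w] by (simp add: leaf_curve_def trivial_quotient_def leaf_orbifold_def)
    qed auto
  qed
  have iso: "(\<lambda>_. (mat 1, (0, 0))) \<in> iso (deck ?X) (deck ?Y)"
    using one affine_mult[of "mat 1" 0 0 "mat 1" 0 0]
    by (auto intro!: isoI homI simp: leaf_curve_def trivial_quotient_def leaf_orbifold_def singleton_group_def
        bij_betw_def leaf_stabilizer_def)
  have equiv: "deck_act ?X g p \<in> cover ?X \<and> deck_act ?X g p = deck_act ?Y (mat 1, (0, 0)) p"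
    if "p \<in> cover ?X" for g p
    using that tor_act_one[of p]
    by (simp add: leaf_curve_def trivial_quotient_def leaf_orbifold_def affine_one)
  have "orbit_quotient ?X" by (simp add: leaf_curve_def orbit_quotient_trivial_quotient)
  from orbifold_isoI[OF this orbit_quotient_leaf_orbifold bihol iso] equiv
  have "\<exists>f. orbifold_iso ?X ?Y f \<and> (\<forall>p\<in>cover ?X. f (quot_map ?X p) = quot_map ?Y p)" by blast
  then obtain f where f: "orbifold_iso ?X ?Y f"
    "\<And>p. p \<in> cover ?X \<Longrightarrow> f (quot_map ?X p) = quot_map ?Y p" by blast
  have fp: "f p = moduli_proj p" if "p \<in> leaf \<alpha> a" for p
    using f(2)[of p] that by (simp add: leaf_curve_def trivial_quotient_def leaf_orbifold_def)
  have pts: "points ?X = leaf \<alpha> a" by (simp add: points_def leaf_curve_def trivial_quotient_def)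
  \<comment> \<open>The descent lemma yields some \<open>f\<close>; on the points of
    \<open>leaf_curve\<close>, where the quotient map is the identity, it is
    \<open>moduli_proj\<close>.\<close>
  have "bij_betw moduli_proj (points ?X) (points ?Y)"
    using f(1) bij_betw_cong[of "points ?X" f moduli_proj "points ?Y"] fp
    by (simp add: orbifold_iso_def pts)
  thus "orbifold_iso ?X ?Y moduli_proj"
    using f(1) fp by (simp add: orbifold_iso_def leaf_curve_def trivial_quotient_def)
  have "bij_betw (\<lambda>_. mat 1) (carrier (deck half_plane)) {A. row_stabilizes (row_act (mat 1) x) A}"
    by (simp add: st half_plane_def trivial_quotient_def singleton_group_def bij_betw_def)
  note bij = this
  obtain f' where "orbifold_iso half_plane ?Y f'"
  proof (rule leaf_orbifold_uniformization[OF _ _ _ mat_1_in_SL2Z _ _ _ bij, of "\<lambda>\<tau>. \<tau>" "\<lambda>\<tau>. \<tau>"])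
    show "orbit_quotient half_plane" by (simp add: half_plane_def orbit_quotient_trivial_quotient)
  qed (auto simp: half_plane_def trivial_quotient_def)
  thus "orbifold_isomorphic half_plane ?Y" unfolding orbifold_isomorphic_def by blast
qed

text \<open>The change of basis makes the first coordinate a fraction e/f in lowest terms and the
  second irrational. Irrationality forces the lower row of a stabilizing matrix to be (0, 1), the
  determinant makes the upper left entry 1, and integrality makes f divide the upper right entry.
  The generator is thus the translation by f, which the scaling by f turns into the translation by
  1.\<close>

lemma parabolic_leaf:
  assumes mn: "coprime m n" "fst x * of_int m + snd x * of_int n \<in> \<rat>"
    and irr: "\<not> (fst x \<in> \<rat> \<and> snd x \<in> \<rat>)"
  shows "orbifold_isomorphic infinite_cylinder (leaf_orbifold \<alpha> a)"
proof -
  obtain B where B: "B \<in> carrier SL2Z" "B$1$1 = m" "B$2$1 = n" by (rule SL2Z_first_column[OF mn(1)])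
  define y where "y = row_act B x"
  have y1: "fst y \<in> \<rat>" using mn(2) by (simp add: y_def row_act_def B)
  have "x = row_act (adj2 B) y" by (simp add: y_def row_act_adj2[OF B(1)])
  \<comment> \<open>If both coordinates of \<open>y\<close> were rational, so would be those of
    \<open>x\<close>, its image under an integer matrix.\<close>
  hence y2: "snd y \<notin> \<rat>" using y1 irr by (auto simp: row_act_def)
  obtain e f where ef: "f > 0" "coprime e (int f)" "fst y = of_int e / of_nat f"
    using y1 by (rule Rats_nat_fraction)
  have int_iff: "of_int q * fst y \<in> \<int> \<longleftrightarrow> int f dvd q" for q
  proof
    assume "of_int q * fst y \<in> \<int>"
    then obtain k :: int where "of_int q * fst y = of_int k" by (auto elim: Ints_cases)
    hence "real_of_int (q * e) = of_int (k * int f)" using ef by (simp add: field_simps)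
    hence "q * e = k * int f" by (simp only: of_int_eq_iff)
    hence "int f dvd q * e" by simp
    thus "int f dvd q" using ef(2) by (simp add: coprime_dvd_mult_left_iff coprime_commute)
  next
    assume "int f dvd q"
    then obtain k where "q = int f * k" by blast
    hence "of_int q * fst y = of_int (k * e)" using ef by simp
    thus "of_int q * fst y \<in> \<int>" by simp
  qed
  have stab: "row_stabilizes y A \<longleftrightarrow> (\<exists>t. A = mat2 1 (int f * t) 0 1)" for A
  proof
    assume A: "row_stabilizes y A"
    have det: "A$1$1 * A$2$2 - A$1$2 * A$2$1 = 1" using A by (simp add: row_stabilizes_def carrier_SL2Z)
    have 1: "fst y * of_int (A$1$1) + snd y * of_int (A$2$1) - fst y \<in> \<rat>"
      and 2: "fst y * of_int (A$1$2) + snd y * of_int (A$2$2) - snd y \<in> \<int>"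
      using A Ints_subset_Rats by (auto simp: row_stabilizes_def row_act_def int_pairs_def)
    have coeff0: "c = 0" if "snd y * of_int c \<in> \<rat>" for c :: int
    proof (rule ccontr)
      assume "c \<noteq> 0"
      have "snd y * of_int c / of_int c \<in> \<rat>" using that by (intro Rats_divide) auto
      thus False using y2 \<open>c \<noteq> 0\<close> by simp
    qed
    have "snd y * of_int (A$2$1) = (fst y * of_int (A$1$1) + snd y * of_int (A$2$1) - fst y) - fst y * of_int (A$1$1) + fst y"
      by simp
    also have "\<dots> \<in> \<rat>"
      by (rule Rats_add[OF Rats_diff[OF 1 Rats_mult[OF y1 Rats_of_int]] y1])
    finally have r: "A$2$1 = 0" by (rule coeff0)
    have "snd y * of_int (A$2$2 - 1) = (fst y * of_int (A$1$2) + snd y * of_int (A$2$2) - snd y) - fst y * of_int (A$1$2)"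
      by (simp add: algebra_simps)
    also have "\<dots> \<in> \<rat>"
      by (rule Rats_diff[OF subsetD[OF Ints_subset_Rats 2] Rats_mult[OF y1 Rats_of_int]])
    finally have s: "A$2$2 = 1" using coeff0[of "A$2$2 - 1"] by simp
    have p: "A$1$1 = 1" using det r s by simp
    have "of_int (A$1$2) * fst y \<in> \<int>" using 2 s by (simp add: mult.commute)
    then obtain t where t: "A$1$2 = int f * t" using int_iff by blast
    have "A = mat2 1 (int f * t) 0 1" by (rule mat2_eqI) (simp_all add: p r s t)
    thus "\<exists>t. A = mat2 1 (int f * t) 0 1" by blast
  next
    assume "\<exists>t. A = mat2 1 (int f * t) 0 1"
    then obtain t where t: "A = mat2 1 (int f * t) 0 1" by blast
    have "of_int (int f * t) * fst y \<in> \<int>" by (rule int_iff[THEN iffD2]) simp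
    thus "row_stabilizes y A"
      by (simp add: t row_stabilizes_def carrier_SL2Z row_act_def int_pairs_def mult.commute)
  qed
  define \<theta> where "\<theta> t = mat2 1 (int f * t) 0 1" for t
  have bij: "bij_betw \<theta> (carrier integer_group) {A. row_stabilizes y A}"
    unfolding bij_betw_def
  proof
    show "inj_on \<theta> (carrier integer_group)"
    proof (rule inj_onI)
      fix s t assume "\<theta> s = \<theta> t"
      hence "int f * s = int f * t" unfolding \<theta>_def by (metis mat2_nth(2))
      thus "s = t" using ef(1) by simp
    qed
    show "\<theta> ` carrier integer_group = {A. row_stabilizes y A}"
      by (auto simp: stab \<theta>_def integer_group_def)
  qed
  have mult: "\<theta> (g \<otimes>\<^bsub>integer_group\<^esub> h) = \<theta> g ** \<theta> h" for g h
    by (rule mat2_eqI) (simp_all add: \<theta>_def integer_group_def matrix_mult_nth2 algebra_simps)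
  have up: "of_nat f * \<tau> \<in> upper_half" "\<tau> / of_nat f \<in> upper_half" if "\<tau> \<in> upper_half" for \<tau>
    using that ef(1) by (simp_all add: upper_half_def)
  have act: "\<tau> + of_int g \<in> upper_half \<and> of_nat f * (\<tau> + of_int g) = moebius (\<theta> g) (of_nat f * \<tau>)"
    if "\<tau> \<in> upper_half" for g \<tau>
    using that by (simp add: upper_half_def moebius_def \<theta>_def algebra_simps)
  obtain h where "orbifold_iso infinite_cylinder (leaf_orbifold \<alpha> a) h"
  proof (rule leaf_orbifold_uniformization[OF orbit_quotient_infinite_cylinder _ _ B(1),
        of "\<lambda>\<tau>. of_nat f * \<tau>" "\<lambda>\<tau>. \<tau> / of_nat f" \<theta>])
    show "bij_betw \<theta> (carrier (deck infinite_cylinder)) {A. row_stabilizes (row_act B x) A}"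
      using bij by (simp add: infinite_cylinder_def half_plane_quotient_def y_def)
  qed (use up act mult ef(1) in \<open>auto simp: infinite_cylinder_def half_plane_quotient_def intro!: holomorphic_intros\<close>)
  thus ?thesis unfolding orbifold_isomorphic_def by blast
qed

lemma torsion_leaf:
  assumes N: "N \<ge> 2" and x: "exact_order N x"
  obtains f where "\<And>\<tau>. \<tau> \<in> upper_half \<Longrightarrow> f (quot_map (Y1 N) \<tau>) = moduli_proj (\<tau>, 1 / of_nat N)"
    "moduli_leaf \<alpha> a = f ` points (Y1 N)" "orbifold_iso (Y1 N) (leaf_orbifold \<alpha> a) f"
    "closed_algebraic_subvariety (moduli_leaf \<alpha> a)"
proof -
  have N0: "N > 0" using N by simp
  obtain B where B: "B \<in> carrier SL2Z" "row_act B x - (0, 1 / real N) \<in> int_pairs"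
    by (rule exact_order_normal_form[OF N x])
  have st: "{A. row_stabilizes (row_act B x) A} = carrier (Gamma1 N)"
    using row_stabilizes_torsion[OF N0 B(2)] by auto
  obtain f where f: "orbifold_iso (Y1 N) (leaf_orbifold \<alpha> a) f"
    "\<And>\<tau>. \<tau> \<in> upper_half \<Longrightarrow> f (quot_map (Y1 N) \<tau>) = moduli_proj (leaf_point x (moebius B \<tau>))"
  proof (rule leaf_orbifold_uniformization[OF orbit_quotient_Y1[OF N0] _ _ B(1),
        of "\<lambda>\<tau>. \<tau>" "\<lambda>\<tau>. \<tau>" "\<lambda>A. A"])
    show "bij_betw (\<lambda>A. A) (carrier (deck (Y1 N))) {A. row_stabilizes (row_act B x) A}"
      by (simp add: st Y1_def half_plane_quotient_def bij_betw_def)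
  qed (auto simp: Y1_def half_plane_quotient_def Gamma1_def SL2Z_def intro: moebius_in_upper_half)
  have f': "f (quot_map (Y1 N) \<tau>) = moduli_proj (\<tau>, 1 / of_nat N)" if "\<tau> \<in> upper_half" for \<tau>
    using f(2)[OF that] moduli_proj_leaf_point_torsion[OF N0 B that] by simp
  have pts: "f ` points (Y1 N) = moduli_leaf \<alpha> a"
    using f(1) by (simp add: orbifold_iso_def bij_betw_def points_def leaf_orbifold_def moduli_leaf_def)
  have "f ` points (Y1 N) = (\<lambda>\<tau>. f (quot_map (Y1 N) \<tau>)) ` upper_half"
    by (simp add: points_def image_image Y1_def half_plane_quotient_def)
  also have "\<dots> = (\<lambda>\<tau>. moduli_proj (\<tau>, 1 / of_nat N)) ` upper_half" by (intro image_cong refl f')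
  finally have "moduli_leaf \<alpha> a = (\<lambda>\<tau>. moduli_proj (\<tau>, 1 / of_nat N)) ` upper_half" using pts by simp
  thus ?thesis using that[of f] f' pts f(1) closed_algebraic_torsion_curve[OF N] by simp
qed

text \<open>One column of A - 1 is nonzero and pairs with x to an integer. Dividing the column by
  the gcd of its entries makes them coprime and leaves a rational number.\<close>

lemma rational_relation_of_stabilizer:
  assumes A: "row_stabilizes x A" "A \<noteq> mat 1"
  obtains m n where "coprime m n" "fst x * of_int m + snd x * of_int n \<in> \<rat>"
proof -
  note result = that
  have rel: thesis if cd: "(c, d) \<noteq> (0, 0)" "fst x * of_int c + snd x * of_int d \<in> \<int>" for c d :: int
  proof -
    obtain g m n where g: "g > 0" "c = g * m" "d = g * n" "coprime m n" by (rule coprime_multiple[OF cd(1)])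
    have "fst x * of_int m + snd x * of_int n = (fst x * of_int c + snd x * of_int d) / of_int g"
      using g(1) unfolding g(2,3) by (simp add: add_divide_distrib)
    also have "\<dots> \<in> \<rat>" using cd(2) Ints_subset_Rats by (intro Rats_divide) auto
    finally show ?thesis by (rule result[OF g(4)])
  qed
  have 1: "fst x * of_int (A$1$1 - 1) + snd x * of_int (A$2$1) \<in> \<int>"
    and 2: "fst x * of_int (A$1$2) + snd x * of_int (A$2$2 - 1) \<in> \<int>"
    using A(1) by (simp_all add: row_stabilizes_def row_act_def int_pairs_def algebra_simps)
  show ?thesis
  proof (cases "(A$1$1 - 1, A$2$1) = (0, 0) \<and> (A$1$2, A$2$2 - 1) = (0, 0)")
    case True
    hence "A = mat 1" by (intro mat2_eqI) auto
    thus ?thesis using A(2) by blast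
  qed (use rel 1 2 in blast)
qed

end

theorem theorem1p8:
  fixes \<alpha>1 :: real and a :: "real \<times> real"
  assumes "0 < \<alpha>1" and "\<alpha>1 < 1"
    and "a \<notin> scaled_lattice \<alpha>1"
  shows
    "(orbifold_iso (leaf_curve \<alpha>1 a) (leaf_orbifold \<alpha>1 a) moduli_proj \<and>
      orbifold_isomorphic half_plane (leaf_orbifold \<alpha>1 a))
   \<or> orbifold_isomorphic infinite_cylinder (leaf_orbifold \<alpha>1 a)
   \<or> (closed_algebraic_subvariety (moduli_leaf \<alpha>1 a) \<and>
      (\<exists>n::nat. n > 0 \<and> real n *\<^sub>R a \<in> scaled_lattice \<alpha>1) \<and>
      (\<forall>N::nat. N = (LEAST n. n > 0 \<and> real n *\<^sub>R a \<in> scaled_lattice \<alpha>1) \<longrightarrow>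
         N \<ge> 2 \<and>
         (\<exists>f. (\<forall>\<tau> \<in> upper_half. f (quot_map (Y1 N) \<tau>) = moduli_proj (\<tau>, 1 / of_nat N)) \<and>
              moduli_leaf \<alpha>1 a = f ` points (Y1 N) \<and>
              orbifold_iso (Y1 N) (leaf_orbifold \<alpha>1 a) f)))"
proof -
  have \<alpha>: "\<alpha>1 \<noteq> 0" using assms(1) by simp
  define x where "x = leaf_coords \<alpha>1 a"
  interpret veech_leaf \<alpha>1 a x
    by unfold_locales (use \<alpha> assms(3) in \<open>simp_all add: x_def\<close>)
  \<comment> \<open>Rational coordinates are split off at the outset, so that the case of a
    nontrivial stabilizer keeps an irrational coordinate, as \<open>parabolic_leaf\<close>
    demands.\<close>
  consider "fst x \<in> \<rat> \<and> snd x \<in> \<rat>" | A where "\<not> (fst x \<in> \<rat> \<and> snd x \<in> \<rat>)" "row_stabilizes x A" "A \<noteq> mat 1"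
    | "\<And>A. row_stabilizes x A \<Longrightarrow> A = mat 1" by blast
  thus ?thesis
  proof cases
    case 1
    let ?P = "\<lambda>n::nat. n > 0 \<and> real n *\<^sub>R a \<in> scaled_lattice \<alpha>1"
    have P: "?P n \<longleftrightarrow> n > 0 \<and> real n *\<^sub>R x \<in> int_pairs" for n
      using scaled_lattice_iff[OF \<alpha>, of "real n *\<^sub>R a"] by (simp add: leaf_coords_scaleR x_def)
    obtain c d m n where cd: "m > 0" "n > 0" "fst x = of_int c / of_nat m" "snd x = of_int d / of_nat n"
      using 1 by (metis Rats_nat_fraction)
    \<comment> \<open>The product of the two denominators is a common denominator, which shows that
      the least N is taken over a nonempty set.\<close>
    have "real (m * n) *\<^sub>R x = (of_int (c * int n), of_int (d * int m))"
      using cd by (simp add: prod_eq_iff)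
    hence "real (m * n) *\<^sub>R x \<in> int_pairs" by (metis int_pairsI)
    hence ex: "\<exists>n. ?P n" using P[of "m * n"] cd by (metis nat_0_less_mult_iff)
    define N where "N = (LEAST n. ?P n)"
    have PN: "?P N" using LeastI_ex[OF ex] by (simp add: N_def)
    have min: "\<not> ?P n" if "n < N" for n using not_less_Least[of n ?P] that by (simp add: N_def)
    \<comment> \<open>For N = 1 the point \<open>a\<close> itself would lie in the scaled
      lattice.\<close>
    have "N \<noteq> 1"
    proof
      assume "N = 1"
      thus False using PN assms(3) by simp
    qed
    hence N2: "N \<ge> 2" using PN by linarith
    have "exact_order N x" using PN min P by (auto simp: exact_order_def)
    then obtain f where "\<And>\<tau>. \<tau> \<in> upper_half \<Longrightarrow> f (quot_map (Y1 N) \<tau>) = moduli_proj (\<tau>, 1 / of_nat N)"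
      "moduli_leaf \<alpha>1 a = f ` points (Y1 N)" "orbifold_iso (Y1 N) (leaf_orbifold \<alpha>1 a) f"
      "closed_algebraic_subvariety (moduli_leaf \<alpha>1 a)"
      by (rule torsion_leaf[OF N2]) (rule that)
    thus ?thesis using ex N2 unfolding N_def[symmetric] by blast
  next
    case (2 A)
    obtain m n where "coprime m n" "fst x * of_int m + snd x * of_int n \<in> \<rat>"
      by (rule rational_relation_of_stabilizer[OF 2(2,3)])
    from parabolic_leaf[OF this 2(1)] show ?thesis by blast
  next
    case 3
    from trivial_leaf[OF 3] show ?thesis by blast
  qed
qed

end
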